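(* Let $k$ be an algebraically closed field of characteristic zero, let $n\ge 3$, and consider the monomial artinian ideal $$I=(x_0,x_1,\dots,x_{n-2})^3+(x_{n-1}^3,\,x_n^3,\,x_0x_{n-1}x_n,\,x_1x_{n-1}x_n,\dots,x_{n-2}x_{n-1}x_n)\subset k[x_0,\dots,x_n].$$ Then $\dim_k (I^{-1})_3=n(n+1)$, and the closure $X\subset\mathbb{P}^{n(n+1)-1}$ of the image of the rational map $\varphi_{(I^{-1})_3}:\mathbb{P}^n\dashrightarrow\mathbb{P}^{n(n+1)-1}$ is a smooth $n$-fold, isomorphic to $\mathbb{P}^n$ blown up at the linear space $x_{n-1}=x_n=0$ and at the two points $(0,\dots,0,1,0)$ and $(0,\dots,0,1)$. Moreover, $X$ satisfies a Laplace equation of order $2$.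
   Context: For a monomial ideal $I\subset k[x_0,\dots,x_n]$, $(I^{-1})_3$ denotes the span of the degree $3$ monomials not in $I$, and $\varphi_{(I^{-1})_3}$ is the rational map from $\mathbb{P}^n$ whose homogeneous components are these monomials. An $n$-dimensional variety $X\subset\mathbb{P}^N$ satisfies a Laplace equation of order $2$ if its projective second osculating space at a general point (the span of all partial derivatives of order $\le 2$ of a local parametrization of $X$) has dimension smaller than the expected dimension $\binom{n+2}{2}-1$. *)

theory Defs
  imports
    "HOL-Library.Poly_Mapping"
    "HOL-Library.Function_Algebras"
    "HOL-Library.Extended_Nat"
    "HOL-Computational_Algebra.Polynomial"
    "HOL-Algebra.Ideal_Product"
    "HOL-Analysis.Abstract_Topology"
begin

section \<open>Polynomials\<close>

type_synonym ('i, 'a) mpoly = "('i \<Rightarrow>\<^sub>0 nat) \<Rightarrow>\<^sub>0 'a"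

abbreviation mvar :: "'i \<Rightarrow> ('i, 'a::comm_ring_1) mpoly"
  where "mvar i \<equiv> Poly_Mapping.single (Poly_Mapping.single i 1) 1"

definition mdeg :: "('i \<Rightarrow>\<^sub>0 nat) \<Rightarrow> nat"
  where "mdeg m = (\<Sum>i\<in>Poly_Mapping.keys m. Poly_Mapping.lookup m i)"

text \<open>The polynomial ring \<open>k[x\<^sub>j | j \<in> J]\<close>, as a ring in the sense of HOL-Algebra.\<close>

definition poly_ring :: "'i set \<Rightarrow> ('i, 'a::comm_ring_1) mpoly ring"
  where "poly_ring J =
    \<lparr>carrier = {p. \<forall>m\<in>Poly_Mapping.keys p. Poly_Mapping.keys m \<subseteq> J},
     mult = (*), one = 1, zero = 0, add = (+)\<rparr>"

lemma cring_poly_ring: "cring (poly_ring J :: ('i, 'a::comm_ring_1) mpoly ring)"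
proof (rule cringI)
  let ?R = "poly_ring J :: ('i, 'a) mpoly ring"
  have add: "p + q \<in> carrier ?R" if "p \<in> carrier ?R" "q \<in> carrier ?R" for p q
    using that Poly_Mapping.keys_add[of p q] by (fastforce simp: poly_ring_def)
  show "abelian_group ?R"
  proof (rule abelian_groupI)
    fix p assume p: "p \<in> carrier ?R"
    then have "- p \<in> carrier ?R" by (simp add: poly_ring_def)
    then show "\<exists>q\<in>carrier ?R. q \<oplus>\<^bsub>?R\<^esub> p = \<zero>\<^bsub>?R\<^esub>"
      by (intro bexI[of _ "- p"]) (auto simp: poly_ring_def)
  next
    fix p q r
    show "p \<oplus>\<^bsub>?R\<^esub> q \<in> carrier ?R" if "p \<in> carrier ?R" "q \<in> carrier ?R"
      using add[OF that] by (simp add: poly_ring_def)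
    show "p \<oplus>\<^bsub>?R\<^esub> q \<oplus>\<^bsub>?R\<^esub> r = p \<oplus>\<^bsub>?R\<^esub> (q \<oplus>\<^bsub>?R\<^esub> r)" by (simp add: poly_ring_def add.assoc)
    show "p \<oplus>\<^bsub>?R\<^esub> q = q \<oplus>\<^bsub>?R\<^esub> p" by (simp add: poly_ring_def add.commute)
  qed (simp_all add: poly_ring_def)
  have mult: "p * q \<in> carrier ?R" if p: "p \<in> carrier ?R" and q: "q \<in> carrier ?R" for p q
  proof -
    have "Poly_Mapping.keys m \<subseteq> J" if m0: "m \<in> Poly_Mapping.keys (p * q)" for m
    proof -
      obtain a b where m: "m = a + b" "a \<in> Poly_Mapping.keys p" "b \<in> Poly_Mapping.keys q"
        using m0 Poly_Mapping.keys_mult[of p q] by blast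
      then show ?thesis
        using p q Poly_Mapping.keys_add[of a b] by (fastforce simp: poly_ring_def)
    qed
    then show ?thesis by (auto simp: poly_ring_def)
  qed
  show "Group.comm_monoid ?R"
  proof (rule comm_monoidI)
    fix p q r
    show "p \<otimes>\<^bsub>?R\<^esub> q \<in> carrier ?R" if "p \<in> carrier ?R" "q \<in> carrier ?R"
      using mult[OF that] by (simp add: poly_ring_def)
    show "p \<otimes>\<^bsub>?R\<^esub> q \<otimes>\<^bsub>?R\<^esub> r = p \<otimes>\<^bsub>?R\<^esub> (q \<otimes>\<^bsub>?R\<^esub> r)" by (simp add: poly_ring_def mult.assoc)
    show "p \<otimes>\<^bsub>?R\<^esub> q = q \<otimes>\<^bsub>?R\<^esub> p" by (simp add: poly_ring_def mult.commute)
  qed (simp_all add: poly_ring_def)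
qed (auto simp: poly_ring_def distrib_right)

definition forms :: "'i set \<Rightarrow> nat \<Rightarrow> ('i, 'a::comm_ring_1) mpoly set"
  where "forms J d = {p \<in> carrier (poly_ring J). \<forall>m\<in>Poly_Mapping.keys p. mdeg m = d}"

text \<open>\<open>psubst c g p\<close> substitutes \<open>g\<close> for the variables of \<open>p\<close>, the coefficients being mapped by \<open>c\<close>.\<close>

definition psubst ::
    "('a::zero \<Rightarrow> 'b::comm_semiring_1) \<Rightarrow> ('i \<Rightarrow> 'b) \<Rightarrow> ('i, 'a) mpoly \<Rightarrow> 'b"
  where "psubst c g p = (\<Sum>m\<in>Poly_Mapping.keys p. c (Poly_Mapping.lookup p m) *
           (\<Prod>i\<in>Poly_Mapping.keys m. g i ^ Poly_Mapping.lookup m i))"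

definition peval :: "('i \<Rightarrow> 'a) \<Rightarrow> ('i, 'a::comm_ring_1) mpoly \<Rightarrow> 'a"
  where "peval v p = psubst (\<lambda>c. c) v p"

lemma peval_superset:
  assumes "finite S" "Poly_Mapping.keys p \<subseteq> S"
  shows "peval v p = (\<Sum>m\<in>S. Poly_Mapping.lookup p m *
           (\<Prod>i\<in>Poly_Mapping.keys m. v i ^ Poly_Mapping.lookup m i))"
  unfolding peval_def psubst_def
  by (rule sum.mono_neutral_left) (use assms in \<open>auto simp: in_keys_iff\<close>)

lemma peval_add: "peval v (p + q) = peval v p + peval v q"
proof -
  let ?S = "Poly_Mapping.keys p \<union> Poly_Mapping.keys q"
  have "Poly_Mapping.keys (p + q) \<subseteq> ?S" by (rule Poly_Mapping.keys_add)
  then show ?thesis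
    using peval_superset[of ?S "p + q" v] peval_superset[of ?S p v] peval_superset[of ?S q v]
    by (simp add: lookup_add distrib_right sum.distrib)
qed

lemma peval_sum: "peval v (\<Sum>a\<in>A. h a) = (\<Sum>a\<in>A. peval v (h a))"
  by (induction A rule: infinite_finite_induct) (simp_all add: peval_add, simp_all add: peval_def psubst_def)

lemma peval_single:
  "peval v (Poly_Mapping.single m c) =
    c * (\<Prod>i\<in>Poly_Mapping.keys m. v i ^ Poly_Mapping.lookup m i)"
  by (cases "c = 0") (simp_all add: peval_def psubst_def)

lemma monomial_value_add:
  fixes v :: "'i \<Rightarrow> 'a::comm_ring_1" and m m' :: "'i \<Rightarrow>\<^sub>0 nat"
  shows "(\<Prod>i\<in>Poly_Mapping.keys (m + m'). v i ^ Poly_Mapping.lookup (m + m') i) =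
    (\<Prod>i\<in>Poly_Mapping.keys m. v i ^ Poly_Mapping.lookup m i) *
    (\<Prod>i\<in>Poly_Mapping.keys m'. v i ^ Poly_Mapping.lookup m' i)"
proof -
  let ?S = "Poly_Mapping.keys m \<union> Poly_Mapping.keys m'"
  have *: "(\<Prod>i\<in>Poly_Mapping.keys k. v i ^ Poly_Mapping.lookup k i) =
      (\<Prod>i\<in>?S. v i ^ Poly_Mapping.lookup k i)" if "Poly_Mapping.keys k \<subseteq> ?S" for k
    by (rule prod.mono_neutral_left) (use that in \<open>auto simp: in_keys_iff\<close>)
  show ?thesis
    using *[of m] *[of m'] *[of "m + m'"] Poly_Mapping.keys_add[of m m']
    by (simp add: lookup_add power_add prod.distrib)
qed

lemma sum_single_lookup: "(\<Sum>m\<in>Poly_Mapping.keys p. Poly_Mapping.single m (Poly_Mapping.lookup p m)) = p"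
  by (rule poly_mapping_eqI) (simp add: lookup_sum lookup_single when_def in_keys_iff)

lemma peval_mult: "peval v (p * q) = peval v p * peval v q"
proof -
  let ?s = "\<lambda>p m. Poly_Mapping.single m (Poly_Mapping.lookup p m)"
  let ?K = "Poly_Mapping.keys"
  have s: "peval v (?s p m * ?s q m') = peval v (?s p m) * peval v (?s q m')" for m m'
    by (simp add: mult_single peval_single monomial_value_add mult_ac)
  have "peval v (p * q) = peval v ((\<Sum>m\<in>?K p. ?s p m) * (\<Sum>m\<in>?K q. ?s q m))"
    by (simp only: sum_single_lookup)
  also have "\<dots> = (\<Sum>m\<in>?K p. \<Sum>m'\<in>?K q. peval v (?s p m) * peval v (?s q m'))"
    by (simp only: sum_product peval_sum s)
  also have "\<dots> = peval v (\<Sum>m\<in>?K p. ?s p m) * peval v (\<Sum>m\<in>?K q. ?s q m)"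
    by (simp only: sum_product peval_sum)
  finally show ?thesis by (simp only: sum_single_lookup)
qed

lemma mdeg_add: "mdeg (m + m') = mdeg m + mdeg m'"
proof -
  let ?S = "Poly_Mapping.keys m \<union> Poly_Mapping.keys m'"
  have *: "mdeg k = (\<Sum>i\<in>?S. Poly_Mapping.lookup k i)" if "Poly_Mapping.keys k \<subseteq> ?S" for k
    unfolding mdeg_def by (rule sum.mono_neutral_left) (use that in \<open>auto simp: in_keys_iff\<close>)
  show ?thesis
    using *[of m] *[of m'] *[of "m + m'"] Poly_Mapping.keys_add[of m m']
    by (simp add: lookup_add sum.distrib)
qed

lemma forms_mult:
  assumes "p \<in> forms J d" "q \<in> forms J e"
  shows "p * q \<in> forms J (d + e)"
proof -
  have "p * q \<in> carrier (poly_ring J)"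
    using cring.cring_simprules(5)[OF cring_poly_ring[of J]] assms
    by (auto simp: forms_def poly_ring_def)
  moreover have "mdeg m = d + e" if m: "m \<in> Poly_Mapping.keys (p * q)" for m
  proof -
    obtain a b where "m = a + b" "a \<in> Poly_Mapping.keys p" "b \<in> Poly_Mapping.keys q"
      using m Poly_Mapping.keys_mult[of p q] by blast
    with assms show ?thesis by (auto simp: mdeg_add forms_def)
  qed
  ultimately show ?thesis by (simp add: forms_def)
qed

lemma peval_scale:
  assumes "p \<in> forms J d"
  shows "peval (\<lambda>i. c * v i) p = c ^ d * peval v p"
proof -
  have "(\<Prod>i\<in>Poly_Mapping.keys m. (c * v i) ^ Poly_Mapping.lookup m i) =
      c ^ d * (\<Prod>i\<in>Poly_Mapping.keys m. v i ^ Poly_Mapping.lookup m i)"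
    if "m \<in> Poly_Mapping.keys p" for m
  proof -
    have "d = mdeg m" using assms that by (auto simp: forms_def)
    then show ?thesis by (simp add: power_mult_distrib prod.distrib power_sum mdeg_def)
  qed
  then show ?thesis by (simp add: peval_def psubst_def sum_distrib_left mult_ac)
qed

definition pdiff :: "'i \<Rightarrow> ('i, 'a::comm_ring_1) mpoly \<Rightarrow> ('i, 'a) mpoly"
  where "pdiff j p = (\<Sum>m\<in>Poly_Mapping.keys p.
           Poly_Mapping.single (m - Poly_Mapping.single j 1)
             (of_nat (Poly_Mapping.lookup m j) * Poly_Mapping.lookup p m))"

abbreviation poly_scale :: "'a::field \<Rightarrow> ('i, 'a) mpoly \<Rightarrow> ('i, 'a) mpoly"
  where "poly_scale c p \<equiv> Poly_Mapping.single 0 c * p"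

lemma vector_space_poly_scale: "vector_space (poly_scale :: 'a::field \<Rightarrow> ('i, 'a) mpoly \<Rightarrow> _)"
  by unfold_locales (simp_all add: distrib_left distrib_right single_add mult_single flip: mult.assoc)

definition standard_monomials :: "'i set \<Rightarrow> ('i, 'a::field) mpoly set \<Rightarrow> nat \<Rightarrow> ('i \<Rightarrow>\<^sub>0 nat) set"
  where "standard_monomials J I d =
    {m. Poly_Mapping.keys m \<subseteq> J \<and> mdeg m = d \<and> Poly_Mapping.single m 1 \<notin> I}"

text \<open>The graded piece \<open>(I\<^sup>-\<^sup>1)\<^sub>d\<close> for a monomial ideal \<open>I\<close>.\<close>

definition inverse_system :: "'i set \<Rightarrow> ('i, 'a::field) mpoly set \<Rightarrow> nat \<Rightarrow> ('i, 'a) mpoly set"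
  where "inverse_system J I d =
    module.span poly_scale ((\<lambda>m. Poly_Mapping.single m 1) ` standard_monomials J I d)"


section \<open>Projective spaces\<close>

text \<open>
  Coordinates are indexed by a finite set \<open>J\<close>, and vectors vanish outside \<open>J\<close>.  A point of the
  projective space is the set of its homogeneous coordinate vectors, all of them non-zero.
\<close>

definition affine_space :: "'i set \<Rightarrow> ('i \<Rightarrow> 'a::field) set"
  where "affine_space J = {v. \<forall>i. i \<notin> J \<longrightarrow> v i = 0}"

definition proj_pt :: "('i \<Rightarrow> 'a::field) \<Rightarrow> ('i \<Rightarrow> 'a) set"
  where "proj_pt v = {\<lambda>i. c * v i | c. c \<noteq> 0}"

definition proj_space :: "'i set \<Rightarrow> ('i \<Rightarrow> 'a::field) set set"
  where "proj_space J = proj_pt ` (affine_space J - {0})"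

definition zero_locus :: "'i set \<Rightarrow> ('i, 'a::field) mpoly set \<Rightarrow> ('i \<Rightarrow> 'a) set set"
  where "zero_locus J S = {x \<in> proj_space J. \<forall>f\<in>S. \<forall>v\<in>x. peval v f = 0}"

definition zariski :: "'i set \<Rightarrow> ('i \<Rightarrow> 'a::field) set topology"
  where "zariski J =
    topology (\<lambda>U. \<exists>S. S \<subseteq> (\<Union>d. forms J d) \<and> U = proj_space J - zero_locus J S)"

lemma form_zero_on_point:
  assumes "x \<in> proj_space J" "p \<in> forms J d" "v \<in> x" "peval v p = 0" "w \<in> x"
  shows "peval w p = 0"
proof -
  obtain u where x: "x = proj_pt u" using assms(1) by (auto simp: proj_space_def)
  obtain a b where "v = (\<lambda>i. a * u i)" "a \<noteq> 0" "w = (\<lambda>i. b * u i)"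
    using assms(3,5) by (auto simp: x proj_pt_def)
  then show ?thesis using peval_scale[OF assms(2)] assms(4) by simp
qed

lemma istopology_zariski:
  "istopology (\<lambda>U. \<exists>S :: ('i, 'a::field) mpoly set.
     S \<subseteq> (\<Union>d. forms J d) \<and> U = proj_space J - zero_locus J S)"
  unfolding istopology_def
proof (intro conjI allI impI)
  fix U V assume "\<exists>S :: ('i, 'a) mpoly set. S \<subseteq> (\<Union>d. forms J d) \<and> U = proj_space J - zero_locus J S"
    "\<exists>S :: ('i, 'a) mpoly set. S \<subseteq> (\<Union>d. forms J d) \<and> V = proj_space J - zero_locus J S"
  then obtain S T :: "('i, 'a) mpoly set" where
    S: "S \<subseteq> (\<Union>d. forms J d)" "U = proj_space J - zero_locus J S" and
    T: "T \<subseteq> (\<Union>d. forms J d)" "V = proj_space J - zero_locus J T" by blast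
  let ?P = "{p * q | p q. p \<in> S \<and> q \<in> T}"
  have P: "?P \<subseteq> (\<Union>d. forms J d)"
  proof
    fix f assume "f \<in> ?P"
    then obtain p q where f: "f = p * q" "p \<in> S" "q \<in> T" by blast
    then obtain d e where "p \<in> forms J d" "q \<in> forms J e" using S(1) T(1) by blast
    then have "f \<in> forms J (d + e)" unfolding f by (rule forms_mult)
    then show "f \<in> (\<Union>d. forms J d)" by blast
  qed
  have "zero_locus J ?P = zero_locus J S \<union> zero_locus J T"
  proof (intro equalityI subsetI)
    fix x assume x: "x \<in> zero_locus J ?P"
    then have xJ: "x \<in> proj_space J" by (simp add: zero_locus_def)
    show "x \<in> zero_locus J S \<union> zero_locus J T"
    proof (rule ccontr)
      assume "\<not> ?thesis"
      then obtain p q v w where pq: "p \<in> S" "q \<in> T" "v \<in> x" "w \<in> x" "peval v p \<noteq> 0" "peval w q \<noteq> 0"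
        using xJ by (auto simp: zero_locus_def)
      obtain e where "q \<in> forms J e" using T(1) pq by blast
      then have "peval v q \<noteq> 0" using form_zero_on_point[OF xJ] pq by blast
      moreover have "peval v (p * q) = 0" using x pq unfolding zero_locus_def by blast
      ultimately show False using pq by (simp add: peval_mult)
    qed
  qed (auto simp: zero_locus_def peval_mult)
  then show "\<exists>S :: ('i, 'a) mpoly set. S \<subseteq> (\<Union>d. forms J d) \<and> U \<inter> V = proj_space J - zero_locus J S"
    using P S(2) T(2) by (intro exI[of _ ?P]) auto
next
  fix K assume "\<forall>U\<in>K. \<exists>S :: ('i, 'a) mpoly set. S \<subseteq> (\<Union>d. forms J d) \<and> U = proj_space J - zero_locus J S"
  then obtain S :: "_ \<Rightarrow> ('i, 'a) mpoly set" where
    S: "\<And>U. U \<in> K \<Longrightarrow> S U \<subseteq> (\<Union>d. forms J d)"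
       "\<And>U. U \<in> K \<Longrightarrow> U = proj_space J - zero_locus J (S U)" by metis
  have "x \<in> \<Union>K \<longleftrightarrow> x \<in> proj_space J - zero_locus J (\<Union>U\<in>K. S U)" for x
  proof
    assume "x \<in> \<Union>K"
    then obtain U where "U \<in> K" "x \<in> proj_space J - zero_locus J (S U)" using S(2) by blast
    then show "x \<in> proj_space J - zero_locus J (\<Union>U\<in>K. S U)"
      unfolding zero_locus_def by blast
  next
    assume "x \<in> proj_space J - zero_locus J (\<Union>U\<in>K. S U)"
    then obtain U where "U \<in> K" "x \<in> proj_space J - zero_locus J (S U)"
      unfolding zero_locus_def by blast
    then show "x \<in> \<Union>K" using S(2) by blast
  qed
  then have "\<Union>K = proj_space J - zero_locus J (\<Union>U\<in>K. S U)" by blast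
  moreover have "(\<Union>U\<in>K. S U) \<subseteq> (\<Union>d. forms J d)" using S(1) by blast
  ultimately show "\<exists>S :: ('i, 'a) mpoly set. S \<subseteq> (\<Union>d. forms J d) \<and> \<Union>K = proj_space J - zero_locus J S"
    by blast
qed

lemma openin_zariski:
  "openin (zariski J) U \<longleftrightarrow>
    (\<exists>S. S \<subseteq> (\<Union>d. forms J d) \<and> U = proj_space J - zero_locus J S)"
  unfolding zariski_def by (simp add: topology_inverse'[OF istopology_zariski])

lemma topspace_zariski: "topspace (zariski J) = (proj_space J :: ('i \<Rightarrow> 'a::field) set set)"
proof -
  have "(1 :: ('i, 'a) mpoly) \<in> forms J 0"
    by (simp add: forms_def poly_ring_def mdeg_def flip: single_one)
  moreover have "zero_locus J {1 :: ('i, 'a) mpoly} = {}"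
  proof -
    have "peval v (1 :: ('i, 'a) mpoly) = 1" for v
      using peval_single[of v 0 1] by simp
    moreover have "u \<in> proj_pt u" for u :: "'i \<Rightarrow> 'a"
      unfolding proj_pt_def by (intro CollectI exI[of _ 1]) simp
    ultimately show ?thesis by (fastforce simp: zero_locus_def proj_space_def)
  qed
  ultimately have "openin (zariski J) (proj_space J :: ('i \<Rightarrow> 'a) set set)"
    unfolding openin_zariski by (intro exI[of _ "{1}"]) auto
  then show ?thesis
    by (intro equalityI openin_subset) (auto simp: topspace_def openin_zariski)
qed

lemma closedin_zariski:
  fixes Z :: "('i \<Rightarrow> 'a::field) set set"
  shows "closedin (zariski J) Z \<longleftrightarrow> (\<exists>S. S \<subseteq> (\<Union>d. forms J d) \<and> Z = zero_locus J S)"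
proof -
  have sub: "zero_locus J S \<subseteq> proj_space J" for S :: "('i, 'a) mpoly set"
    by (auto simp: zero_locus_def)
  have eq: "Z \<subseteq> proj_space J \<and> proj_space J - Z = proj_space J - zero_locus J S \<longleftrightarrow> Z = zero_locus J S"
    for S :: "('i, 'a) mpoly set" using sub[of S] by blast
  show ?thesis
    unfolding closedin_def topspace_zariski openin_zariski using eq by blast
qed

text \<open>
  Polynomials vanishing on the cone over \<open>X\<close>; over an infinite field this is the homogeneous ideal
  of \<open>X\<close> whenever \<open>X\<close> is non-empty.
\<close>

definition vanishing_ideal :: "'i set \<Rightarrow> ('i \<Rightarrow> 'a::field) set set \<Rightarrow> ('i, 'a) mpoly set"
  where "vanishing_ideal J X =
    {p \<in> carrier (poly_ring J). \<forall>x\<in>X. \<forall>v\<in>x. peval v p = 0}"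

definition irreducible_in :: "'b topology \<Rightarrow> 'b set \<Rightarrow> bool"
  where "irreducible_in T S \<longleftrightarrow> S \<noteq> {} \<and> S \<subseteq> topspace T \<and>
    (\<forall>A B. closedin T A \<and> closedin T B \<and> S \<subseteq> A \<union> B \<longrightarrow> S \<subseteq> A \<or> S \<subseteq> B)"

definition krull_dim :: "'b topology \<Rightarrow> enat"
  where "krull_dim T = Sup {enat m | m. \<exists>C :: nat \<Rightarrow> 'b set.
    (\<forall>i\<le>m. closedin T (C i) \<and> irreducible_in T (C i)) \<and> (\<forall>i<m. C i \<subset> C (Suc i))}"


section \<open>Linear algebra in \<open>k\<^sup>J\<close>\<close>

abbreviation vec_scale :: "'a::field \<Rightarrow> ('i \<Rightarrow> 'a) \<Rightarrow> 'i \<Rightarrow> 'a"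
  where "vec_scale c v \<equiv> (\<lambda>i. c * v i)"

abbreviation vec_span :: "('i \<Rightarrow> 'a::field) set \<Rightarrow> ('i \<Rightarrow> 'a) set"
  where "vec_span \<equiv> module.span vec_scale"

abbreviation vec_dim :: "('i \<Rightarrow> 'a::field) set \<Rightarrow> nat"
  where "vec_dim \<equiv> vector_space.dim vec_scale"

lemma vector_space_vec_scale: "vector_space (vec_scale :: 'a::field \<Rightarrow> ('i \<Rightarrow> 'a) \<Rightarrow> 'i \<Rightarrow> 'a)"
  by unfold_locales (auto simp: fun_eq_iff algebra_simps)


section \<open>Smooth varieties\<close>

text \<open>
  The embedded tangent space of \<open>X\<close> at the point with coordinates \<open>v\<close>, as a linear subspace of
  \<open>k\<^sup>J\<close>: its projective dimension is one less than its dimension.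
\<close>

definition tangent_space :: "'i set \<Rightarrow> ('i \<Rightarrow> 'a::field) set set \<Rightarrow> ('i \<Rightarrow> 'a) \<Rightarrow> ('i \<Rightarrow> 'a) set"
  where "tangent_space J X v = {w \<in> affine_space J.
    \<forall>f\<in>vanishing_ideal J X. (\<Sum>j\<in>J. peval v (pdiff j f) * w j) = 0}"

definition smooth_variety :: "'i set \<Rightarrow> nat \<Rightarrow> ('i \<Rightarrow> 'a::field) set set \<Rightarrow> bool"
  where "smooth_variety J d X \<longleftrightarrow>
    closedin (zariski J) X \<and> irreducible_in (zariski J) X \<and>
    krull_dim (subtopology (zariski J) X) = enat d \<and>
    (\<forall>x\<in>X. \<forall>v\<in>x. vec_dim (tangent_space J X v) = d + 1)"


section \<open>Rational and regular maps\<close>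

definition eval_tuple ::
    "'j set \<Rightarrow> ('j \<Rightarrow> ('i, 'a::field) mpoly) \<Rightarrow> ('i \<Rightarrow> 'a) \<Rightarrow> 'j \<Rightarrow> 'a"
  where "eval_tuple K f v = (\<lambda>j. if j \<in> K then peval v (f j) else 0)"

text \<open>Closure of the image of the rational map given by a family \<open>f\<close> of forms of equal degree.\<close>

definition image_closure ::
    "'i set \<Rightarrow> 'j set \<Rightarrow> ('j \<Rightarrow> ('i, 'a::field) mpoly) \<Rightarrow> ('j \<Rightarrow> 'a) set set"
  where "image_closure J K f = zariski K closure_of
    {proj_pt (eval_tuple K f v) | v. v \<in> affine_space J \<and> eval_tuple K f v \<noteq> 0}"

definition regular_map ::
    "'i set \<Rightarrow> ('i \<Rightarrow> 'a::field) set set \<Rightarrow> 'j set \<Rightarrow> ('j \<Rightarrow> 'a) set set \<Rightarrow>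
     (('i \<Rightarrow> 'a) set \<Rightarrow> ('j \<Rightarrow> 'a) set) \<Rightarrow> bool"
  where "regular_map J X K Y F \<longleftrightarrow> F ` X \<subseteq> Y \<and>
    (\<forall>x\<in>X. \<exists>U d G. openin (zariski J) U \<and> x \<in> U \<and> (\<forall>k\<in>K. G k \<in> forms J d) \<and>
      (\<forall>y\<in>X \<inter> U. \<forall>v\<in>y. eval_tuple K G v \<noteq> 0 \<and> F y = proj_pt (eval_tuple K G v)))"

definition isomorphic ::
    "'i set \<Rightarrow> ('i \<Rightarrow> 'a::field) set set \<Rightarrow> 'j set \<Rightarrow> ('j \<Rightarrow> 'a) set set \<Rightarrow> bool"
  where "isomorphic J X K Y \<longleftrightarrow> (\<exists>F G. regular_map J X K Y F \<and> regular_map K Y J X G \<and>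
    (\<forall>x\<in>X. G (F x) = x) \<and> (\<forall>y\<in>Y. F (G y) = y))"


section \<open>Blow-ups of projective space\<close>

definition segre :: "('i \<Rightarrow> 'a::field) \<Rightarrow> ('j \<Rightarrow> 'a) \<Rightarrow> ('i \<times> 'j \<Rightarrow> 'a) set"
  where "segre v w = proj_pt (\<lambda>(i, j). v i * w j)"

text \<open>
  \<open>B\<close> is a model of the blow-up of \<open>\<P>\<^sup>J\<close> along the reduced closed subset \<open>Y\<close>: it is the closure,
  inside \<open>\<P>\<^sup>J \<times> \<P>\<^sup>r\<close>, of the graph of the rational map given by forms \<open>f\<^sub>0, \<dots>, f\<^sub>r\<close> of a common
  degree \<open>d\<close> which generate the ideal of \<open>Y\<close> in all degrees \<open>\<ge> d\<close>, hence generate its ideal sheaf.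
  The product is realised by its Segre embedding.  Up to isomorphism over \<open>\<P>\<^sup>J\<close> the result does
  not depend on the choice of the \<open>f\<^sub>i\<close>, and the blow-up along a disjoint union is the composite of
  the blow-ups along its components.
\<close>

definition is_blowup ::
    "'i set \<Rightarrow> ('i \<Rightarrow> 'a::field) set set \<Rightarrow> nat \<Rightarrow> ('i \<times> nat \<Rightarrow> 'a) set set \<Rightarrow> bool"
  where "is_blowup J Y r B \<longleftrightarrow> (\<exists>d f.
    (\<forall>i\<le>r. f i \<in> forms J d) \<and>
    (\<forall>e\<ge>d. genideal (poly_ring J) (f ` {..r}) \<inter> forms J e = vanishing_ideal J Y \<inter> forms J e) \<and>
    B = zariski (J \<times> {..r}) closure_of
      {segre v (eval_tuple {..r} f v) | v. v \<in> affine_space J \<and> eval_tuple {..r} f v \<noteq> 0})"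


section \<open>Osculating spaces and Laplace equations\<close>

text \<open>
  Over a general field, a local parametrization of a \<open>d\<close>-dimensional variety is a formal one: a
  tuple \<open>\<Phi>\<close> of power series in \<open>t\<^sub>0, \<dots>, t\<^sub>d\<^sub>-\<^sub>1\<close>, where \<open>\<Phi> j \<alpha>\<close> is the coefficient of \<open>t\<^sup>\<alpha>\<close> in the
  homogeneous coordinate \<open>\<Phi>\<^sub>j\<close>.  For a polynomial \<open>F\<close>, the series \<open>F(\<Phi>)\<close> is zero iff for every \<open>m\<close>
  the polynomial obtained by truncating \<open>\<Phi>\<close> after degree \<open>m\<close> has no term of degree \<open>\<le> m\<close>.
\<close>

definition multi_indices :: "nat \<Rightarrow> nat \<Rightarrow> (nat \<Rightarrow>\<^sub>0 nat) set"
  where "multi_indices d m = {\<alpha>. Poly_Mapping.keys \<alpha> \<subseteq> {..<d} \<and> mdeg \<alpha> \<le> m}"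

definition truncated :: "nat \<Rightarrow> nat \<Rightarrow> ((nat \<Rightarrow>\<^sub>0 nat) \<Rightarrow> 'a) \<Rightarrow> (nat, 'a::comm_ring_1) mpoly"
  where "truncated d m \<phi> = (\<Sum>\<alpha>\<in>multi_indices d m. Poly_Mapping.single \<alpha> (\<phi> \<alpha>))"

definition series_solution ::
    "nat \<Rightarrow> ('i \<Rightarrow> (nat \<Rightarrow>\<^sub>0 nat) \<Rightarrow> 'a::field) \<Rightarrow> ('i, 'a) mpoly \<Rightarrow> bool"
  where "series_solution d \<Phi> F \<longleftrightarrow> (\<forall>m. \<forall>\<beta>\<in>multi_indices d m.
    Poly_Mapping.lookup (psubst (Poly_Mapping.single 0) (\<lambda>j. truncated d m (\<Phi> j)) F) \<beta> = 0)"

text \<open>The vector of partial derivatives \<open>\<partial>\<^sup>\<alpha>\<Phi>\<close> at the origin.\<close>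

definition partial_at_0 ::
    "('i \<Rightarrow> (nat \<Rightarrow>\<^sub>0 nat) \<Rightarrow> 'a::field) \<Rightarrow> (nat \<Rightarrow>\<^sub>0 nat) \<Rightarrow> 'i \<Rightarrow> 'a"
  where "partial_at_0 \<Phi> \<alpha> =
    (\<lambda>j. (\<Prod>i\<in>Poly_Mapping.keys \<alpha>. of_nat (fact (Poly_Mapping.lookup \<alpha> i))) * \<Phi> j \<alpha>)"

definition osculating_space ::
    "nat \<Rightarrow> ('i \<Rightarrow> (nat \<Rightarrow>\<^sub>0 nat) \<Rightarrow> 'a::field) \<Rightarrow> nat \<Rightarrow> ('i \<Rightarrow> 'a) set"
  where "osculating_space d \<Phi> k = vec_span (partial_at_0 \<Phi> ` multi_indices d k)"

text \<open>The last condition says that \<open>\<Phi>\<close> is an immersion at the origin.\<close>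

definition local_parametrization ::
    "'i set \<Rightarrow> ('i \<Rightarrow> 'a::field) set set \<Rightarrow> nat \<Rightarrow> ('i \<Rightarrow> 'a) set \<Rightarrow>
     ('i \<Rightarrow> (nat \<Rightarrow>\<^sub>0 nat) \<Rightarrow> 'a) \<Rightarrow> bool"
  where "local_parametrization J X d x \<Phi> \<longleftrightarrow>
    (\<forall>j \<alpha>. \<Phi> j \<alpha> \<noteq> 0 \<longrightarrow> j \<in> J \<and> Poly_Mapping.keys \<alpha> \<subseteq> {..<d}) \<and>
    (\<forall>F\<in>vanishing_ideal J X. series_solution d \<Phi> F) \<and>
    (\<lambda>j. \<Phi> j 0) \<in> x \<and>
    vec_dim (osculating_space d \<Phi> 1) = d + 1"

text \<open>
  At a smooth point the osculating spaces do not depend on the parametrization.  The projective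
  osculating space has dimension one less than the linear span.
\<close>

definition laplace_equation_order_2 :: "'i set \<Rightarrow> ('i \<Rightarrow> 'a::field) set set \<Rightarrow> bool"
  where "laplace_equation_order_2 J X \<longleftrightarrow>
    (\<exists>d. krull_dim (subtopology (zariski J) X) = enat d \<and>
      (\<exists>U. openin (zariski J) U \<and> X \<inter> U \<noteq> {} \<and>
        (\<forall>x\<in>X \<inter> U. \<exists>\<Phi>. local_parametrization J X d x \<Phi> \<and>
          vec_dim (osculating_space d \<Phi> 2) - 1 < ((d + 2) choose 2) - 1)))"


section \<open>The ideal and the centre of the blow-up\<close>

definition togliatti_ideal :: "nat \<Rightarrow> (nat, 'a::field) mpoly set"
  where "togliatti_ideal n =
    (let R = poly_ring {..n}; \<mm> = genideal R (mvar ` {..n - 2}) in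
      ideal_prod R \<mm> (ideal_prod R \<mm> \<mm>) <+>\<^bsub>R\<^esub>
      genideal R ({mvar (n - 1) ^ 3, mvar n ^ 3} \<union>
                  {mvar i * mvar (n - 1) * mvar n | i. i \<le> n - 2}))"

definition blowup_centre :: "nat \<Rightarrow> (nat \<Rightarrow> 'a::field) set set"
  where "blowup_centre n =
    {x \<in> proj_space {..n}. \<forall>v\<in>x. v (n - 1) = 0 \<and> v n = 0} \<union>
    {proj_pt (\<lambda>i. if i = n - 1 then 1 else 0), proj_pt (\<lambda>i. if i = n then 1 else 0)}"

end

theory Submission
  imports Defs
begin

text \<open>
  Both \<open>X\<close> and the blow-up are closures of images of monomial maps, with the same atlas of monomial charts.
  In the chart at a vertex \<open>A\<close> of the polytope every quotient \<open>m / A\<close> is a monomial, with non-negative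
  exponents, in \<open>n\<close> of these quotients.  So both varieties are locally graphs over affine \<open>n\<close>-space, which gives
  smoothness, and the identity of the affine coordinates in each chart defines the isomorphism.  The blow-up is
  computed with the quadrics \<open>x\<^sub>i x\<^sub>n\<^sub>-\<^sub>1\<close>, \<open>x\<^sub>i x\<^sub>n\<close>, \<open>x\<^sub>n\<^sub>-\<^sub>1 x\<^sub>n\<close>, which generate the ideal of the centre; its coordinates
  are all monomials \<open>x\<^sub>j q\<close> with \<open>q\<close> such a quadric, that is, those of \<open>X\<close> together with the \<open>x\<^sub>i x\<^sub>n\<^sub>-\<^sub>1 x\<^sub>n\<close>.

  The exponents of the cubics spanning \<open>(I\<^sup>-\<^sup>1)\<^sub>3\<close> project to the vertices of a hexagon, without its centre
  \<open>x\<^sub>i x\<^sub>n\<^sub>-\<^sub>1 x\<^sub>n\<close>.  These vertices lie on a conic, and the equation of the conic is the Laplace equation.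
\<close>

section \<open>Polynomials and monomials\<close>

text \<open>The varieties are closures, so nothing says beforehand that the charts reach all of
  their points. \<open>cover\<close> supplies this: the square of every coordinate is a product of
  two chart origins, an equation that passes to the closure, so the origins never vanish together.
  The atlas lives on the larger set \<open>cubics\<close>; a family is any indexing of a part of it
  that contains the origins and edges. Hence the centre of the hexagon may be missing from X, and
  repetitions are allowed for the blow-up, where two Segre coordinates carry the same monomial
  whenever x_i q = x_j q'. Density arguments run along curves with polynomial coordinates: over an
  infinite field a univariate polynomial that vanishes for almost all parameters is zero, so
  irreducibility, points outside the torus and tangent vectors all come down to one-variable
  algebra. The upper bound for the Krull dimension replaces transcendence degree by a count of
  monomials.\<close>

abbreviation keys :: "('i \<Rightarrow>\<^sub>0 'b::zero) \<Rightarrow> 'i set" where "keys \<equiv> Poly_Mapping.keys"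
abbreviation lookup :: "('i \<Rightarrow>\<^sub>0 'b::zero) \<Rightarrow> 'i \<Rightarrow> 'b" where "lookup \<equiv> Poly_Mapping.lookup"
abbreviation sgl :: "'i \<Rightarrow> nat \<Rightarrow> 'i \<Rightarrow>\<^sub>0 nat" where "sgl \<equiv> Poly_Mapping.single"
abbreviation xpow :: "('i \<Rightarrow>\<^sub>0 nat) \<Rightarrow> ('i, 'a::comm_ring_1) mpoly" where "xpow m \<equiv> Poly_Mapping.single m 1"

definition mval :: "('i \<Rightarrow> 'a::comm_ring_1) \<Rightarrow> ('i \<Rightarrow>\<^sub>0 nat) \<Rightarrow> 'a"
  where "mval v m = (\<Prod>i\<in>keys m. v i ^ lookup m i)"

lemma mval_superset:
  assumes "finite S" "keys m \<subseteq> S"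
  shows "mval v m = (\<Prod>i\<in>S. v i ^ lookup m i)"
  unfolding mval_def by (rule prod.mono_neutral_left) (use assms in \<open>auto simp: in_keys_iff\<close>)

lemma mval_add: "mval v (m + m') = mval v m * mval v m'"
  unfolding mval_def by (rule monomial_value_add)

lemma mval_0 [simp]: "mval v 0 = 1"
  by (simp add: mval_def)

lemma mval_single [simp]: "mval v (sgl i k) = v i ^ k"
  by (cases "k = 0") (simp_all add: mval_def)

lemma mval_cong: "(\<And>i. i \<in> keys m \<Longrightarrow> v i = w i) \<Longrightarrow> mval v m = mval w m"
  by (simp add: mval_def)

lemma mval_eq_0_iff: "mval v m = 0 \<longleftrightarrow> (\<exists>i\<in>keys m. v i = 0)" for v :: "'i \<Rightarrow> 'a::field"
  by (auto simp: mval_def in_keys_iff)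

lemma mdeg_superset:
  assumes "finite S" "keys m \<subseteq> S"
  shows "mdeg m = (\<Sum>i\<in>S. lookup m i)"
  unfolding mdeg_def by (rule sum.mono_neutral_left) (use assms in \<open>auto simp: in_keys_iff\<close>)

lemma mdeg_0 [simp]: "mdeg 0 = 0"
  by (simp add: mdeg_def)

lemma mdeg_single [simp]: "mdeg (sgl i k) = k"
  by (cases "k = 0") (simp_all add: mdeg_def)

lemma mdeg_eq_0_iff: "mdeg m = 0 \<longleftrightarrow> m = 0"
proof
  assume "mdeg m = 0"
  then show "m = 0" by (intro poly_mapping_eqI) (simp add: mdeg_def in_keys_iff)
qed simp

lemma lookup_le_mdeg: "lookup m i \<le> mdeg m"
proof (cases "i \<in> keys m")
  case True
  then show ?thesis unfolding mdeg_def by (intro member_le_sum) auto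
qed (simp add: in_keys_iff)

lemma mdeg_Suc_decompose:
  assumes "mdeg m = Suc d"
  obtains i m' where "m = sgl i 1 + m'" "mdeg m' = d"
proof -
  have "m \<noteq> 0" using assms by auto
  then obtain i where i: "lookup m i \<noteq> 0" by (metis in_keys_iff keys_eq_empty equals0I)
  have "m = sgl i 1 + (m - sgl i 1)"
    using i by (intro poly_mapping_eqI) (auto simp: lookup_add lookup_minus lookup_single when_def)
  moreover from this have "mdeg (m - sgl i 1) = d"
    using mdeg_add[of "sgl i 1" "m - sgl i 1"] assms by simp
  ultimately show ?thesis using that by blast
qed

lemma keys_add_exponents: "keys (m + m') = keys m \<union> keys m'" for m m' :: "'i \<Rightarrow>\<^sub>0 nat"
  by (auto simp: in_keys_iff lookup_add)

lemma peval_monomial: "peval v (Poly_Mapping.single m c) = c * mval v m"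
  by (simp add: peval_single mval_def)

lemma peval_def_mval: "peval v p = (\<Sum>m\<in>keys p. lookup p m * mval v m)"
  by (simp add: peval_def psubst_def mval_def)

lemma peval_0 [simp]: "peval v 0 = 0"
  by (simp add: peval_def_mval)

lemma peval_1 [simp]: "peval v 1 = 1"
  using peval_monomial[of v 0 1] by simp

lemma peval_uminus [simp]: "peval v (- p) = - peval v p"
  using peval_add[of v "-p" p] by (simp add: eq_neg_iff_add_eq_0)

lemma peval_diff: "peval v (p - q) = peval v p - peval v q"
  using peval_add[of v p "-q"] by simp

lemma peval_power: "peval v (p ^ k) = peval v p ^ k"
  by (induction k) (simp_all add: peval_mult)

lemma peval_prod: "peval v (\<Prod>a\<in>A. h a) = (\<Prod>a\<in>A. peval v (h a))"
  by (induction A rule: infinite_finite_induct) (simp_all add: peval_mult)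

lemma peval_cong:
  assumes "p \<in> carrier (poly_ring J)" "\<And>j. j \<in> J \<Longrightarrow> v j = w j"
  shows "peval v p = peval w p"
  unfolding peval_def_mval
  by (intro sum.cong arg_cong2[where f = "(*)"] mval_cong refl)
    (use assms in \<open>auto simp: poly_ring_def\<close>)

lemma peval_psubst:
  "peval v (psubst (Poly_Mapping.single 0) g p) = peval (\<lambda>j. peval v (g j)) p"
  by (simp add: psubst_def peval_def_mval[of _ p] mval_def peval_sum peval_mult peval_prod
      peval_power peval_monomial)

section \<open>Polynomials along parametrized curves\<close>

lemma poly_psubst: "poly (psubst (\<lambda>c. [:c:]) P p) t = peval (\<lambda>j. poly (P j) t) p"
  by (simp add: psubst_def peval_def poly_sum poly_prod)

lemma pderiv_sum: "pderiv (\<Sum>a\<in>A. f a) = (\<Sum>a\<in>A. pderiv (f a))"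
  by (induction A rule: infinite_finite_induct) (simp_all add: pderiv_add)

text \<open>The chain rule along a polynomial curve. It pairs the gradients in
  \<open>tangent_space\<close> with a velocity, so tangency becomes a statement about one-variable
  polynomials.\<close>

lemma pderiv_psubst:
  fixes P :: "'i \<Rightarrow> 'a::field poly"
  assumes "finite J" "p \<in> carrier (poly_ring J)"
  shows "poly (pderiv (psubst (\<lambda>c. [:c:]) P p)) t =
    (\<Sum>j\<in>J. peval (\<lambda>j. poly (P j) t) (pdiff j p) * poly (pderiv (P j)) t)"
proof -
  let ?v = "\<lambda>j. poly (P j) t"
  have m: "(\<Sum>a\<in>keys m. (\<Prod>i\<in>keys m - {a}. ?v i ^ lookup m i) *
        (of_nat (lookup m a) * (?v a ^ (lookup m a - 1) * poly (pderiv (P a)) t))) =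
      (\<Sum>j\<in>J. of_nat (lookup m j) * mval ?v (m - sgl j 1) * poly (pderiv (P j)) t)"
    if "keys m \<subseteq> J" for m
  proof -
    have "mval ?v (m - sgl a 1) = (\<Prod>i\<in>keys m - {a}. ?v i ^ lookup m i) * ?v a ^ (lookup m a - 1)"
      if a: "a \<in> keys m" for a
    proof -
      have "mval ?v (m - sgl a 1) = (\<Prod>i\<in>keys m. ?v i ^ lookup (m - sgl a 1) i)"
        by (rule mval_superset) (auto simp: in_keys_iff lookup_minus)
      also have "\<dots> = ?v a ^ (lookup m a - 1) * (\<Prod>i\<in>keys m - {a}. ?v i ^ lookup (m - sgl a 1) i)"
        using a by (subst prod.remove[of _ a]) (simp_all add: lookup_minus)
      also have "(\<Prod>i\<in>keys m - {a}. ?v i ^ lookup (m - sgl a 1) i) = (\<Prod>i\<in>keys m - {a}. ?v i ^ lookup m i)"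
        by (rule prod.cong) (auto simp: lookup_minus lookup_single when_def)
      finally show ?thesis by simp
    qed
    then have "(\<Sum>a\<in>keys m. (\<Prod>i\<in>keys m - {a}. ?v i ^ lookup m i) *
        (of_nat (lookup m a) * (?v a ^ (lookup m a - 1) * poly (pderiv (P a)) t))) =
      (\<Sum>j\<in>keys m. of_nat (lookup m j) * mval ?v (m - sgl j 1) * poly (pderiv (P j)) t)"
      by (intro sum.cong) simp_all
    \<comment> \<open>For a variable absent from \<open>m\<close> the subtraction
      \<open>m - sgl j 1\<close> truncates, but the factor \<open>of_nat 0\<close> removes the
      term.\<close>
    also have "\<dots> = (\<Sum>j\<in>J. of_nat (lookup m j) * mval ?v (m - sgl j 1) * poly (pderiv (P j)) t)"
      by (rule sum.mono_neutral_left) (use assms that in \<open>auto simp: in_keys_iff\<close>)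
    finally show ?thesis .
  qed
  have "poly (pderiv (psubst (\<lambda>c. [:c:]) P p)) t =
      (\<Sum>m\<in>keys p. lookup p m * (\<Sum>a\<in>keys m. (\<Prod>i\<in>keys m - {a}. ?v i ^ lookup m i) *
        (of_nat (lookup m a) * (?v a ^ (lookup m a - 1) * poly (pderiv (P a)) t))))"
    by (simp add: psubst_def pderiv_sum pderiv_smult pderiv_prod pderiv_power poly_sum poly_prod mult_ac)
  also have "\<dots> = (\<Sum>m\<in>keys p. lookup p m *
      (\<Sum>j\<in>J. of_nat (lookup m j) * mval ?v (m - sgl j 1) * poly (pderiv (P j)) t))"
    using assms by (intro sum.cong refl arg_cong2[where f = "(*)"] m) (auto simp: poly_ring_def)
  also have "\<dots> = (\<Sum>j\<in>J. \<Sum>m\<in>keys p. lookup p m *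
      (of_nat (lookup m j) * mval ?v (m - sgl j 1) * poly (pderiv (P j)) t))"
    by (simp only: sum_distrib_left) (rule sum.swap)
  also have "\<dots> = (\<Sum>j\<in>J. peval ?v (pdiff j p) * poly (pderiv (P j)) t)"
    by (simp add: pdiff_def peval_sum peval_monomial sum_distrib_right sum_distrib_left mult_ac)
  finally show ?thesis .
qed

lemma carrier_poly_ring_closed:
  assumes "p \<in> carrier (poly_ring J)" "q \<in> carrier (poly_ring J)"
  shows "p + q \<in> carrier (poly_ring J)" "p * q \<in> carrier (poly_ring J)"
proof -
  interpret cring "poly_ring J :: ('a, 'b) mpoly ring" by (rule cring_poly_ring)
  show "p + q \<in> carrier (poly_ring J)" "p * q \<in> carrier (poly_ring J)"
    using a_closed[OF assms] m_closed[OF assms] by (simp_all add: poly_ring_def)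
qed

lemma carrier_poly_ring_uminus: "p \<in> carrier (poly_ring J) \<Longrightarrow> - p \<in> carrier (poly_ring J)"
  by (simp add: poly_ring_def)

section \<open>Closure properties of forms\<close>

lemma monomial_in_forms: "keys m \<subseteq> J \<Longrightarrow> mdeg m = d \<Longrightarrow> Poly_Mapping.single m c \<in> forms J d"
  by (auto simp: forms_def poly_ring_def)

lemma mvar_in_forms: "j \<in> J \<Longrightarrow> mvar j \<in> forms J 1"
  by (rule monomial_in_forms) simp_all

lemma zero_in_forms [simp]: "0 \<in> forms J d"
  by (auto simp: forms_def poly_ring_def)

lemma one_in_forms: "1 \<in> forms J 0"
  using monomial_in_forms[of 0 J 0 1] by simp

lemma forms_add: "p \<in> forms J d \<Longrightarrow> q \<in> forms J d \<Longrightarrow> p + q \<in> forms J d"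
  using Poly_Mapping.keys_add[of p q] by (auto simp: forms_def carrier_poly_ring_closed)

lemma forms_uminus: "p \<in> forms J d \<Longrightarrow> - p \<in> forms J d"
  by (simp add: forms_def carrier_poly_ring_uminus)

lemma forms_diff: "p \<in> forms J d \<Longrightarrow> q \<in> forms J d \<Longrightarrow> p - q \<in> forms J d"
  using forms_add[OF _ forms_uminus] by fastforce

lemma forms_sum: "(\<And>a. a \<in> A \<Longrightarrow> h a \<in> forms J d) \<Longrightarrow> (\<Sum>a\<in>A. h a) \<in> forms J d"
  by (induction A rule: infinite_finite_induct) (auto intro: forms_add)

lemma forms_power: "p \<in> forms J d \<Longrightarrow> p ^ k \<in> forms J (d * k)"
  by (induction k) (auto intro: one_in_forms forms_mult)

lemma forms_prod: "(\<And>a. a \<in> A \<Longrightarrow> h a \<in> forms J (d a)) \<Longrightarrow> (\<Prod>a\<in>A. h a) \<in> forms J (\<Sum>a\<in>A. d a)"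
  by (induction A rule: infinite_finite_induct) (auto intro: one_in_forms forms_mult)

lemma forms_scale: "p \<in> forms J d \<Longrightarrow> poly_scale c p \<in> forms J d"
  using forms_mult[OF monomial_in_forms[of 0 J 0 c]] by fastforce

lemma psubst_in_forms:
  fixes p :: "('k, 'a::field) mpoly"
  assumes "p \<in> forms K e" "\<And>k. k \<in> K \<Longrightarrow> g k \<in> forms J d"
  shows "psubst (Poly_Mapping.single 0) g p \<in> forms J (d * e)"
  unfolding psubst_def
proof (rule forms_sum)
  fix m assume m: "m \<in> keys p"
  then have "keys m \<subseteq> K" and e: "mdeg m = e" using assms(1) by (auto simp: forms_def poly_ring_def)
  then have "(\<Prod>i\<in>keys m. g i ^ lookup m i) \<in> forms J (\<Sum>i\<in>keys m. d * lookup m i)"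
    using assms(2) by (intro forms_prod forms_power) auto
  moreover have "(\<Sum>i\<in>keys m. d * lookup m i) = d * e"
    using e by (simp add: mdeg_def flip: sum_distrib_left)
  ultimately show "poly_scale (lookup p m) (\<Prod>i\<in>keys m. g i ^ lookup m i) \<in> forms J (d * e)"
    by (simp add: forms_scale)
qed

text \<open>
  Distinct monomials are distinct characters, so they are linearly independent as functions:
  as in Dedekind's argument, rescaling one coordinate by 2 shortens a linear relation.
\<close>

lemma mono_functions_independent:
  fixes c :: "('i \<Rightarrow>\<^sub>0 nat) \<Rightarrow> 'a::field_char_0"
  assumes "finite S" "\<And>m. m \<in> S \<Longrightarrow> keys m \<subseteq> J"
    and "\<And>v. v \<in> affine_space J \<Longrightarrow> (\<Sum>m\<in>S. c m * mval v m) = 0"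
  shows "\<forall>m\<in>S. c m = 0"
  using assms
proof (induction "card S" arbitrary: S c rule: less_induct)
  case (less S)
  show ?case
  proof (rule ccontr)
    assume "\<not> ?thesis"
    then obtain m where m: "m \<in> S" "c m \<noteq> 0" by blast
    show False
    proof (cases "S = {m}")
      case True
      define v where "v i = (if i \<in> J then 1 else 0 :: 'a)" for i
      have "v \<in> affine_space J" by (simp add: v_def affine_space_def)
      then have "c m * mval v m = 0" using less.prems(3)[of v] True by simp
      moreover have "mval v m = 1"
        using less.prems(2) True by (auto simp: mval_def v_def intro!: prod.neutral)
      ultimately show False using m by simp
    next
      case False
      then obtain m' where m': "m' \<in> S" "m' \<noteq> m" using m by blast
      then obtain i where i: "lookup m i \<noteq> lookup m' i" using poly_mapping_eqI by metis
      define c' where "c' k = c k * (2 ^ lookup k i - 2 ^ lookup m' i)" for k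
      have "\<forall>k\<in>S - {m'}. c' k = 0"
      proof (rule less.hyps)
        show "card (S - {m'}) < card S" using m' less.prems(1) by (meson card_Diff1_less)
        show "finite (S - {m'})" using less.prems(1) by simp
        show "keys k \<subseteq> J" if "k \<in> S - {m'}" for k using less.prems(2) that by simp
        fix v :: "'i \<Rightarrow> 'a" assume v: "v \<in> affine_space J"
        let ?w = "v(i := 2 * v i)"
        have w: "mval ?w k = 2 ^ lookup k i * mval v k" for k
        proof -
          have "mval ?w k = (\<Prod>j\<in>insert i (keys k). ?w j ^ lookup k j)"
            by (rule mval_superset) auto
          also have "\<dots> = (2 * v i) ^ lookup k i * (\<Prod>j\<in>insert i (keys k) - {i}. v j ^ lookup k j)"
            by (subst prod.remove[of _ i]) (auto intro: prod.cong)
          also have "\<dots> = 2 ^ lookup k i * (\<Prod>j\<in>insert i (keys k). v j ^ lookup k j)"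
            by (subst prod.remove[of "insert i (keys k)" i]) (auto simp: power_mult_distrib)
          also have "(\<Prod>j\<in>insert i (keys k). v j ^ lookup k j) = mval v k"
            by (rule mval_superset[symmetric]) auto
          finally show ?thesis .
        qed
        have "?w \<in> affine_space J" using v by (auto simp: affine_space_def)
        then have "(\<Sum>k\<in>S. c k * mval ?w k) = 0" "(\<Sum>k\<in>S. c k * mval v k) = 0"
          using less.prems(3) v by blast+
        then have "(\<Sum>k\<in>S. c k * mval ?w k) - 2 ^ lookup m' i * (\<Sum>k\<in>S. c k * mval v k) = 0" by simp
        also have "(\<Sum>k\<in>S. c k * mval ?w k) - 2 ^ lookup m' i * (\<Sum>k\<in>S. c k * mval v k) =
            (\<Sum>k\<in>S. c' k * mval v k)"
          unfolding w c'_def by (simp add: sum_distrib_left algebra_simps sum_subtractf)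
        also have "\<dots> = (\<Sum>k\<in>S - {m'}. c' k * mval v k)"
          using less.prems(1) m' by (simp add: sum.remove[of S m'] c'_def)
        finally show "(\<Sum>k\<in>S - {m'}. c' k * mval v k) = 0" .
      qed
      then have "c' m = 0" using m m' by blast
      \<comment> \<open>Characteristic zero enters here: distinct powers of 2 stay distinct in the
        field.\<close>
      moreover have "(2::'a) ^ lookup m i \<noteq> 2 ^ lookup m' i"
      proof
        assume "(2::'a) ^ lookup m i = 2 ^ lookup m' i"
        then have "of_nat (2 ^ lookup m i) = (of_nat (2 ^ lookup m' i) :: 'a)" by simp
        then have "(2::nat) ^ lookup m i = 2 ^ lookup m' i" by (simp only: of_nat_eq_iff)
        then show False using i by simp
      qed
      ultimately show False using m by (simp add: c'_def)
    qed
  qed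
qed

lemma mpoly_eq_0_if_vanishes:
  fixes p :: "('i, 'a::field_char_0) mpoly"
  assumes "p \<in> carrier (poly_ring J)" "\<And>v. v \<in> affine_space J \<Longrightarrow> peval v p = 0"
  shows "p = 0"
proof -
  have "\<forall>m\<in>keys p. lookup p m = 0"
    using assms by (intro mono_functions_independent[of _ J]) (auto simp: poly_ring_def peval_def_mval)
  then show ?thesis by (intro poly_mapping_eqI) (auto simp: in_keys_iff)
qed

section \<open>Zariski closure and irreducibility\<close>

lemma self_in_proj_pt: "v \<in> proj_pt v"
  unfolding proj_pt_def by (intro CollectI exI[of _ 1]) simp

lemma proj_pt_scale: "c \<noteq> 0 \<Longrightarrow> proj_pt (\<lambda>i. c * v i) = proj_pt v"
proof -
  assume c: "c \<noteq> 0"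
  have "\<exists>c'. (\<lambda>i. b * (c * v i)) = (\<lambda>i. c' * v i) \<and> c' \<noteq> 0" if "b \<noteq> 0" for b
    using c that by (intro exI[of _ "b * c"]) (simp add: mult.assoc)
  moreover have "\<exists>c'. (\<lambda>i. b * v i) = (\<lambda>i. c' * (c * v i)) \<and> c' \<noteq> 0" if "b \<noteq> 0" for b
    using c that by (intro exI[of _ "b / c"]) simp
  ultimately show ?thesis by (auto simp: proj_pt_def)
qed

lemma proj_pt_eqI: "c \<noteq> 0 \<Longrightarrow> (\<And>i. w i = c * v i) \<Longrightarrow> proj_pt w = proj_pt v"
  using proj_pt_scale[of c v] by (metis ext)

lemma in_proj_ptE:
  assumes "w \<in> proj_pt v"
  obtains c where "c \<noteq> 0" "\<And>i. w i = c * v i"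
  using assms by (auto simp: proj_pt_def)

lemma proj_space_point:
  assumes "x \<in> proj_space J" "v \<in> x"
  shows "v \<in> affine_space J" "v \<noteq> 0" "x = proj_pt v"
proof -
  obtain u where u: "u \<in> affine_space J" "u \<noteq> 0" "x = proj_pt u"
    using assms(1) by (auto simp: proj_space_def)
  then obtain c where c: "c \<noteq> 0" "\<And>i. v i = c * u i" using assms(2) in_proj_ptE by metis
  show "x = proj_pt v" unfolding u(3) by (rule proj_pt_eqI[OF c, symmetric])
  show "v \<in> affine_space J" using u c by (simp add: affine_space_def)
  show "v \<noteq> 0" using u c by (auto simp: fun_eq_iff)
qed

lemma proj_pt_in_proj_space: "v \<in> affine_space J \<Longrightarrow> v \<noteq> 0 \<Longrightarrow> proj_pt v \<in> proj_space J"
  by (auto simp: proj_space_def)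

lemma form_vanishes_at_proj_pt_iff:
  assumes "f \<in> forms J d"
  shows "(\<forall>w\<in>proj_pt v. peval w f = 0) \<longleftrightarrow> peval v f = 0"
  using self_in_proj_pt[of v] peval_scale[OF assms] by (auto simp: proj_pt_def)

definition vanishes_on :: "('i, 'a::field) mpoly \<Rightarrow> ('i \<Rightarrow> 'a) set set \<Rightarrow> bool"
  where "vanishes_on f Z \<longleftrightarrow> (\<forall>x\<in>Z. \<forall>v\<in>x. peval v f = 0)"

lemma vanishes_on_subset: "vanishes_on f Z \<Longrightarrow> W \<subseteq> Z \<Longrightarrow> vanishes_on f W"
  by (auto simp: vanishes_on_def)

lemma vanishes_on_proj_pt_image_iff:
  assumes "f \<in> forms J d"
  shows "vanishes_on f (proj_pt ` S) \<longleftrightarrow> (\<forall>v\<in>S. peval v f = 0)"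
  using form_vanishes_at_proj_pt_iff[OF assms] by (auto simp: vanishes_on_def)

lemma vanishes_on_mult: "vanishes_on f Z \<or> vanishes_on g Z \<Longrightarrow> vanishes_on (f * g) Z"
  by (auto simp: vanishes_on_def peval_mult)

lemma vanishes_on_iff_subset:
  assumes "Z \<subseteq> proj_space J"
  shows "vanishes_on f Z \<longleftrightarrow> Z \<subseteq> zero_locus J {f}"
  using assms by (auto simp: vanishes_on_def zero_locus_def)

lemma closedin_form_zero_locus: "f \<in> forms J d \<Longrightarrow> closedin (zariski J) (zero_locus J {f})"
  unfolding closedin_zariski by (intro exI[of _ "{f}"]) auto

lemma closedin_zariski_subset: "closedin (zariski J) Z \<Longrightarrow> Z \<subseteq> proj_space J"
  using closedin_subset[of "zariski J"] by (simp add: topspace_zariski)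

lemma closedin_zariski_separates:
  assumes "closedin (zariski J) Z" "x \<in> proj_space J" "x \<notin> Z"
  obtains f d where "f \<in> forms J d" "vanishes_on f Z" "\<not> vanishes_on f {x}"
proof -
  obtain S where S: "S \<subseteq> (\<Union>d. forms J d)" "Z = zero_locus J S"
    using assms(1) by (auto simp: closedin_zariski)
  then obtain f v where "f \<in> S" "v \<in> x" "peval v f \<noteq> 0"
    using assms(2,3) by (auto simp: zero_locus_def)
  moreover obtain d where "f \<in> forms J d" using S(1) \<open>f \<in> S\<close> by blast
  moreover have "vanishes_on f Z" using \<open>f \<in> S\<close> S(2) by (auto simp: vanishes_on_def zero_locus_def)
  moreover have "\<not> vanishes_on f {x}" using \<open>v \<in> x\<close> \<open>peval v f \<noteq> 0\<close> by (auto simp: vanishes_on_def)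
  ultimately show thesis using that by blast
qed

lemma vanishes_on_closure_of_iff:
  assumes "Z \<subseteq> proj_space J" "f \<in> forms J d"
  shows "vanishes_on f (zariski J closure_of Z) \<longleftrightarrow> vanishes_on f Z"
proof
  assume "vanishes_on f Z"
  then have "Z \<subseteq> zero_locus J {f}" using vanishes_on_iff_subset assms by blast
  then have "zariski J closure_of Z \<subseteq> zero_locus J {f}"
    by (rule closure_of_minimal[OF _ closedin_form_zero_locus[OF assms(2)]])
  then show "vanishes_on f (zariski J closure_of Z)" by (auto simp: vanishes_on_def zero_locus_def)
next
  assume "vanishes_on f (zariski J closure_of Z)"
  then show "vanishes_on f Z"
    using closure_of_subset[of Z "zariski J"] assms(1) vanishes_on_subset
    by (auto simp: topspace_zariski)
qed

text \<open>Closed sets are cut out by forms, so limit points can be recognised form by form. This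
  is how \<open>chart_in_X\<close> gets beyond the image.\<close>

lemma in_closure_of_zariski_iff:
  assumes "Z \<subseteq> proj_space J"
  shows "x \<in> zariski J closure_of Z \<longleftrightarrow> x \<in> proj_space J \<and>
    (\<forall>d. \<forall>f\<in>forms J d. vanishes_on f Z \<longrightarrow> vanishes_on f {x})"
proof (intro iffI conjI allI ballI impI)
  assume x: "x \<in> zariski J closure_of Z"
  then show "x \<in> proj_space J" using closure_of_subset_topspace[of "zariski J"] by (auto simp: topspace_zariski)
  fix d f assume "f \<in> forms J d" "vanishes_on f Z"
  then show "vanishes_on f {x}"
    using x vanishes_on_closure_of_iff[OF assms] vanishes_on_subset by blast
next
  assume x: "x \<in> proj_space J \<and> (\<forall>d. \<forall>f\<in>forms J d. vanishes_on f Z \<longrightarrow> vanishes_on f {x})"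
  show "x \<in> zariski J closure_of Z"
  proof (rule ccontr)
    assume "x \<notin> zariski J closure_of Z"
    then obtain f d where "f \<in> forms J d" "vanishes_on f (zariski J closure_of Z)" "\<not> vanishes_on f {x}"
      using x closedin_zariski_separates[OF closedin_closure_of] by metis
    with x vanishes_on_closure_of_iff[OF assms] show False by blast
  qed
qed

lemma irreducible_in_closure_of:
  assumes "irreducible_in T S"
  shows "irreducible_in T (T closure_of S)"
proof -
  have S: "S \<noteq> {}" "S \<subseteq> topspace T" using assms by (auto simp: irreducible_in_def)
  then have sub: "S \<subseteq> T closure_of S" by (simp add: closure_of_subset)
  have "T closure_of S \<subseteq> A \<or> T closure_of S \<subseteq> B"
    if "closedin T A" "closedin T B" "T closure_of S \<subseteq> A \<union> B" for A B
  proof -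
    have "S \<subseteq> A \<or> S \<subseteq> B" using assms that sub by (auto simp: irreducible_in_def)
    then show ?thesis using closure_of_minimal that by metis
  qed
  then show ?thesis
    using S sub closure_of_subset_topspace[of T S] by (auto simp: irreducible_in_def)
qed

text \<open>Coverings by closed sets of \<open>T\<close> and by their traces on \<open>X\<close> are
  interchangeable, because \<open>X\<close> is closed. The Krull dimension of \<open>X\<close> can
  thus be computed with chains in the projective space.\<close>

lemma irreducible_in_subtopology_iff:
  assumes "closedin T X" "S \<subseteq> X"
  shows "irreducible_in (subtopology T X) S \<longleftrightarrow> irreducible_in T S"
proof
  assume irr: "irreducible_in (subtopology T X) S"
  have "S \<subseteq> A \<or> S \<subseteq> B" if "closedin T A" "closedin T B" "S \<subseteq> A \<union> B" for A B
  proof -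
    have "closedin (subtopology T X) (A \<inter> X)" "closedin (subtopology T X) (B \<inter> X)"
      using that assms(1) by (auto simp: closedin_closed_subtopology closedin_Int)
    moreover have "S \<subseteq> (A \<inter> X) \<union> (B \<inter> X)" using that assms(2) by blast
    ultimately have "S \<subseteq> A \<inter> X \<or> S \<subseteq> B \<inter> X" using irr unfolding irreducible_in_def by blast
    then show ?thesis by blast
  qed
  then show "irreducible_in T S" using irr by (auto simp: irreducible_in_def)
next
  assume "irreducible_in T S"
  then show "irreducible_in (subtopology T X) S"
    using assms closedin_subset[OF assms(1)]
    by (simp add: irreducible_in_def closedin_closed_subtopology)
qed

text \<open>At each point one factor vanishes, so the zero loci of \<open>f\<close> and
  \<open>g\<close> cover \<open>C\<close>: the homogeneous ideal of an irreducible set is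
  prime.\<close>

lemma irreducible_in_zariski_forms:
  assumes "irreducible_in (zariski J) C" "f \<in> forms J d" "g \<in> forms J e" "vanishes_on (f * g) C"
  shows "vanishes_on f C \<or> vanishes_on g C"
proof -
  have C: "C \<subseteq> proj_space J" using assms(1) by (simp add: irreducible_in_def topspace_zariski)
  have "C \<subseteq> zero_locus J {f} \<union> zero_locus J {g}"
  proof
    fix x assume x: "x \<in> C"
    then obtain v where v: "x = proj_pt v" using C by (auto simp: proj_space_def)
    then have "peval v f = 0 \<or> peval v g = 0"
      using assms(4) x self_in_proj_pt[of v] by (auto simp: vanishes_on_def peval_mult)
    then have "vanishes_on f {x} \<or> vanishes_on g {x}"
      using form_vanishes_at_proj_pt_iff[OF assms(2)] form_vanishes_at_proj_pt_iff[OF assms(3)] v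
      by (simp add: vanishes_on_def)
    then show "x \<in> zero_locus J {f} \<union> zero_locus J {g}"
      using x C by (auto simp: zero_locus_def vanishes_on_def)
  qed
  then have "C \<subseteq> zero_locus J {f} \<or> C \<subseteq> zero_locus J {g}"
    using assms(1) closedin_form_zero_locus[OF assms(2)] closedin_form_zero_locus[OF assms(3)]
    by (auto simp: irreducible_in_def)
  then show ?thesis using vanishes_on_iff_subset[OF C] by blast
qed

text \<open>Curves are allowed finitely many bad parameters \<open>F\<close>, where they leave the
  torus or pass through the zero vector.\<close>

lemma poly_eq_0_if_cofinitely_many_roots:
  fixes p :: "'a::field_char_0 poly"
  assumes "finite F" "\<And>t. t \<notin> F \<Longrightarrow> poly p t = 0"
  shows "p = 0"
proof (rule ccontr)
  assume "p \<noteq> 0"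
  then have "finite ({t. poly p t = 0} \<union> F)" using assms(1) poly_roots_finite by blast
  moreover have "{t. poly p t = 0} \<union> F = UNIV" using assms(2) by blast
  ultimately show False using infinite_UNIV_char_0[where 'a='a] by simp
qed

text \<open>
  On a curve through two points, the vanishing of a product of forms is the vanishing of a product of
  univariate polynomials.
\<close>

lemma irreducible_in_zariski_curves:
  fixes S :: "('i \<Rightarrow> 'a::field_char_0) set"
  assumes S: "S \<subseteq> affine_space J - {0}" "S \<noteq> {}"
    and curve: "\<And>v w. v \<in> S \<Longrightarrow> w \<in> S \<Longrightarrow> \<exists>P :: 'i \<Rightarrow> 'a poly.
      (\<forall>j. poly (P j) 0 = v j \<and> poly (P j) 1 = w j) \<and> (\<forall>t. (\<lambda>j. poly (P j) t) \<in> insert 0 S)"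
  shows "irreducible_in (zariski J) (proj_pt ` S)"
  unfolding irreducible_in_def
proof (intro conjI allI impI)
  have sub: "proj_pt ` S \<subseteq> proj_space J" using S by (auto simp: proj_space_def)
  then show "proj_pt ` S \<subseteq> topspace (zariski J)" by (simp add: topspace_zariski)
  show "proj_pt ` S \<noteq> {}" using S by blast
  fix A B assume AB: "closedin (zariski J) A \<and> closedin (zariski J) B \<and> proj_pt ` S \<subseteq> A \<union> B"
  show "proj_pt ` S \<subseteq> A \<or> proj_pt ` S \<subseteq> B"
  proof (rule ccontr)
    assume "\<not> ?thesis"
    then obtain v w where vw: "v \<in> S" "proj_pt v \<notin> A" "w \<in> S" "proj_pt w \<notin> B" by blast
    obtain f d where f: "f \<in> forms J d" "vanishes_on f A" "\<not> vanishes_on f {proj_pt v}"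
      using closedin_zariski_separates AB vw sub by (metis imageI subsetD)
    obtain g e where g: "g \<in> forms J e" "vanishes_on g B" "\<not> vanishes_on g {proj_pt w}"
      using closedin_zariski_separates AB vw sub by (metis imageI subsetD)
    obtain P where P: "\<And>j. poly (P j) 0 = v j" "\<And>j. poly (P j) 1 = w j"
      "\<And>t. (\<lambda>j. poly (P j) t) \<in> insert 0 S"
      using curve[OF vw(1,3)] by blast
    let ?q = "psubst (\<lambda>c. [:c:]) P"
    have "v \<noteq> 0" using vw S by blast
    then obtain j where j: "v j \<noteq> 0" by (auto simp: fun_eq_iff)
    \<comment> \<open>Where the curve passes through 0 there is no projective point; the extra
      factor \<open>P j\<close> vanishes there, and it is not the zero polynomial because
      \<open>v j \<noteq> 0\<close>.\<close>
    have "poly (?q f * ?q g * P j) t = 0" for t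
    proof (cases "(\<lambda>j. poly (P j) t) \<in> S")
      case True
      then have "proj_pt (\<lambda>j. poly (P j) t) \<in> A \<union> B" using AB by blast
      then show ?thesis using f(2) g(2) self_in_proj_pt by (fastforce simp: poly_psubst vanishes_on_def)
    next
      case False
      then have "(\<lambda>j. poly (P j) t) = 0" using P(3)[of t] by auto
      then show ?thesis by (simp add: fun_eq_iff)
    qed
    then have "?q f * ?q g * P j = 0" by (intro poly_eq_0_if_cofinitely_many_roots[of "{}"]) simp_all
    moreover have "peval v f \<noteq> 0" "peval w g \<noteq> 0"
      using f(3) g(3) form_vanishes_at_proj_pt_iff[OF f(1)] form_vanishes_at_proj_pt_iff[OF g(1)]
      by (simp_all add: vanishes_on_def)
    then have "poly (?q f) 0 \<noteq> 0" "poly (?q g) 1 \<noteq> 0" "poly (P j) 0 \<noteq> 0"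
      using P j by (simp_all add: poly_psubst)
    ultimately show False by auto
  qed
qed

section \<open>Dimension of the closure of the image of a rational map\<close>

text \<open>Stated for families rather than sets, because products with different exponents may
  coincide as polynomials; a repetition is itself a relation, with coefficients 1 and -1.\<close>

lemma (in vector_space) exists_linear_relation:
  assumes "finite A" "finite B" "card B < card A" "\<And>a. a \<in> A \<Longrightarrow> w a \<in> span B"
  shows "\<exists>c. (\<exists>a\<in>A. c a \<noteq> 0) \<and> (\<Sum>a\<in>A. c a *s w a) = 0"
proof (cases "inj_on w A")
  case True
  have "\<not> independent (w ` A)"
    using independent_span_bound[OF assms(2), of "w ` A"] assms(3,4) card_image[OF True] by auto
  then obtain u where u: "\<exists>v\<in>w ` A. u v \<noteq> 0" "(\<Sum>v\<in>w ` A. u v *s v) = 0"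
    using dependent_finite[of "w ` A"] assms(1) by auto
  then show ?thesis by (intro exI[of _ "u \<circ> w"]) (auto simp: sum.reindex[OF True])
next
  case False
  then obtain a b where ab: "a \<in> A" "b \<in> A" "a \<noteq> b" "w a = w b" by (auto simp: inj_on_def)
  define c where "c k = (if k = a then 1 else if k = b then -1 else 0 :: 'a)" for k
  have "(\<Sum>k\<in>A. c k *s w k) = (\<Sum>k\<in>{a, b}. c k *s w k)"
    using assms(1) ab by (intro sum.mono_neutral_right) (auto simp: c_def)
  also have "\<dots> = 0" using ab by (simp add: c_def)
  finally show ?thesis using ab by (intro exI[of _ c]) (auto simp: c_def)
qed

interpretation mpoly_space: vector_space "poly_scale :: 'a::field \<Rightarrow> ('i, 'a) mpoly \<Rightarrow> _"
  by (rule vector_space_poly_scale)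

text \<open>The degree fixes the exponent of one variable \<open>j\<close>, so
  \<open>card J - 1\<close> exponents in \<open>{..d}\<close> determine a monomial. Saving this one
  variable is what lets the count in \<open>forms_algebraically_dependent\<close> succeed.\<close>

lemma card_monomials_of_degree_le:
  assumes "finite J" "J \<noteq> {}"
  shows "finite {m. keys m \<subseteq> J \<and> mdeg m = d}"
    and "card {m. keys m \<subseteq> J \<and> mdeg m = d} \<le> (d + 1) ^ (card J - 1)"
proof -
  let ?M = "{m. keys m \<subseteq> J \<and> mdeg m = d}"
  obtain j where j: "j \<in> J" using assms by blast
  let ?r = "\<lambda>m. restrict (lookup m) (J - {j})"
  have inj: "inj_on ?r ?M"
  proof (rule inj_onI)
    fix m m' assume m: "m \<in> ?M" "m' \<in> ?M" "?r m = ?r m'"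
    have eq: "lookup m i = lookup m' i" if "i \<in> J - {j}" for i
    proof -
      have "restrict (lookup m) (J - {j}) i = restrict (lookup m') (J - {j}) i" using m(3) by simp
      then show ?thesis by (simp only: restrict_apply' that)
    qed
    have "mdeg k = lookup k j + (\<Sum>i\<in>J - {j}. lookup k i)" if "keys k \<subseteq> J" for k
      using mdeg_superset[OF assms(1) that] j assms(1) by (simp add: sum.remove)
    from this[of m] this[of m'] m eq have "lookup m j = lookup m' j" by simp
    moreover have "lookup m i = lookup m' i" if "i \<notin> J" for i
    proof -
      have "i \<notin> keys m" "i \<notin> keys m'" using m(1,2) that by blast+
      then show ?thesis by (simp add: in_keys_iff)
    qed
    ultimately show "m = m'" using eq by (intro poly_mapping_eqI) blast
  qed
  have sub: "?r ` ?M \<subseteq> (J - {j}) \<rightarrow>\<^sub>E {..d}"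
    by (auto simp: lookup_le_mdeg split: if_splits)
  have fin: "finite ((J - {j}) \<rightarrow>\<^sub>E {..d})" using assms(1) by (intro finite_PiE) auto
  show "finite ?M" using inj_on_finite[OF inj sub fin] .
  have "card ?M \<le> card ((J - {j}) \<rightarrow>\<^sub>E {..d})" using card_inj_on_le[OF inj sub fin] .
  also have "\<dots> = (d + 1) ^ (card J - 1)" using assms(1) j by (simp add: card_PiE)
  finally show "card ?M \<le> (d + 1) ^ (card J - 1)" .
qed

lemma forms_subset_span:
  "forms J d \<subseteq> mpoly_space.span (xpow ` {m. keys m \<subseteq> J \<and> mdeg m = d})"
proof
  fix p :: "('a, 'b) mpoly" assume p: "p \<in> forms J d"
  have "p = (\<Sum>m\<in>keys p. poly_scale (lookup p m) (xpow m))"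
    by (simp add: mult_single sum_single_lookup)
  also have "\<dots> \<in> mpoly_space.span (xpow ` {m. keys m \<subseteq> J \<and> mdeg m = d})"
    using p by (intro mpoly_space.span_sum mpoly_space.span_scale mpoly_space.span_base)
      (auto simp: forms_def poly_ring_def)
  finally show "p \<in> mpoly_space.span (xpow ` {m. keys m \<subseteq> J \<and> mdeg m = d})" .
qed

text \<open>
  For large \<open>R\<close> there are more products of the \<open>G\<^sub>i\<close> with exponents below \<open>R\<close> than monomials in their common degree.
\<close>

lemma forms_algebraically_dependent:
  fixes G :: "nat \<Rightarrow> ('i, 'a::field) mpoly"
  assumes "finite J" "J \<noteq> {}" "\<And>i. i \<le> card J \<Longrightarrow> G i \<in> forms J d"
  obtains A :: "(nat \<Rightarrow> nat) set" and c k L where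
    "finite A" "A \<subseteq> extensional {1..card J}" "\<And>\<alpha>. \<alpha> \<in> A \<Longrightarrow> k \<alpha> + (\<Sum>i\<in>{1..card J}. \<alpha> i) = L"
    "\<exists>\<alpha>\<in>A. c \<alpha> \<noteq> 0"
    "(\<Sum>\<alpha>\<in>A. poly_scale (c \<alpha>) (G 0 ^ k \<alpha> * (\<Prod>i\<in>{1..card J}. G i ^ \<alpha> i))) = 0"
proof -
  define m where "m = card J"
  have m: "m > 0" using assms by (simp add: m_def card_gt_0_iff)
  \<comment> \<open>\<open>R\<close> exceeds \<open>(d * m + 1) ^ (m - 1)\<close>, which puts the
    bound \<open>((d * m + 1) * R) ^ (m - 1)\<close> for the monomials below \<open>R ^ m\<close>,
    the number of products.\<close>
  define R where "R = Suc ((d * m + 1) ^ (m - 1))"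
  define L where "L = m * R"
  define A where "A = {1..m} \<rightarrow>\<^sub>E {..<R}"
  \<comment> \<open>The power of \<open>G 0\<close> fills each product up to \<open>L\<close>
    factors, hence to the common degree \<open>d * L\<close>.\<close>
  define k where "k \<alpha> = L - (\<Sum>i\<in>{1..m}. \<alpha> i)" for \<alpha> :: "nat \<Rightarrow> nat"
  let ?M = "{x. keys x \<subseteq> J \<and> mdeg x = d * L}"
  have fin: "finite A" by (simp add: A_def finite_PiE)
  have k: "k \<alpha> + (\<Sum>i\<in>{1..m}. \<alpha> i) = L" if "\<alpha> \<in> A" for \<alpha>
  proof -
    have "(\<Sum>i\<in>{1..m}. \<alpha> i) \<le> (\<Sum>i\<in>{1..m}. R)"
      using that by (intro sum_mono) (auto simp: A_def PiE_def Pi_def intro: less_imp_le)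
    then show ?thesis by (simp add: k_def L_def)
  qed
  have "card (xpow ` ?M :: ('i, 'a) mpoly set) \<le> card ?M"
    by (intro card_image_le card_monomials_of_degree_le assms)
  also have "\<dots> \<le> (d * L + 1) ^ (m - 1)"
    unfolding m_def by (intro card_monomials_of_degree_le assms)
  also have "\<dots> \<le> ((d * m + 1) * R) ^ (m - 1)"
    by (intro power_mono) (simp_all add: L_def R_def algebra_simps)
  also have "\<dots> = (d * m + 1) ^ (m - 1) * R ^ (m - 1)" by (simp only: power_mult_distrib)
  also have "\<dots> < R * R ^ (m - 1)" by (simp add: R_def)
  also have "\<dots> = R ^ m" using m by (simp flip: power_Suc)
  also have "\<dots> = card A" by (simp add: A_def card_PiE)
  finally have card: "card (xpow ` ?M :: ('i, 'a) mpoly set) < card A" .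
  have "G 0 ^ k \<alpha> * (\<Prod>i\<in>{1..m}. G i ^ \<alpha> i) \<in> mpoly_space.span (xpow ` ?M)" if "\<alpha> \<in> A" for \<alpha>
  proof -
    have "G 0 ^ k \<alpha> * (\<Prod>i\<in>{1..m}. G i ^ \<alpha> i) \<in> forms J (d * k \<alpha> + (\<Sum>i\<in>{1..m}. d * \<alpha> i))"
      by (intro forms_mult forms_prod forms_power assms) (auto simp: m_def)
    moreover have "d * k \<alpha> + (\<Sum>i\<in>{1..m}. d * \<alpha> i) = d * L"
      unfolding k[OF that, symmetric] by (simp add: sum_distrib_left distrib_left)
    ultimately show ?thesis using forms_subset_span by fastforce
  qed
  then obtain c where "\<exists>\<alpha>\<in>A. c \<alpha> \<noteq> 0"
      "(\<Sum>\<alpha>\<in>A. poly_scale (c \<alpha>) (G 0 ^ k \<alpha> * (\<Prod>i\<in>{1..m}. G i ^ \<alpha> i))) = 0"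
    using mpoly_space.exists_linear_relation[OF fin _ card,
        of "\<lambda>\<alpha>. G 0 ^ k \<alpha> * (\<Prod>i\<in>{1..m}. G i ^ \<alpha> i)"]
      card_monomials_of_degree_le(1)[OF assms(1,2)] by auto
  with fin k that[of A k L c] show thesis by (auto simp: A_def m_def PiE_def)
qed

text \<open>
  The forms \<open>F\<^sub>i\<close> vanish on \<open>C\<^sub>i\<^sub>-\<^sub>1\<close> but not on \<open>C\<^sub>i\<close>.  A relation between \<open>F\<^sub>0, \<dots>, F\<^sub>l\<close> on \<open>C\<^sub>l\<close>, divided by
  the largest possible power of \<open>F\<^sub>l\<close> and restricted to \<open>C\<^sub>l\<^sub>-\<^sub>1\<close>, gives one between \<open>F\<^sub>0, \<dots>, F\<^sub>l\<^sub>-\<^sub>1\<close>.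
\<close>

lemma no_relation_along_chain:
  fixes F :: "nat \<Rightarrow> ('k, 'a::field) mpoly" and A :: "(nat \<Rightarrow> nat) set"
  assumes "\<And>i. i \<le> l \<Longrightarrow> irreducible_in (zariski K) (C i)"
    and "\<And>i. i < l \<Longrightarrow> C i \<subseteq> C (Suc i)"
    and "\<And>i. i \<le> l \<Longrightarrow> F i \<in> forms K e"
    and "\<And>i. i \<le> l \<Longrightarrow> \<not> vanishes_on (F i) (C i)"
    and "\<And>i. i < l \<Longrightarrow> vanishes_on (F (Suc i)) (C i)"
    and "finite A" "inj_on (\<lambda>\<alpha>. restrict \<alpha> {1..l}) A"
    and "\<And>\<alpha>. \<alpha> \<in> A \<Longrightarrow> k \<alpha> + (\<Sum>i\<in>{1..l}. \<alpha> i) = L"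
    and "vanishes_on (\<Sum>\<alpha>\<in>A. poly_scale (c \<alpha>) (F 0 ^ k \<alpha> * (\<Prod>i\<in>{1..l}. F i ^ \<alpha> i))) (C l)"
  shows "\<forall>\<alpha>\<in>A. c \<alpha> = 0"
  using assms
proof (induction l arbitrary: A L)
  case 0
  show ?case
  proof
    fix \<alpha> assume \<alpha>: "\<alpha> \<in> A"
    \<comment> \<open>Restrictions to the empty range \<open>{1..0}\<close> all agree, so
      injectivity leaves a single exponent and the relation is one multiple of a power of
      \<open>F 0\<close>.\<close>
    have "A = {\<alpha>}" using \<alpha> 0(7) by (auto simp: inj_on_def)
    moreover obtain x v where "x \<in> C 0" "v \<in> x" "peval v (F 0) \<noteq> 0"
      using 0(4)[of 0] by (auto simp: vanishes_on_def)
    ultimately show "c \<alpha> = 0" using 0(9) by (auto simp: vanishes_on_def peval_mult peval_power peval_monomial)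
  qed
next
  case (Suc l)
  let ?s = "Suc l"
  let ?t = "\<lambda>\<alpha>. F 0 ^ k \<alpha> * (\<Prod>i\<in>{1..l}. F i ^ \<alpha> i)"
  define B where "B = {\<alpha>\<in>A. c \<alpha> \<noteq> 0}"
  show ?case
  proof (rule ccontr)
    assume "\<not> ?thesis"
    then have B: "B \<noteq> {}" "finite B" using Suc.prems(6) by (auto simp: B_def)
    define a where "a = Min ((\<lambda>\<alpha>. \<alpha> ?s) ` B)"
    have a_le: "a \<le> \<alpha> ?s" if "\<alpha> \<in> B" for \<alpha> using B that by (simp add: a_def)
    obtain \<beta> where \<beta>: "\<beta> \<in> B" "\<beta> ?s = a"
    proof -
      have "a \<in> (\<lambda>\<alpha>. \<alpha> ?s) ` B" unfolding a_def using B by (intro Min_in) auto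
      then show thesis using that by blast
    qed
    define B' where "B' = {\<alpha>\<in>B. \<alpha> ?s = a}"
    define H where "H = (\<Sum>\<alpha>\<in>B. poly_scale (c \<alpha>) (?t \<alpha> * F ?s ^ (\<alpha> ?s - a)))"
    have L: "k \<alpha> + (\<Sum>i\<in>{1..l}. \<alpha> i) + \<alpha> ?s = L" if "\<alpha> \<in> A" for \<alpha>
      using Suc.prems(8)[OF that] by simp
    have prod: "(\<Prod>i\<in>{1..?s}. F i ^ \<alpha> i) = (\<Prod>i\<in>{1..l}. F i ^ \<alpha> i) * F ?s ^ \<alpha> ?s" for \<alpha>
      by simp
    have "(\<Sum>\<alpha>\<in>A. poly_scale (c \<alpha>) (F 0 ^ k \<alpha> * (\<Prod>i\<in>{1..?s}. F i ^ \<alpha> i))) =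
        (\<Sum>\<alpha>\<in>B. poly_scale (c \<alpha>) (?t \<alpha> * F ?s ^ \<alpha> ?s))"
      unfolding prod B_def using Suc.prems(6)
      by (intro sum.mono_neutral_cong_right) (auto simp: mult.assoc)
    also have "\<dots> = F ?s ^ a * H"
      unfolding H_def sum_distrib_left
    proof (rule sum.cong[OF refl])
      fix \<alpha> assume "\<alpha> \<in> B"
      then have "F ?s ^ \<alpha> ?s = F ?s ^ a * F ?s ^ (\<alpha> ?s - a)" using a_le by (simp flip: power_add)
      then show "poly_scale (c \<alpha>) (?t \<alpha> * F ?s ^ \<alpha> ?s) = F ?s ^ a * poly_scale (c \<alpha>) (?t \<alpha> * F ?s ^ (\<alpha> ?s - a))"
        by (simp add: mult_ac)
    qed
    finally have FH: "vanishes_on (F ?s ^ a * H) (C ?s)" using Suc.prems(9) by simp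
    have "H \<in> forms K (e * (L - a))"
      unfolding H_def
    proof (intro forms_sum forms_scale)
      fix \<alpha> assume \<alpha>: "\<alpha> \<in> B"
      then have "k \<alpha> + (\<Sum>i\<in>{1..l}. \<alpha> i) + (\<alpha> ?s - a) = L - a"
        using L[of \<alpha>] a_le[of \<alpha>] by (simp add: B_def)
      then have "e * k \<alpha> + (\<Sum>i\<in>{1..l}. e * \<alpha> i) + e * (\<alpha> ?s - a) = e * (L - a)"
        by (metis distrib_left sum_distrib_left)
      moreover have "?t \<alpha> * F ?s ^ (\<alpha> ?s - a) \<in>
          forms K (e * k \<alpha> + (\<Sum>i\<in>{1..l}. e * \<alpha> i) + e * (\<alpha> ?s - a))"
        by (intro forms_mult forms_prod forms_power Suc.prems(3)) auto
      ultimately show "?t \<alpha> * F ?s ^ (\<alpha> ?s - a) \<in> forms K (e * (L - a))" by simp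
    qed
    moreover have "F ?s ^ a \<in> forms K (e * a)" using Suc.prems(3) by (intro forms_power) simp
    moreover have "\<not> vanishes_on (F ?s ^ a) (C ?s)"
      using Suc.prems(4)[of ?s] by (auto simp: vanishes_on_def peval_power)
    ultimately have "vanishes_on H (C ?s)"
      using irreducible_in_zariski_forms[OF Suc.prems(1)[of ?s] _ _ FH] by auto
    then have H: "vanishes_on H (C l)" using vanishes_on_subset Suc.prems(2)[of l] by blast
    have "vanishes_on (\<Sum>\<alpha>\<in>B'. poly_scale (c \<alpha>) (?t \<alpha>)) (C l)"
      unfolding vanishes_on_def
    proof (intro ballI)
      fix x v assume xv: "x \<in> C l" "v \<in> x"
      have F0: "peval v (F ?s) = 0" using Suc.prems(5)[of l] xv by (auto simp: vanishes_on_def)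
      have "0 = peval v H" using H xv by (simp add: vanishes_on_def)
      also have "\<dots> = (\<Sum>\<alpha>\<in>B. peval v (poly_scale (c \<alpha>) (?t \<alpha>)) * peval v (F ?s) ^ (\<alpha> ?s - a))"
        by (simp add: H_def peval_sum peval_mult peval_power mult_ac)
      \<comment> \<open>\<open>F ?s\<close> vanishes on \<open>C l\<close>, so only the terms of
        exponent exactly \<open>a\<close> survive, through \<open>0 ^ 0 = 1\<close>.\<close>
      also have "\<dots> = (\<Sum>\<alpha>\<in>B'. peval v (poly_scale (c \<alpha>) (?t \<alpha>)))"
        using B(2) F0 le_antisym[OF a_le]
        by (intro sum.mono_neutral_cong_right) (auto simp: B'_def power_0_left)
      finally show "peval v (\<Sum>\<alpha>\<in>B'. poly_scale (c \<alpha>) (?t \<alpha>)) = 0" by (simp add: peval_sum)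
    qed
    \<comment> \<open>All members of \<open>B'\<close> share the exponent \<open>a\<close> at
      \<open>?s\<close>, so dropping this index identifies no two of them.\<close>
    moreover have "inj_on (\<lambda>\<alpha>. restrict \<alpha> {1..l}) B'"
    proof (rule inj_onI)
      fix \<alpha> \<gamma> assume B': "\<alpha> \<in> B'" "\<gamma> \<in> B'" and eq: "restrict \<alpha> {1..l} = restrict \<gamma> {1..l}"
      have "restrict \<alpha> {1..?s} i = restrict \<gamma> {1..?s} i" for i
      proof (cases "i = ?s")
        case True
        then show ?thesis using B' by (simp add: B'_def)
      next
        case False
        then show ?thesis using fun_cong[OF eq, of i] by (auto simp: restrict_def split: if_splits)
      qed
      then show "\<alpha> = \<gamma>" using inj_onD[OF Suc.prems(7), of \<alpha> \<gamma>] B' by (auto simp: B'_def B_def)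
    qed
    moreover have "k \<alpha> + (\<Sum>i\<in>{1..l}. \<alpha> i) = L - a" if "\<alpha> \<in> B'" for \<alpha>
      using L[of \<alpha>] that by (auto simp: B'_def B_def)
    moreover have "finite B'" using B(2) by (simp add: B'_def)
    ultimately have "\<forall>\<alpha>\<in>B'. c \<alpha> = 0"
      using Suc.prems(1-5) by (intro Suc.IH[of B' "L - a"]) (auto simp del: restrict_apply)
    then show False using \<beta> by (auto simp: B'_def B_def)
  qed
qed

section \<open>Closures of images of rational maps\<close>

lemma eval_tuple_in_affine_space: "eval_tuple K f v \<in> affine_space K"
  by (simp add: eval_tuple_def affine_space_def)

lemma image_subset_proj_space:
  "{proj_pt (eval_tuple K f v) | v. v \<in> affine_space J \<and> eval_tuple K f v \<noteq> 0} \<subseteq> proj_space K"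
  by (auto intro: proj_pt_in_proj_space eval_tuple_in_affine_space)

lemma vanishes_on_image_closure_iff:
  assumes "F \<in> forms K e"
  shows "vanishes_on F (image_closure J K f) \<longleftrightarrow>
    (\<forall>v\<in>affine_space J. eval_tuple K f v \<noteq> 0 \<longrightarrow> peval (eval_tuple K f v) F = 0)"
  unfolding image_closure_def vanishes_on_closure_of_iff[OF image_subset_proj_space assms]
  using form_vanishes_at_proj_pt_iff[OF assms] by (fastforce simp: vanishes_on_def)

lemma image_closure_subset: "image_closure J K f \<subseteq> proj_space K"
  unfolding image_closure_def
  using closure_of_subset_topspace[of "zariski K"] by (simp add: topspace_zariski)

lemma closedin_image_closure: "closedin (zariski K) (image_closure J K f)"
  by (simp add: image_closure_def)

text \<open>If the chain had \<open>card J\<close> or more steps, forms separating its members would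
  give \<open>card J + 1\<close> forms on the target. Pulled back along \<open>f\<close> they live
  in \<open>card J\<close> variables and satisfy a relation, which
  \<open>no_relation_along_chain\<close> forbids.\<close>

lemma chain_in_image_closure_bound:
  fixes f :: "'k \<Rightarrow> ('i, 'a::field) mpoly"
  assumes J: "finite J" "J \<noteq> {}" and f: "\<And>k. k \<in> K \<Longrightarrow> f k \<in> forms J d"
    and closed: "\<And>i. i \<le> m \<Longrightarrow> closedin (zariski K) (C i)"
    and irr: "\<And>i. i \<le> m \<Longrightarrow> irreducible_in (zariski K) (C i)"
    and strict: "\<And>i. i < m \<Longrightarrow> C i \<subset> C (Suc i)"
    and top: "C m \<subseteq> image_closure J K f"
  shows "m < card J"
proof (rule ccontr)
  assume not: "\<not> ?thesis"
  define l where "l = card J"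
  have l: "l \<le> m" using not by (simp add: l_def)
  have "\<exists>F d. F \<in> forms K d \<and> \<not> vanishes_on F (C i) \<and> (i > 0 \<longrightarrow> vanishes_on F (C (i - 1)))" if i: "i \<le> l" for i
  proof (cases i)
    case 0
    have "C 0 \<noteq> {}" "C 0 \<subseteq> proj_space K"
      using irr[of 0] by (auto simp: irreducible_in_def topspace_zariski)
    then have "\<not> vanishes_on 1 (C 0)"
      by (fastforce simp: vanishes_on_def proj_space_def intro: self_in_proj_pt)
    then show ?thesis using 0 one_in_forms by blast
  next
    case (Suc i')
    then obtain x where x: "x \<in> C i" "x \<notin> C i'" using strict[of i'] i l by auto
    moreover have "C i \<subseteq> proj_space K" using closedin_zariski_subset[OF closed[of i]] i l by simp
    ultimately obtain F d where F: "F \<in> forms K d" "vanishes_on F (C i')" "\<not> vanishes_on F {x}"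
      using closedin_zariski_separates[of K "C i'" x] closed[of i'] Suc i l by (metis Suc_leD le_trans subsetD)
    then have "\<not> vanishes_on F (C i)" using x vanishes_on_subset by blast
    then show ?thesis using F Suc by auto
  qed
  then obtain F0 d0 where F0: "\<And>i. i \<le> l \<Longrightarrow> F0 i \<in> forms K (d0 i)"
    "\<And>i. i \<le> l \<Longrightarrow> \<not> vanishes_on (F0 i) (C i)"
    "\<And>i. i \<le> l \<Longrightarrow> i > 0 \<Longrightarrow> vanishes_on (F0 i) (C (i - 1))" by metis
  define e where "e = (\<Sum>i\<le>l. d0 i)"
  have "\<exists>F. F \<in> forms K e \<and> \<not> vanishes_on F (C i) \<and> (i > 0 \<longrightarrow> vanishes_on F (C (i - 1)))" if i: "i \<le> l" for i
  proof -
    obtain x v where x: "x \<in> C i" "v \<in> x" "peval v (F0 i) \<noteq> 0"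
      using F0(2)[OF i] by (auto simp: vanishes_on_def)
    have "C i \<subseteq> proj_space K" using closedin_zariski_subset[OF closed[of i]] i l by simp
    then have "v \<in> affine_space K" "v \<noteq> 0" using proj_space_point x by blast+
    then obtain k where k: "k \<in> K" "v k \<noteq> 0" by (auto simp: affine_space_def fun_eq_iff)
    let ?F = "F0 i * mvar k ^ (e - d0 i)"
    have "d0 i \<le> e" unfolding e_def using i by (intro member_le_sum) auto
    then have "?F \<in> forms K e"
      using forms_mult[OF F0(1)[OF i] forms_power[OF mvar_in_forms[OF k(1)]], of "e - d0 i"] by simp
    moreover have "\<not> vanishes_on ?F (C i)"
      using x k by (auto simp: vanishes_on_def peval_mult peval_power peval_monomial)
    moreover have "i > 0 \<longrightarrow> vanishes_on ?F (C (i - 1))" using F0(3)[OF i] vanishes_on_mult by blast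
    ultimately show ?thesis by blast
  qed
  then obtain F where F: "\<And>i. i \<le> l \<Longrightarrow> F i \<in> forms K e"
    "\<And>i. i \<le> l \<Longrightarrow> \<not> vanishes_on (F i) (C i)"
    "\<And>i. i \<le> l \<Longrightarrow> i > 0 \<Longrightarrow> vanishes_on (F i) (C (i - 1))" by metis
  define G where "G i = psubst (Poly_Mapping.single 0) f (F i)" for i
  have G: "G i \<in> forms J (d * e)" if "i \<le> l" for i
    unfolding G_def using F(1) f that by (intro psubst_in_forms) auto
  obtain A :: "(nat \<Rightarrow> nat) set" and c k L where rel: "finite A" "A \<subseteq> extensional {1..l}"
    "\<And>\<alpha>. \<alpha> \<in> A \<Longrightarrow> k \<alpha> + (\<Sum>i\<in>{1..l}. \<alpha> i) = L" "\<exists>\<alpha>\<in>A. c \<alpha> \<noteq> 0"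
    "(\<Sum>\<alpha>\<in>A. poly_scale (c \<alpha>) (G 0 ^ k \<alpha> * (\<Prod>i\<in>{1..l}. G i ^ \<alpha> i))) = 0"
    by (rule forms_algebraically_dependent[OF J, of G "d * e", folded l_def, OF G]) (assumption, rule that)
  let ?R = "\<lambda>F. \<Sum>\<alpha>\<in>A. poly_scale (c \<alpha>) (F 0 ^ k \<alpha> * (\<Prod>i\<in>{1..l}. F i ^ \<alpha> i))"
  have "?R F \<in> forms K (e * L)"
  proof (intro forms_sum forms_scale)
    fix \<alpha> assume \<alpha>: "\<alpha> \<in> A"
    have "F 0 ^ k \<alpha> * (\<Prod>i\<in>{1..l}. F i ^ \<alpha> i) \<in> forms K (e * k \<alpha> + (\<Sum>i\<in>{1..l}. e * \<alpha> i))"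
      by (intro forms_mult forms_prod forms_power F(1)) auto
    moreover have "e * k \<alpha> + (\<Sum>i\<in>{1..l}. e * \<alpha> i) = e * L"
      unfolding rel(3)[OF \<alpha>, symmetric] by (simp add: sum_distrib_left distrib_left)
    ultimately show "F 0 ^ k \<alpha> * (\<Prod>i\<in>{1..l}. F i ^ \<alpha> i) \<in> forms K (e * L)" by simp
  qed
  moreover have "peval (eval_tuple K f v) (?R F) = 0" for v
  proof -
    have G: "peval (eval_tuple K f v) (F i) = peval v (G i)" if "i \<le> l" for i
      unfolding G_def peval_psubst
      by (rule peval_cong[of _ K]) (use F(1)[OF that] in \<open>auto simp: forms_def eval_tuple_def\<close>)
    have "peval (eval_tuple K f v) (?R F) = peval v (?R G)"
      unfolding peval_sum peval_mult peval_prod peval_power peval_monomial using G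
      by (intro sum.cong refl) (auto intro!: prod.cong)
    then show ?thesis by (simp only: rel(5) peval_0)
  qed
  ultimately have R: "vanishes_on (?R F) (image_closure J K f)"
    using vanishes_on_image_closure_iff by blast
  \<comment> \<open>Only the first \<open>l + 1\<close> members of the chain are used; the relation
    on the whole closure restricts to \<open>C l\<close>.\<close>
  have "C l \<subseteq> C m"
    using l strict
  proof (induction rule: dec_induct)
    case (step k)
    then have "C l \<subseteq> C k" "C k \<subset> C (Suc k)" by simp_all
    then show ?case by blast
  qed simp
  then have "vanishes_on (?R F) (C l)" by (intro vanishes_on_subset[OF R] subset_trans[OF _ top])
  moreover have "inj_on (\<lambda>\<alpha>. restrict \<alpha> {1..l}) A"
  proof (rule inj_onI)
    fix \<alpha> \<beta> assume "\<alpha> \<in> A" "\<beta> \<in> A" "restrict \<alpha> {1..l} = restrict \<beta> {1..l}"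
    moreover from this have "\<alpha> \<in> extensional {1..l}" "\<beta> \<in> extensional {1..l}" using rel(2) by blast+
    ultimately show "\<alpha> = \<beta>" by (simp only: extensional_restrict)
  qed
  moreover have "C i \<subseteq> C (Suc i)" if "i < l" for i using strict[of i] l that by auto
  moreover have "vanishes_on (F (Suc i)) (C i)" if "i < l" for i using F(3)[of "Suc i"] that by simp
  ultimately have "\<forall>\<alpha>\<in>A. c \<alpha> = 0"
    using l irr F(1,2) rel(1,3) by (intro no_relation_along_chain[of l K C F e A k L c]) simp_all
  then show False using rel(4) by blast
qed

lemma krull_dim_subtopology_eqI:
  assumes closed: "closedin T X"
    and chain: "\<And>i. i \<le> n \<Longrightarrow> closedin T (C i)" "\<And>i. i \<le> n \<Longrightarrow> irreducible_in T (C i)"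
      "\<And>i. i < n \<Longrightarrow> C i \<subset> C (Suc i)" "\<And>i. i \<le> n \<Longrightarrow> C i \<subseteq> X"
    and bound: "\<And>m D. (\<And>i. i \<le> m \<Longrightarrow> closedin T (D i)) \<Longrightarrow> (\<And>i. i \<le> m \<Longrightarrow> irreducible_in T (D i)) \<Longrightarrow>
      (\<And>i. i < m \<Longrightarrow> D i \<subset> D (Suc i)) \<Longrightarrow> D m \<subseteq> X \<Longrightarrow> m \<le> n"
  shows "krull_dim (subtopology T X) = enat n"
  unfolding krull_dim_def
proof (rule Sup_eqI)
  fix y assume "y \<in> {enat m | m. \<exists>D. (\<forall>i\<le>m. closedin (subtopology T X) (D i) \<and>
    irreducible_in (subtopology T X) (D i)) \<and> (\<forall>i<m. D i \<subset> D (Suc i))}"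
  then obtain m D where y: "y = enat m" and D: "\<And>i. i \<le> m \<Longrightarrow> closedin (subtopology T X) (D i)"
    "\<And>i. i \<le> m \<Longrightarrow> irreducible_in (subtopology T X) (D i)" "\<And>i. i < m \<Longrightarrow> D i \<subset> D (Suc i)" by auto
  have "m \<le> n"
    using D irreducible_in_subtopology_iff[OF closed] closedin_closed_subtopology[OF closed]
    by (intro bound[of m D]) auto
  then show "y \<le> enat n" by (simp add: y)
next
  fix y assume y: "\<And>z. z \<in> {enat m | m. \<exists>D. (\<forall>i\<le>m. closedin (subtopology T X) (D i) \<and>
    irreducible_in (subtopology T X) (D i)) \<and> (\<forall>i<m. D i \<subset> D (Suc i))} \<Longrightarrow> z \<le> y"
  show "enat n \<le> y"
    using chain irreducible_in_subtopology_iff[OF closed] closedin_closed_subtopology[OF closed]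
    by (intro y CollectI exI[of _ n] conjI exI[of _ C]) auto
qed

section \<open>Toric varieties with a smooth atlas of monomial charts\<close>

interpretation vec: vector_space "vec_scale :: 'a::field \<Rightarrow> ('i \<Rightarrow> 'a) \<Rightarrow> 'i \<Rightarrow> 'a"
  by (rule vector_space_vec_scale)

text \<open>\<open>dual\<close> makes the restriction of \<open>V\<close> to the coordinates
  \<open>S\<close> surjective and \<open>inj\<close> makes it injective; the preimages of the unit
  vectors form a basis. Tangent spaces and first osculating spaces are both measured this
  way.\<close>

lemma vec_dim_eq_card_coordinates:
  fixes V :: "('i \<Rightarrow> 'a::field) set"
  assumes V: "vec.subspace V" and S: "finite S"
    and dual: "\<And>s. s \<in> S \<Longrightarrow> \<exists>b\<in>V. \<forall>s'\<in>S. b s' = (if s = s' then 1 else 0)"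
    and inj: "\<And>w. w \<in> V \<Longrightarrow> (\<And>s. s \<in> S \<Longrightarrow> w s = 0) \<Longrightarrow> w = 0"
  shows "vec_dim V = card S"
proof -
  obtain b where b: "\<And>s. s \<in> S \<Longrightarrow> b s \<in> V"
    "\<And>s s'. s \<in> S \<Longrightarrow> s' \<in> S \<Longrightarrow> b s s' = (if s = s' then 1 else 0)"
    using dual by metis
  have inj_b: "inj_on b S"
  proof (rule inj_onI)
    fix s s' assume s: "s \<in> S" "s' \<in> S" "b s = b s'"
    have "b s s = b s' s" by (simp only: s(3))
    then show "s = s'" unfolding b(2)[OF s(1,1)] b(2)[OF s(2,1)] by (simp split: if_splits)
  qed
  have coord: "(\<Sum>s\<in>S. vec_scale (u s) (b s)) s' = u s'" if "s' \<in> S" for u s'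
  proof -
    have "(\<Sum>s\<in>S. vec_scale (u s) (b s)) s' = (\<Sum>s\<in>S. u s * b s s')"
      using S by (induction S rule: finite_induct) auto
    also have "\<dots> = (\<Sum>s\<in>S. if s = s' then u s else 0)"
      using b(2) that by (intro sum.cong) auto
    finally show ?thesis using S that by simp
  qed
  show ?thesis
  proof (rule vec.dim_unique[of "b ` S"])
    show "b ` S \<subseteq> V" using b by blast
    show "V \<subseteq> vec.span (b ` S)"
    proof
      fix w assume w: "w \<in> V"
      let ?p = "\<Sum>s\<in>S. vec_scale (w s) (b s)"
      have "?p \<in> V" using V b(1) by (intro vec.subspace_sum vec.subspace_scale)
      moreover have "(w - ?p) s = 0" if "s \<in> S" for s using coord[OF that] by simp
      ultimately have "w - ?p = 0" using V w by (intro inj vec.subspace_diff)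
      then have "w = ?p" by simp
      also have "\<dots> \<in> vec.span (b ` S)"
        by (intro vec.span_sum vec.span_scale vec.span_base) auto
      finally show "w \<in> vec.span (b ` S)" .
    qed
    show "vec.independent (b ` S)"
    proof
      assume "vec.dependent (b ` S)"
      then obtain u where u: "\<exists>v\<in>b ` S. u v \<noteq> 0" "(\<Sum>v\<in>b ` S. vec_scale (u v) v) = 0"
        using vec.dependent_finite S by blast
      then have "(\<Sum>s\<in>S. vec_scale (u (b s)) (b s)) = 0" by (simp add: sum.reindex[OF inj_b])
      then have "u (b s) = 0" if "s \<in> S" for s using coord[OF that, of "u \<circ> b"] by simp
      then show False using u by blast
    qed
    show "card (b ` S) = card S" by (rule card_image[OF inj_b])
  qed
qed

text \<open>
  A chart \<open>h\<close> has origin \<open>A h\<close> and affine coordinates \<open>E h t / A h\<close> for \<open>t \<in> T h\<close>, in which the quotient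
  \<open>m / A h\<close> is the monomial with exponents \<open>c h m\<close>.  The exponents \<open>d h\<close> describe a point of the source with
  prescribed affine coordinates, up to the scaling factor with exponents \<open>D h\<close>.
\<close>

locale toric_atlas =
  fixes J :: "'i set" and M :: "('i \<Rightarrow>\<^sub>0 nat) set" and g :: nat
    and H :: "'h set" and A :: "'h \<Rightarrow> 'i \<Rightarrow>\<^sub>0 nat" and T :: "'h \<Rightarrow> 't set"
    and E :: "'h \<Rightarrow> 't \<Rightarrow> 'i \<Rightarrow>\<^sub>0 nat" and c :: "'h \<Rightarrow> ('i \<Rightarrow>\<^sub>0 nat) \<Rightarrow> 't \<Rightarrow> nat"
    and d :: "'h \<Rightarrow> 'i \<Rightarrow> 't \<Rightarrow> nat" and D :: "'h \<Rightarrow> 't \<Rightarrow> nat"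
  assumes finite_J: "finite J"
    and monomials: "m \<in> M \<Longrightarrow> keys m \<subseteq> J" "m \<in> M \<Longrightarrow> mdeg m = g"
    and finite_T: "h \<in> H \<Longrightarrow> finite (T h)"
    and A_in: "h \<in> H \<Longrightarrow> A h \<in> M"
    and E_in: "h \<in> H \<Longrightarrow> t \<in> T h \<Longrightarrow> E h t \<in> M"
    and c_A: "h \<in> H \<Longrightarrow> t \<in> T h \<Longrightarrow> c h (A h) t = 0"
    and c_E: "h \<in> H \<Longrightarrow> s \<in> T h \<Longrightarrow> t \<in> T h \<Longrightarrow> c h (E h s) t = (if s = t then 1 else 0)"
    and quotient: "h \<in> H \<Longrightarrow> m \<in> M \<Longrightarrow> i \<in> J \<Longrightarrow> lookup m i + (\<Sum>t\<in>T h. c h m t) * lookup (A h) i =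
      lookup (A h) i + (\<Sum>t\<in>T h. c h m t * lookup (E h t) i)"
    and source: "h \<in> H \<Longrightarrow> m \<in> M \<Longrightarrow> t \<in> T h \<Longrightarrow> (\<Sum>i\<in>J. d h i t * lookup m i) = D h t + c h m t"
    and cover: "m \<in> M \<Longrightarrow> \<exists>h\<in>H. \<exists>h'\<in>H. m + m = A h + A h'"

text \<open>The projective coordinates \<open>e\<close> may repeat monomials and may omit members of
  \<open>M\<close> other than the origins and edges of the charts. One locale thus covers both
  \<open>X\<close> and the Segre model of the blow-up.\<close>

locale toric_family = toric_atlas J M g H A T E c d D
  for J :: "'i set" and M g and H :: "'h set" and A and T :: "'h \<Rightarrow> 't set" and E c d D +
  fixes K :: "'k set" and e :: "'k \<Rightarrow> 'i \<Rightarrow>\<^sub>0 nat"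
  assumes finite_K: "finite K" and K_nonempty: "K \<noteq> {}" and e_in: "k \<in> K \<Longrightarrow> e k \<in> M"
    and A_image: "h \<in> H \<Longrightarrow> A h \<in> e ` K"
    and E_image: "h \<in> H \<Longrightarrow> t \<in> T h \<Longrightarrow> E h t \<in> e ` K"
begin

abbreviation mtuple :: "'k \<Rightarrow> ('i, 'a::field_char_0) mpoly" where "mtuple \<equiv> \<lambda>k. xpow (e k)"

abbreviation X :: "('k \<Rightarrow> 'a::field_char_0) set set" where "X \<equiv> image_closure J K mtuple"

text \<open>Several indices may carry the origin monomial; \<open>inv_into\<close> picks one of
  them, and \<open>b\<close> does the same for the edges.\<close>

definition a :: "'h \<Rightarrow> 'k" where "a h = inv_into K e (A h)"
definition b :: "'h \<Rightarrow> 't \<Rightarrow> 'k" where "b h t = inv_into K e (E h t)"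

definition chart :: "'h \<Rightarrow> ('t \<Rightarrow> 'a::field_char_0) \<Rightarrow> 'k \<Rightarrow> 'a"
  where "chart h x = (\<lambda>k. if k \<in> K then \<Prod>t\<in>T h. x t ^ c h (e k) t else 0)"

lemma a: "h \<in> H \<Longrightarrow> a h \<in> K" "h \<in> H \<Longrightarrow> e (a h) = A h"
  using A_image by (simp_all add: a_def inv_into_into f_inv_into_f)

lemma b: "h \<in> H \<Longrightarrow> t \<in> T h \<Longrightarrow> b h t \<in> K" "h \<in> H \<Longrightarrow> t \<in> T h \<Longrightarrow> e (b h t) = E h t"
  using E_image by (simp_all add: b_def inv_into_into f_inv_into_f)

lemma b_neq_a: "h \<in> H \<Longrightarrow> t \<in> T h \<Longrightarrow> b h t \<noteq> a h"
  using a(2) b(2) c_A c_E by (metis zero_neq_one)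

lemma inj_on_b: "h \<in> H \<Longrightarrow> inj_on (b h) (T h)"
  using b(2) c_E by (intro inj_onI) (metis zero_neq_one)

lemma H_nonempty: "H \<noteq> {}"
  using K_nonempty e_in cover by blast

lemma mtuple_forms: "k \<in> K \<Longrightarrow> mtuple k \<in> forms J g"
  using e_in monomials by (intro monomial_in_forms) blast+

lemma eval_mtuple: "eval_tuple K mtuple v = (\<lambda>k. if k \<in> K then mval v (e k) else 0)"
  by (rule ext) (simp add: eval_tuple_def peval_monomial)

lemma mval_M: "m \<in> M \<Longrightarrow> mval v m = (\<Prod>i\<in>J. v i ^ lookup m i)"
  using monomials finite_J by (intro mval_superset) blast+

lemma form_vanishes_on_X_iff:
  "f \<in> forms K l \<Longrightarrow> vanishes_on f X \<longleftrightarrow> (\<forall>v\<in>affine_space J. eval_tuple K mtuple v \<noteq> 0 \<longrightarrow>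
    peval (eval_tuple K mtuple v) f = 0)"
  by (rule vanishes_on_image_closure_iff)

lemma X_point: "x \<in> X \<Longrightarrow> z \<in> x \<Longrightarrow> z \<in> affine_space K \<and> z \<noteq> 0 \<and> x = proj_pt z"
  using image_closure_subset proj_space_point by blast

lemma chart_a [simp]: "h \<in> H \<Longrightarrow> chart h x (a h) = 1"
  using a c_A by (simp add: chart_def)

lemma chart_b [simp]:
  assumes "h \<in> H" "t \<in> T h"
  shows "chart h x (b h t) = x t"
proof -
  have "chart h x (b h t) = (\<Prod>s\<in>T h. x s ^ (if t = s then 1 else 0))"
    unfolding chart_def using b[OF assms] c_E[OF assms] by (auto intro: prod.cong)
  also have "\<dots> = (\<Prod>s\<in>T h. if t = s then x s else 1)" by (auto intro: prod.cong)
  finally show ?thesis using assms finite_T by simp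
qed

lemma chart_in_affine_space: "chart h x \<in> affine_space K"
  by (simp add: chart_def affine_space_def)

lemma chart_neq_0: "h \<in> H \<Longrightarrow> chart h x \<noteq> 0"
  using chart_a[of h x] by (metis zero_fun_apply zero_neq_one)

text \<open>The equation z_k / z_a = prod (z_b / z_a)^c, multiplied by z_a to the power 1 + (sum of
  c). Clearing denominators makes it a form, so it extends from the image to its closure.\<close>

definition chart_relation :: "'h \<Rightarrow> 'k \<Rightarrow> ('k, 'a::field_char_0) mpoly"
  where "chart_relation h k = mvar k * mvar (a h) ^ (\<Sum>t\<in>T h. c h (e k) t) -
    mvar (a h) * (\<Prod>t\<in>T h. mvar (b h t) ^ c h (e k) t)"

lemma peval_chart_relation: "peval z (chart_relation h k) = z k * z (a h) ^ (\<Sum>t\<in>T h. c h (e k) t) -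
    z (a h) * (\<Prod>t\<in>T h. z (b h t) ^ c h (e k) t)"
  by (simp add: chart_relation_def peval_diff peval_mult peval_power peval_prod peval_monomial)

lemma chart_relation_form:
  assumes "h \<in> H" "k \<in> K"
  shows "(chart_relation h k :: ('k, 'a::field_char_0) mpoly) \<in> forms K (1 + (\<Sum>t\<in>T h. c h (e k) t))"
proof -
  let ?x = "mvar :: 'k \<Rightarrow> ('k, 'a) mpoly"
  have "?x k * ?x (a h) ^ (\<Sum>t\<in>T h. c h (e k) t) \<in> forms K (1 + 1 * (\<Sum>t\<in>T h. c h (e k) t))"
    using assms a by (intro forms_mult forms_power mvar_in_forms) auto
  moreover have "?x (a h) * (\<Prod>t\<in>T h. ?x (b h t) ^ c h (e k) t) \<in>
      forms K (1 + (\<Sum>t\<in>T h. 1 * c h (e k) t))"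
    using assms a b by (intro forms_mult forms_prod forms_power mvar_in_forms) auto
  ultimately show ?thesis unfolding chart_relation_def by (simp add: forms_diff)
qed

lemma chart_relation_vanishes:
  assumes h: "h \<in> H" and k: "k \<in> K"
  shows "vanishes_on (chart_relation h k :: ('k, 'a::field_char_0) mpoly) X"
  unfolding form_vanishes_on_X_iff[OF chart_relation_form[OF assms]]
proof (intro ballI impI)
  fix v :: "'i \<Rightarrow> 'a"
  let ?S = "\<Sum>t\<in>T h. c h (e k) t"
  have "mval v (e k) * mval v (A h) ^ ?S = (\<Prod>i\<in>J. v i ^ (lookup (e k) i + ?S * lookup (A h) i))"
    by (simp add: mval_M e_in[OF k] A_in[OF h] prod.distrib power_add
        prod_power_distrib mult.commute[of ?S] power_mult)
  also have "\<dots> = (\<Prod>i\<in>J. v i ^ (lookup (A h) i + (\<Sum>t\<in>T h. c h (e k) t * lookup (E h t) i)))"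
    using quotient[OF h e_in[OF k]] by simp
  also have "\<dots> = mval v (A h) * (\<Prod>i\<in>J. \<Prod>t\<in>T h. v i ^ (c h (e k) t * lookup (E h t) i))"
    by (simp add: mval_M A_in[OF h] prod.distrib power_add power_sum)
  also have "(\<Prod>i\<in>J. \<Prod>t\<in>T h. v i ^ (c h (e k) t * lookup (E h t) i)) =
      (\<Prod>t\<in>T h. \<Prod>i\<in>J. v i ^ (c h (e k) t * lookup (E h t) i))"
    by (rule prod.swap)
  also have "\<dots> = (\<Prod>t\<in>T h. mval v (E h t) ^ c h (e k) t)"
    using h by (intro prod.cong refl)
      (simp add: mval_M E_in prod_power_distrib mult.commute flip: power_mult)
  finally show "peval (eval_tuple K mtuple v) (chart_relation h k) = 0"
    using a b h k by (simp add: peval_chart_relation eval_mtuple)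
qed

lemma vanishing_ideal_memI:
  "f \<in> forms K l \<Longrightarrow> vanishes_on f Z \<Longrightarrow> f \<in> vanishing_ideal K Z"
  by (simp add: vanishing_ideal_def forms_def vanishes_on_def)

text \<open>Where the origin coordinate is nonzero, the chart relations can be solved for every
  coordinate: \<open>X\<close> is there a graph over the affine coordinates.\<close>

lemma point_in_chart:
  fixes x :: "('k \<Rightarrow> 'a::field_char_0) set"
  assumes x: "x \<in> X" "z \<in> x" and h: "h \<in> H" and za: "z (a h) \<noteq> 0"
  shows "z k = z (a h) * chart h (\<lambda>t. z (b h t) / z (a h)) k"
proof (cases "k \<in> K")
  case True
  let ?S = "\<Sum>t\<in>T h. c h (e k) t"
  have "z k * z (a h) ^ ?S = z (a h) * (\<Prod>t\<in>T h. z (b h t) ^ c h (e k) t)"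
    using chart_relation_vanishes[OF h True] x by (auto simp: vanishes_on_def peval_chart_relation)
  moreover have "(\<Prod>t\<in>T h. (z (b h t) / z (a h)) ^ c h (e k) t) =
      (\<Prod>t\<in>T h. z (b h t) ^ c h (e k) t) / z (a h) ^ ?S"
    by (simp add: power_divide prod_dividef power_sum)
  ultimately show ?thesis using za True by (simp only: chart_def if_True) (simp add: divide_simps)
next
  case False
  then show ?thesis using X_point[OF x] by (simp add: chart_def affine_space_def)
qed

lemma point_eq_chart:
  assumes "x \<in> X" "z \<in> x" "h \<in> H" "z (a h) \<noteq> 0"
  shows "x = proj_pt (chart h (\<lambda>t. z (b h t) / z (a h)))"
  using X_point[OF assms(1,2)] proj_pt_eqI[OF assms(4) point_in_chart[OF assms]] by simp

text \<open>If all affine coordinates are nonzero, \<open>source\<close> exhibits the point as an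
  image. Any other point lies on a line in the diagonal direction of the chart that meets the
  coordinate hyperplanes finitely often, so forms vanishing on \<open>X\<close> vanish there
  too.\<close>

lemma chart_in_X:
  fixes x :: "'t \<Rightarrow> 'a::field_char_0"
  assumes h: "h \<in> H"
  shows "proj_pt (chart h x) \<in> X"
proof -
  have torus: "peval (chart h y) f = 0"
    if y: "\<And>t. t \<in> T h \<Longrightarrow> y t \<noteq> 0" and f: "f \<in> forms K l" "vanishes_on f X"
    for y :: "'t \<Rightarrow> 'a" and f l
  proof -
    define v where "v i = (if i \<in> J then \<Prod>t\<in>T h. y t ^ d h i t else 0)" for i
    define r where "r = (\<Prod>t\<in>T h. y t ^ D h t)"
    have r: "r \<noteq> 0" using y finite_T[OF h] by (simp add: r_def)
    have "mval v (e k) = r * chart h y k" if k: "k \<in> K" for k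
    proof -
      have "mval v (e k) = (\<Prod>i\<in>J. \<Prod>t\<in>T h. y t ^ (d h i t * lookup (e k) i))"
        unfolding mval_M[OF e_in[OF k]] v_def by (simp add: power_mult prod_power_distrib)
      also have "\<dots> = (\<Prod>t\<in>T h. \<Prod>i\<in>J. y t ^ (d h i t * lookup (e k) i))" by (rule prod.swap)
      also have "\<dots> = (\<Prod>t\<in>T h. y t ^ (D h t + c h (e k) t))"
        using source[OF h e_in[OF k]] by (intro prod.cong refl) (simp flip: power_sum)
      finally show ?thesis using k by (simp add: r_def chart_def power_add prod.distrib)
    qed
    then have ev: "eval_tuple K mtuple v = (\<lambda>k. r * chart h y k)"
      by (auto simp: eval_mtuple chart_def)
    moreover from this have "eval_tuple K mtuple v (a h) \<noteq> 0" using r h by simp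
    moreover have "v \<in> affine_space J" by (simp add: affine_space_def v_def)
    ultimately have "peval (\<lambda>k. r * chart h y k) f = 0"
      using f form_vanishes_on_X_iff[OF f(1)] by (metis zero_fun_apply)
    then show ?thesis using peval_scale[OF f(1)] r by simp
  qed
  have "vanishes_on f {proj_pt (chart h x)}" if f: "f \<in> forms K l" "vanishes_on f X" for f l
  proof -
    define P where "P k = (if k \<in> K then \<Prod>t\<in>T h. [:x t, 1:] ^ c h (e k) t else 0)" for k
    have P: "poly (P k) s = chart h (\<lambda>t. x t + s) k" for k s
      by (simp add: P_def chart_def poly_prod)
    have "psubst (\<lambda>c. [:c:]) P f = 0"
    proof (rule poly_eq_0_if_cofinitely_many_roots)
      show "finite ((\<lambda>t. - x t) ` T h)" using finite_T[OF h] by simp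
      fix s assume "s \<notin> (\<lambda>t. - x t) ` T h"
      then have "x t + s \<noteq> 0" if "t \<in> T h" for t
        using that by (auto simp: add_eq_0_iff)
      then show "poly (psubst (\<lambda>c. [:c:]) P f) s = 0" by (simp add: poly_psubst P torus[OF _ f])
    qed
    then have "peval (\<lambda>k. poly (P k) 0) f = 0" using poly_psubst[of P f 0] by simp
    then have "peval (chart h x) f = 0" by (simp add: P)
    then show ?thesis using form_vanishes_at_proj_pt_iff[OF f(1)] by (simp add: vanishes_on_def)
  qed
  then show ?thesis
    unfolding image_closure_def in_closure_of_zariski_iff[OF image_subset_proj_space]
    using proj_pt_in_proj_space[OF chart_in_affine_space chart_neq_0[OF h]]
    by (auto simp: image_closure_def vanishes_on_closure_of_iff[OF image_subset_proj_space])
qed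

text \<open>\<open>f\<close> ranges over the full ideal and not only its forms; the scalar
  \<open>r\<close> is absorbed by the quantification over all representatives in
  \<open>vanishing_ideal\<close>.\<close>

lemma vanishing_ideal_chart:
  assumes "h \<in> H" "f \<in> vanishing_ideal K X" "r \<noteq> 0"
  shows "peval (\<lambda>k. r * chart h x k) f = 0"
proof -
  have "(\<lambda>k. r * chart h x k) \<in> proj_pt (chart h x)" using assms(3) by (auto simp: proj_pt_def)
  moreover have "\<forall>v\<in>proj_pt (chart h x). peval v f = 0"
    using assms(2) chart_in_X[OF assms(1), of x] by (simp add: vanishing_ideal_def)
  ultimately show ?thesis by blast
qed

text \<open>\<open>cover\<close> yields the equation z_k^2 = z_a z_a' on the image and so on the
  closure. If all origin coordinates vanished, every coordinate would.\<close>

lemma exists_chart: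
  assumes "x \<in> X" "z \<in> x"
  shows "\<exists>h\<in>H. z (a h) \<noteq> 0"
proof (rule ccontr)
  assume za: "\<not> ?thesis"
  have "z k = 0" if k: "k \<in> K" for k
  proof -
    obtain h h' where h: "h \<in> H" "h' \<in> H" "e k + e k = A h + A h'" using cover e_in k by blast
    let ?f = "mvar k * mvar k - mvar (a h) * mvar (a h') :: ('k, 'a) mpoly"
    have f: "?f \<in> forms K (1 + 1)" using h k a by (intro forms_diff forms_mult mvar_in_forms) auto
    have "mval v (e k) * mval v (e k) = mval v (A h) * mval v (A h')" for v :: "'i \<Rightarrow> 'a"
      using h(3) by (metis mval_add)
    then have "vanishes_on ?f X"
      unfolding form_vanishes_on_X_iff[OF f] using h k a
      by (simp add: peval_diff peval_mult peval_monomial eval_mtuple)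
    then have "peval z ?f = 0" using assms by (auto simp: vanishes_on_def)
    then show ?thesis using za h by (simp add: peval_diff peval_mult peval_monomial)
  qed
  then show False using X_point[OF assms] by (auto simp: affine_space_def fun_eq_iff)
qed

subsection \<open>Smoothness\<close>

lemma subspace_tangent_space: "vec.subspace (tangent_space K Z z)"
  by (auto simp: vec.subspace_def tangent_space_def affine_space_def distrib_left sum.distrib
      mult.left_commute simp flip: sum_distrib_left)

text \<open>Along the curve an element of the ideal becomes a polynomial with cofinitely many zeros,
  hence 0, and its derivative at 0 is the tangency condition for the velocity.\<close>

lemma curve_velocity_in_tangent_space:
  fixes P :: "'k \<Rightarrow> 'a::field_char_0 poly"
  assumes "finite F" "\<And>s f. s \<notin> F \<Longrightarrow> f \<in> vanishing_ideal K Z \<Longrightarrow> peval (\<lambda>k. poly (P k) s) f = 0"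
    and "\<And>k. k \<notin> K \<Longrightarrow> P k = 0"
  shows "(\<lambda>k. poly (pderiv (P k)) 0) \<in> tangent_space K Z (\<lambda>k. poly (P k) 0)"
proof -
  have "(\<Sum>j\<in>K. peval (\<lambda>k. poly (P k) 0) (pdiff j f) * poly (pderiv (P j)) 0) = 0"
    if f: "f \<in> vanishing_ideal K Z" for f
  proof -
    have "psubst (\<lambda>c. [:c:]) P f = 0"
      using assms(1,2) f by (intro poly_eq_0_if_cofinitely_many_roots) (auto simp: poly_psubst)
    then show ?thesis
      using pderiv_psubst[OF finite_K, of f P 0] f by (simp add: vanishing_ideal_def)
  qed
  then show ?thesis using assms(3) by (simp add: tangent_space_def affine_space_def)
qed

text \<open>The origin and edge entries \<open>?S\<close> are coordinates on the tangent space of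
  the cone: curves through \<open>z\<close> realise all unit vectors, and the linearised chart
  relations determine the remaining entries.\<close>

lemma dim_tangent_space:
  fixes x :: "('k \<Rightarrow> 'a::field_char_0) set"
  assumes x: "x \<in> X" "z \<in> x" and h: "h \<in> H" and za: "z (a h) \<noteq> 0"
  shows "vec_dim (tangent_space K X z) = card (T h) + 1"
proof -
  let ?V = "tangent_space K X z"
  let ?S = "insert (a h) (b h ` T h)"
  define y where "y t = z (b h t) / z (a h)" for t
  have z: "z k = z (a h) * chart h y k" for k unfolding y_def by (rule point_in_chart[OF assms])
  have "vec_dim ?V = card ?S"
  proof (rule vec_dim_eq_card_coordinates[OF subspace_tangent_space])
    show "finite ?S" using finite_T[OF h] by simp
  next
    fix s assume s: "s \<in> ?S"
    define \<alpha> where "\<alpha> = (if s = a h then 1 else 0 :: 'a)"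
    \<comment> \<open>An edge entry is the scaling factor times an affine coordinate, with velocity
      \<open>\<alpha> * y t + z (a h) * \<beta> t\<close>; \<open>\<beta>\<close> is solved from the
      prescribed value of this velocity.\<close>
    define \<beta> where "\<beta> t = ((if s = b h t then 1 else 0) - \<alpha> * y t) / z (a h)" for t
    define P where "P k = (if k \<in> K then [:z (a h), \<alpha>:] * (\<Prod>t\<in>T h. [:y t, \<beta> t:] ^ c h (e k) t) else 0)" for k
    have P: "poly (P k) r = (z (a h) + r * \<alpha>) * chart h (\<lambda>t. y t + r * \<beta> t) k" for k r
      by (simp add: P_def chart_def poly_prod algebra_simps)
    have "(\<lambda>k. poly (pderiv (P k)) 0) \<in> tangent_space K X (\<lambda>k. poly (P k) 0)"
    proof (rule curve_velocity_in_tangent_space)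
      \<comment> \<open>Where the scaling factor vanishes the curve is at the zero vector, which
        represents no point.\<close>
      show "finite {r. poly [:z (a h), \<alpha>:] r = 0}" using za by (intro poly_roots_finite) simp
      show "P k = 0" if "k \<notin> K" for k using that by (simp add: P_def)
      fix r and f :: "('k, 'a) mpoly" assume "r \<notin> {r. poly [:z (a h), \<alpha>:] r = 0}" "f \<in> vanishing_ideal K X"
      then show "peval (\<lambda>k. poly (P k) r) f = 0"
        unfolding P by (intro vanishing_ideal_chart[OF h]) simp_all
    qed
    also have "(\<lambda>k. poly (P k) 0) = z" by (rule ext) (simp add: P flip: z)
    finally have w: "(\<lambda>k. poly (pderiv (P k)) 0) \<in> ?V" .
    have P_a: "P (a h) = [:z (a h), \<alpha>:]" using a c_A h by (simp add: P_def)
    have P_b: "P (b h t) = [:z (a h), \<alpha>:] * [:y t, \<beta> t:]" if t: "t \<in> T h" for t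
    proof -
      have "(\<Prod>s\<in>T h. [:y s, \<beta> s:] ^ c h (e (b h t)) s) = (\<Prod>s\<in>T h. if t = s then [:y s, \<beta> s:] else 1)"
        using b(2)[OF h t] c_E[OF h t] by (intro prod.cong) auto
      also have "\<dots> = [:y t, \<beta> t:]" using finite_T[OF h] t by simp
      finally show ?thesis using b(1)[OF h t] by (simp only: P_def if_True)
    qed
    have "poly (pderiv (P (a h))) 0 = \<alpha>" by (simp add: P_a pderiv_pCons)
    moreover have "poly (pderiv (P (b h t))) 0 = (if s = b h t then 1 else 0)" if "t \<in> T h" for t
      using za by (simp add: P_b[OF that] pderiv_mult pderiv_pCons \<beta>_def)
    ultimately have "\<forall>s'\<in>?S. poly (pderiv (P s')) 0 = (if s = s' then 1 else 0)"
      by (auto simp: \<alpha>_def)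
    then show "\<exists>w\<in>?V. \<forall>s'\<in>?S. w s' = (if s = s' then 1 else 0)"
      using w by (intro bexI[of _ "\<lambda>k. poly (pderiv (P k)) 0"])
  next
    fix w assume w: "w \<in> ?V" and w0: "\<And>s. s \<in> ?S \<Longrightarrow> w s = 0"
    have "w k = 0" if k: "k \<in> K" for k
    proof -
      let ?n = "\<Sum>t\<in>T h. c h (e k) t"
      let ?f = "chart_relation h k :: ('k, 'a) mpoly"
      let ?P = "\<lambda>j. [:z j, w j:]"
      have f: "?f \<in> vanishing_ideal K X"
        using vanishing_ideal_memI[OF chart_relation_form chart_relation_vanishes] h k by blast
      \<comment> \<open>Along the line \<open>z + r * w\<close> only the factor \<open>z k\<close>
        can vary in the chart relation, since \<open>w\<close> is 0 on \<open>?S\<close>. The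
        relation is therefore affine in \<open>r\<close> with slope
        \<open>w k * z (a h) ^ ?n\<close>.\<close>
      have "psubst (\<lambda>c. [:c:]) ?P ?f - [:peval z ?f, w k * z (a h) ^ ?n:] = 0"
      proof (rule poly_eq_0_if_cofinitely_many_roots[of "{}"])
        fix r :: 'a
        have "(\<Prod>t\<in>T h. (z (b h t) + r * w (b h t)) ^ c h (e k) t) =
            (\<Prod>t\<in>T h. z (b h t) ^ c h (e k) t)"
          using w0 by (intro prod.cong) auto
        then show "poly (psubst (\<lambda>c. [:c:]) ?P ?f - [:peval z ?f, w k * z (a h) ^ ?n:]) r = 0"
          using w0 by (simp add: poly_psubst peval_chart_relation algebra_simps)
      qed simp
      then have "poly (pderiv (psubst (\<lambda>c. [:c:]) ?P ?f)) 0 = w k * z (a h) ^ ?n"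
        by (simp add: pderiv_pCons)
      moreover have "poly (pderiv (psubst (\<lambda>c. [:c:]) ?P ?f)) 0 = 0"
        using pderiv_psubst[OF finite_K, of ?f ?P 0] f w
        by (simp add: vanishing_ideal_def tangent_space_def pderiv_pCons)
      ultimately show ?thesis using za by simp
    qed
    then show "w = 0" using w by (auto simp: tangent_space_def affine_space_def fun_eq_iff)
  qed
  also have "card ?S = card (T h) + 1"
    using finite_T[OF h] b_neq_a[OF h, symmetric] card_image[OF inj_on_b[OF h]]
    by (subst card_insert_disjoint) auto
  finally show ?thesis .
qed

lemma irreducible_X: "irreducible_in (zariski K) (X :: ('k \<Rightarrow> 'a::field_char_0) set set)"
proof -
  let ?\<phi> = "eval_tuple K mtuple :: ('i \<Rightarrow> 'a) \<Rightarrow> 'k \<Rightarrow> 'a"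
  let ?S = "?\<phi> ` affine_space J - {0}"
  obtain k where k: "k \<in> K" using K_nonempty by blast
  define v where "v i = (if i \<in> J then 1 else 0 :: 'a)" for i
  have "?\<phi> v k = 1" using k monomials(1)[OF e_in[OF k]] by (auto simp: eval_mtuple mval_def v_def intro!: prod.neutral)
  then have "?\<phi> v \<noteq> 0" by (metis zero_fun_apply zero_neq_one)
  moreover have "v \<in> affine_space J" by (simp add: affine_space_def v_def)
  ultimately have ne: "?S \<noteq> {}" by blast
  have sub: "?S \<subseteq> affine_space K - {0}" by (auto intro: eval_tuple_in_affine_space)
  have "irreducible_in (zariski K) (proj_pt ` ?S)"
  proof (rule irreducible_in_zariski_curves[OF sub ne])
    fix p q assume "p \<in> ?S" "q \<in> ?S"
    then obtain v w where v: "v \<in> affine_space J" "p = ?\<phi> v" and w: "w \<in> affine_space J" "q = ?\<phi> w"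
      by blast
    \<comment> \<open>The image of the segment from \<open>v\<close> to \<open>w\<close>. It may
      cross the base locus, where the tuple is 0.\<close>
    define P where "P k = (if k \<in> K then \<Prod>i\<in>keys (e k). [:v i, w i - v i:] ^ lookup (e k) i else 0)" for k
    have P: "(\<lambda>k. poly (P k) s) = ?\<phi> (\<lambda>i. v i + s * (w i - v i))" for s
      by (auto simp: P_def eval_mtuple poly_prod mval_def)
    have "(\<lambda>i. v i + s * (w i - v i)) \<in> affine_space J" for s
      using v w by (simp add: affine_space_def)
    then have "\<forall>s. (\<lambda>k. poly (P k) s) \<in> insert 0 ?S" unfolding P by blast
    moreover have "poly (P k) 0 = p k" "poly (P k) 1 = q k" for k
      using fun_cong[OF P[of 0], of k] fun_cong[OF P[of 1], of k] v w by simp_all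
    ultimately show "\<exists>P :: 'k \<Rightarrow> 'a poly. (\<forall>k. poly (P k) 0 = p k \<and> poly (P k) 1 = q k) \<and>
        (\<forall>s. (\<lambda>k. poly (P k) s) \<in> insert 0 ?S)" by blast
  qed
  moreover have "proj_pt ` ?S = {proj_pt (?\<phi> v) | v. v \<in> affine_space J \<and> ?\<phi> v \<noteq> 0}" by blast
  ultimately show ?thesis by (simp add: image_closure_def irreducible_in_closure_of)
qed

text \<open>The coordinate subspaces of a single chart, with 0 to \<open>n\<close> free coordinates,
  give a chain of length \<open>n\<close>; \<open>chain_in_image_closure_bound\<close> for
  \<open>n + 1\<close> variables forbids a longer one.\<close>

lemma krull_dim_X:
  assumes n: "card J = n + 1" "\<And>h. h \<in> H \<Longrightarrow> card (T h) = n"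
  shows "krull_dim (subtopology (zariski K) (X :: ('k \<Rightarrow> 'a::field_char_0) set set)) = enat n"
proof -
  obtain h where h: "h \<in> H" using H_nonempty by blast
  obtain \<tau> where \<tau>: "bij_betw \<tau> {0..<n} (T h)"
    using ex_bij_betw_nat_finite[OF finite_T[OF h]] n(2)[OF h] by auto
  have \<tau>_in: "\<tau> i \<in> T h" if "i < n" for i using bij_betwE[OF \<tau>] that by simp
  have \<tau>_eq: "\<tau> i = \<tau> j \<longleftrightarrow> i = j" if "i < n" "j < n" for i j
    using bij_betw_imp_inj_on[OF \<tau>] that by (auto simp: inj_on_def)
  define L where "L i = {x :: 't \<Rightarrow> 'a. \<forall>j. i \<le> j \<and> j < n \<longrightarrow> x (\<tau> j) = 0}" for i
  define S where "S i = chart h ` L i" for i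
  define C where "C i = zariski K closure_of (proj_pt ` S i)" for i
  have S_sub: "S i \<subseteq> affine_space K - {0}" for i
    using chart_in_affine_space chart_neq_0[OF h] by (auto simp: S_def)
  then have S_pts: "proj_pt ` S i \<subseteq> proj_space K" for i by (auto simp: proj_space_def)
  have van: "vanishes_on (mvar (b h (\<tau> j))) (C i) \<longleftrightarrow> (\<forall>x\<in>L i. x (\<tau> j) = 0)" if "j < n" for i j
  proof -
    have f: "mvar (b h (\<tau> j)) \<in> forms K 1" using b(1) h \<tau>_in[OF that] by (intro mvar_in_forms)
    show ?thesis
      unfolding C_def vanishes_on_closure_of_iff[OF S_pts f] vanishes_on_proj_pt_image_iff[OF f]
      using h \<tau>_in[OF that] by (simp add: S_def peval_monomial)
  qed
  show ?thesis
  proof (rule krull_dim_subtopology_eqI[of _ _ _ C])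
    show "closedin (zariski K) X" by (rule closedin_image_closure)
    show "closedin (zariski K) (C i)" for i by (simp add: C_def)
    show "irreducible_in (zariski K) (C i)" for i
      unfolding C_def
    proof (intro irreducible_in_closure_of irreducible_in_zariski_curves[OF S_sub])
      have "(\<lambda>_. 0) \<in> L i" by (simp add: L_def)
      then show "S i \<noteq> {}" unfolding S_def by blast
      fix p q assume "p \<in> S i" "q \<in> S i"
      then obtain v w where v: "v \<in> L i" "p = chart h v" and w: "w \<in> L i" "q = chart h w"
        by (auto simp: S_def)
      define P where "P k = (if k \<in> K then \<Prod>t\<in>T h. [:v t, w t - v t:] ^ c h (e k) t else 0)" for k
      have P: "(\<lambda>k. poly (P k) s) = chart h (\<lambda>t. v t + s * (w t - v t))" for s
        by (auto simp: P_def chart_def poly_prod)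
      have "(\<lambda>t. v t + s * (w t - v t)) \<in> L i" for s using v w by (simp add: L_def)
      then have "\<forall>s. (\<lambda>k. poly (P k) s) \<in> insert 0 (S i)" unfolding P S_def by blast
      moreover have "poly (P k) 0 = p k" "poly (P k) 1 = q k" for k
        using fun_cong[OF P[of 0], of k] fun_cong[OF P[of 1], of k] v w by simp_all
      ultimately show "\<exists>P :: 'k \<Rightarrow> 'a poly. (\<forall>k. poly (P k) 0 = p k \<and> poly (P k) 1 = q k) \<and>
          (\<forall>s. (\<lambda>k. poly (P k) s) \<in> insert 0 (S i))" by blast
    qed
    show "C i \<subseteq> X" for i
      unfolding C_def using chart_in_X[OF h] closedin_image_closure
      by (intro closure_of_minimal) (auto simp: S_def)
    show "C i \<subset> C (Suc i)" if i: "i < n" for i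
    proof
      have "L i \<subseteq> L (Suc i)" by (auto simp: L_def)
      then show "C i \<subseteq> C (Suc i)" unfolding C_def S_def by (intro closure_of_mono) blast
      \<comment> \<open>The edge coordinate of direction \<open>\<tau> i\<close> vanishes on
        \<open>C i\<close> but not at this unit vector of \<open>L (Suc i)\<close>, so the inclusion
        is strict.\<close>
      have "(\<lambda>t. if t = \<tau> i then 1 else 0) \<in> L (Suc i)" using \<tau>_eq i by (auto simp: L_def)
      then have "\<not> vanishes_on (mvar (b h (\<tau> i))) (C (Suc i))" using van[OF i] by fastforce
      moreover have "vanishes_on (mvar (b h (\<tau> i))) (C i)" using van[OF i] i by (auto simp: L_def)
      ultimately show "C i \<noteq> C (Suc i)" by metis
    qed
    show "m \<le> n" if "\<And>i. i \<le> m \<Longrightarrow> closedin (zariski K) (F i)"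
      "\<And>i. i \<le> m \<Longrightarrow> irreducible_in (zariski K) (F i)" "\<And>i. i < m \<Longrightarrow> F i \<subset> F (Suc i)" "F m \<subseteq> X"
      for m and F :: "nat \<Rightarrow> ('k \<Rightarrow> 'a) set set"
      using chain_in_image_closure_bound[OF finite_J _ mtuple_forms that] n(1) by fastforce
  qed
qed

theorem smooth_variety_X:
  assumes "card J = n + 1" "\<And>h. h \<in> H \<Longrightarrow> card (T h) = n"
  shows "smooth_variety K n (X :: ('k \<Rightarrow> 'a::field_char_0) set set)"
  unfolding smooth_variety_def
proof (intro conjI ballI closedin_image_closure irreducible_X krull_dim_X[OF assms])
  fix x :: "('k \<Rightarrow> 'a) set" and z assume x: "x \<in> X" "z \<in> x"
  then obtain h where h: "h \<in> H" "z (a h) \<noteq> 0" using exists_chart by blast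
  show "vec_dim (tangent_space K X z) = n + 1" using dim_tangent_space[OF x h] assms(2)[OF h(1)] by simp
qed

end

subsection \<open>Isomorphisms\<close>

lemma (in toric_family) chart_cong:
  "(\<And>t. t \<in> T h \<Longrightarrow> x t = y t) \<Longrightarrow> chart h x = chart h y"
  by (auto simp: chart_def intro: prod.cong)

text \<open>The graph of the isomorphism, described without reference to a chart: suitable
  representatives agree wherever both carry the same monomial.\<close>

definition same_coordinates :: "'k set \<Rightarrow> ('k \<Rightarrow> 'm) \<Rightarrow> 'l set \<Rightarrow> ('l \<Rightarrow> 'm) \<Rightarrow>
    ('k \<Rightarrow> 'a) set \<Rightarrow> ('l \<Rightarrow> 'a) set \<Rightarrow> bool"
  where "same_coordinates K e L e' x y \<longleftrightarrow>
    (\<exists>z\<in>x. \<exists>w\<in>y. \<forall>k\<in>K. \<forall>l\<in>L. e k = e' l \<longrightarrow> z k = w l)"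

lemma same_coordinates_sym: "same_coordinates K e L e' x y \<Longrightarrow> same_coordinates L e' K e y x"
  unfolding same_coordinates_def by metis

text \<open>On a chart the map keeps the affine coordinates. The relation fixes the origin and edge
  coordinates of the partner up to one scalar and thereby the partner itself, so the local maps
  agree on overlaps without any transition functions.\<close>

lemma toric_families_transfer:
  fixes e :: "'k \<Rightarrow> 'i \<Rightarrow>\<^sub>0 nat" and e' :: "'l \<Rightarrow> 'i \<Rightarrow>\<^sub>0 nat"
  assumes P: "toric_family J M g H A T E c d D K e" and Q: "toric_family J M g H A T E c d D L e'"
  defines "X \<equiv> image_closure J K (\<lambda>k. xpow (e k)) :: ('k \<Rightarrow> 'a::field_char_0) set set"
    and "Y \<equiv> image_closure J L (\<lambda>l. xpow (e' l)) :: ('l \<Rightarrow> 'a) set set"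
  shows "\<exists>F. regular_map K X L Y F \<and> (\<forall>x\<in>X. same_coordinates K e L e' x (F x))"
    and "x \<in> X \<Longrightarrow> y \<in> Y \<Longrightarrow> y' \<in> Y \<Longrightarrow> same_coordinates K e L e' x y \<Longrightarrow>
      same_coordinates K e L e' x y' \<Longrightarrow> y = y'"
proof -
  interpret P: toric_family J M g H A T E c d D K e by (rule P)
  interpret Q: toric_family J M g H A T E c d D L e' by (rule Q)
  define \<Phi> where "\<Phi> h z = proj_pt (Q.chart h (\<lambda>t. z (P.b h t) / z (P.a h) :: 'a))" for h z
  have \<Phi>_rel: "same_coordinates K e L e' x (\<Phi> h z)" if x: "x \<in> X" "z \<in> x" "h \<in> H" "z (P.a h) \<noteq> 0" for x z h
  proof -
    let ?y = "\<lambda>t. z (P.b h t) / z (P.a h)"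
    have "P.chart h ?y \<in> x" "Q.chart h ?y \<in> \<Phi> h z"
      using P.point_eq_chart[of x z h] x self_in_proj_pt by (auto simp: X_def \<Phi>_def)
    moreover have "P.chart h ?y k = Q.chart h ?y l" if "k \<in> K" "l \<in> L" "e k = e' l" for k l
      using that by (simp add: P.chart_def Q.chart_def)
    ultimately show ?thesis unfolding same_coordinates_def by blast
  qed
  have \<Phi>_unique: "y = \<Phi> h z"
    if x: "x \<in> X" "z \<in> x" "h \<in> H" "z (P.a h) \<noteq> 0" and y: "y \<in> Y" "same_coordinates K e L e' x y" for x y z h
  proof -
    obtain z' w where zw: "z' \<in> x" "w \<in> y" "\<And>k l. k \<in> K \<Longrightarrow> l \<in> L \<Longrightarrow> e k = e' l \<Longrightarrow> z' k = w l"
      using y(2) by (auto simp: same_coordinates_def)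
    obtain r where r: "r \<noteq> 0" "\<And>k. z' k = r * z k"
      using P.X_point x zw(1) in_proj_ptE unfolding X_def by metis
    have wa: "w (Q.a h) = r * z (P.a h)"
      using zw(3)[OF P.a(1) Q.a(1)] P.a(2) Q.a(2) r x(3) by simp
    have wb: "w (Q.b h t) = r * z (P.b h t)" if "t \<in> T h" for t
      using zw(3)[OF P.b(1) Q.b(1)] P.b(2) Q.b(2) r x(3) that by simp
    have "y = proj_pt (Q.chart h (\<lambda>t. w (Q.b h t) / w (Q.a h)))"
      using y zw(2) x r wa by (intro Q.point_eq_chart) (auto simp: Y_def)
    also have "Q.chart h (\<lambda>t. w (Q.b h t) / w (Q.a h)) = Q.chart h (\<lambda>t. z (P.b h t) / z (P.a h))"
      using wa wb r by (intro Q.chart_cong) simp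
    finally show ?thesis by (simp add: \<Phi>_def)
  qed
  have chart_at: "\<exists>z\<in>x. \<exists>h\<in>H. z (P.a h) \<noteq> 0" if x: "x \<in> X" for x
  proof -
    have "x \<in> proj_space K" using x image_closure_subset unfolding X_def by blast
    then obtain z where "z \<in> x" using self_in_proj_pt by (auto simp: proj_space_def)
    then show ?thesis using P.exists_chart x unfolding X_def by blast
  qed
  show "y = y'" if "x \<in> X" "y \<in> Y" "y' \<in> Y" "same_coordinates K e L e' x y" "same_coordinates K e L e' x y'"
    for x y y'
  proof -
    obtain z h where "z \<in> x" "h \<in> H" "z (P.a h) \<noteq> 0" using chart_at \<open>x \<in> X\<close> by blast
    then show ?thesis using \<Phi>_unique[OF \<open>x \<in> X\<close>] that by metis
  qed
  \<comment> \<open>Choice from the chart-free relation; \<open>F_eq\<close> then computes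
    \<open>F\<close> in every chart that contains the point.\<close>
  define F where "F x = (SOME y. y \<in> Y \<and> same_coordinates K e L e' x y)" for x
  have \<Phi>_Y: "\<Phi> h z \<in> Y" if "h \<in> H" for h z unfolding \<Phi>_def Y_def using that by (rule Q.chart_in_X)
  have F_eq: "F x = \<Phi> h z" if x: "x \<in> X" "z \<in> x" "h \<in> H" "z (P.a h) \<noteq> 0" for x z h
  proof -
    have "\<exists>y. y \<in> Y \<and> same_coordinates K e L e' x y" using \<Phi>_Y \<Phi>_rel x by blast
    then have "F x \<in> Y \<and> same_coordinates K e L e' x (F x)" unfolding F_def by (rule someI_ex)
    then show ?thesis using \<Phi>_unique x by blast
  qed
  have "regular_map K X L Y F"
    unfolding regular_map_def
  proof (intro conjI ballI)
    show "F ` X \<subseteq> Y" using chart_at F_eq \<Phi>_Y by fastforce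
    fix x assume x: "x \<in> X"
    then obtain z h where zh: "z \<in> x" "h \<in> H" "z (P.a h) \<noteq> 0" using chart_at by blast
    define U where "U = proj_space K - zero_locus K {mvar (P.a h) :: ('k, 'a) mpoly}"
    have a_form: "mvar (P.a h) \<in> forms K 1" using zh P.a by (intro mvar_in_forms) simp
    have "openin (zariski K) U"
      unfolding U_def openin_zariski using a_form by (intro exI[of _ "{mvar (P.a h)}"]) blast
    moreover have "x \<in> U"
      using x zh image_closure_subset unfolding U_def X_def
      by (auto simp: zero_locus_def peval_monomial)
    \<comment> \<open>A degree at least as large as every exponent sum, so that the same power of
      \<open>v (P.a h)\<close> clears all denominators.\<close>
    moreover define R where "R = (\<Sum>l\<in>L. \<Sum>t\<in>T h. c h (e' l) t)"
    define G :: "'l \<Rightarrow> ('k, 'a) mpoly" where "G l = mvar (P.a h) ^ (R - (\<Sum>t\<in>T h. c h (e' l) t)) *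
      (\<Prod>t\<in>T h. mvar (P.b h t) ^ c h (e' l) t)" for l
    have R: "(\<Sum>t\<in>T h. c h (e' l) t) \<le> R" if "l \<in> L" for l
      unfolding R_def using that Q.finite_K by (intro member_le_sum) auto
    have "G l \<in> forms K R" if l: "l \<in> L" for l
    proof -
      have "G l \<in> forms K (1 * (R - (\<Sum>t\<in>T h. c h (e' l) t)) + (\<Sum>t\<in>T h. 1 * c h (e' l) t))"
        unfolding G_def using zh P.a P.b by (intro forms_mult forms_prod forms_power mvar_in_forms) auto
      then show ?thesis using R[OF l] by simp
    qed
    moreover have "eval_tuple L G v \<noteq> 0 \<and> F y = proj_pt (eval_tuple L G v)" if y: "y \<in> X \<inter> U" "v \<in> y" for y v
    proof -
      have yK: "y \<in> proj_space K" and "y \<notin> zero_locus K {mvar (P.a h) :: ('k, 'a) mpoly}"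
        using y by (auto simp: U_def)
      then obtain w where "w \<in> y" "w (P.a h) \<noteq> 0" by (auto simp: zero_locus_def peval_monomial)
      then have va: "v (P.a h) \<noteq> 0"
        using form_zero_on_point[OF yK a_form y(2)] by (auto simp: peval_monomial)
      let ?C = "Q.chart h (\<lambda>t. v (P.b h t) / v (P.a h))"
      have ev: "eval_tuple L G v = (\<lambda>l. v (P.a h) ^ R * ?C l)"
      proof
        fix l
        show "eval_tuple L G v l = v (P.a h) ^ R * ?C l"
        proof (cases "l \<in> L")
          case True
          let ?S = "\<Sum>t\<in>T h. c h (e' l) t"
          have "v (P.a h) ^ R = v (P.a h) ^ (R - ?S) * v (P.a h) ^ ?S"
            using R[OF True] by (simp flip: power_add)
          moreover have "(\<Prod>t\<in>T h. (v (P.b h t) / v (P.a h)) ^ c h (e' l) t) =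
              (\<Prod>t\<in>T h. v (P.b h t) ^ c h (e' l) t) / v (P.a h) ^ ?S"
            by (simp add: power_divide prod_dividef power_sum)
          ultimately show ?thesis using va True
            by (simp add: eval_tuple_def G_def peval_mult peval_power peval_prod peval_monomial Q.chart_def)
        next
          case False
          then show ?thesis by (simp add: eval_tuple_def Q.chart_def)
        qed
      qed
      have "F y = \<Phi> h v" using F_eq y zh(2) va by blast
      then show ?thesis
        using va zh(2) proj_pt_scale[of "v (P.a h) ^ R" ?C] Q.chart_neq_0[of h "\<lambda>t. v (P.b h t) / v (P.a h)"]
        unfolding ev by (auto simp: \<Phi>_def fun_eq_iff)
    qed
    ultimately show "\<exists>U l G. openin (zariski K) U \<and> x \<in> U \<and> (\<forall>k\<in>L. G k \<in> forms K l) \<and>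
        (\<forall>y\<in>X \<inter> U. \<forall>v\<in>y. eval_tuple L G v \<noteq> 0 \<and> F y = proj_pt (eval_tuple L G v))"
      by blast
  qed
  moreover have "\<forall>x\<in>X. same_coordinates K e L e' x (F x)" using chart_at F_eq \<Phi>_rel by fastforce
  ultimately show "\<exists>F. regular_map K X L Y F \<and> (\<forall>x\<in>X. same_coordinates K e L e' x (F x))" by blast
qed

text \<open>Both \<open>x\<close> and \<open>G (F x)\<close> share coordinates with
  \<open>F x\<close>, and a point has only one such partner; by symmetry both composites are
  identities.\<close>

theorem isomorphic_toric_families:
  fixes e :: "'k \<Rightarrow> 'i \<Rightarrow>\<^sub>0 nat" and e' :: "'l \<Rightarrow> 'i \<Rightarrow>\<^sub>0 nat"
  assumes P: "toric_family J M g H A T E c d D K e" and Q: "toric_family J M g H A T E c d D L e'"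
  shows "isomorphic K (image_closure J K (\<lambda>k. xpow (e k)) :: ('k \<Rightarrow> 'a::field_char_0) set set)
    L (image_closure J L (\<lambda>l. xpow (e' l)))"
proof -
  let ?X = "image_closure J K (\<lambda>k. xpow (e k)) :: ('k \<Rightarrow> 'a) set set"
  let ?Y = "image_closure J L (\<lambda>l. xpow (e' l)) :: ('l \<Rightarrow> 'a) set set"
  obtain F where F: "regular_map K ?X L ?Y F" "\<And>x. x \<in> ?X \<Longrightarrow> same_coordinates K e L e' x (F x)"
    using toric_families_transfer(1)[OF P Q] by blast
  obtain G where G: "regular_map L ?Y K ?X G" "\<And>y. y \<in> ?Y \<Longrightarrow> same_coordinates L e' K e y (G y)"
    using toric_families_transfer(1)[OF Q P] by blast
  have FY: "F x \<in> ?Y" if "x \<in> ?X" for x using F(1) that by (auto simp: regular_map_def)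
  have GX: "G y \<in> ?X" if "y \<in> ?Y" for y using G(1) that by (auto simp: regular_map_def)
  have "G (F x) = x" if x: "x \<in> ?X" for x
    by (rule toric_families_transfer(2)[OF Q P FY[OF x] GX[OF FY[OF x]] x G(2)[OF FY[OF x]]
        same_coordinates_sym[OF F(2)[OF x]]])
  moreover have "F (G y) = y" if y: "y \<in> ?Y" for y
    by (rule toric_families_transfer(2)[OF P Q GX[OF y] FY[OF GX[OF y]] y F(2)[OF GX[OF y]]
        same_coordinates_sym[OF G(2)[OF y]]])
  ultimately show ?thesis using F(1) G(1) unfolding isomorphic_def by blast
qed

subsection \<open>Laplace equations\<close>

text \<open>The factors involve different variables, so each multi-index comes from at most one
  choice of terms. The vanishing of \<open>q s\<close> beyond \<open>N s\<close> makes the formula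
  valid for indices outside the expanded range.\<close>

lemma lookup_prod_of_variable_polys:
  fixes q :: "nat \<Rightarrow> nat \<Rightarrow> 'a::comm_ring_1"
  assumes "\<And>s i. i > N s \<Longrightarrow> q s i = 0"
  shows "lookup (\<Prod>s<n. \<Sum>i\<le>N s. Poly_Mapping.single (sgl s i) (q s i)) \<alpha> =
    (if keys \<alpha> \<subseteq> {..<n} then \<Prod>s<n. q s (lookup \<alpha> s) else 0)"
proof -
  have single_prod: "(\<Prod>s\<in>S. Poly_Mapping.single (sgl s (g s)) (q s (g s))) =
      Poly_Mapping.single (\<Sum>s\<in>S. sgl s (g s)) (\<Prod>s\<in>S. q s (g s))" if "finite S" for S g
    using that by (induction S rule: finite_induct) (simp_all add: mult_single)
  let ?G = "PiE {..<n} (\<lambda>s. {..N s})"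
  have look: "lookup (\<Sum>s<n. sgl s (g s)) i = (if i < n then g i else 0)" for g i
    by (simp add: lookup_sum lookup_single when_def)
  have "lookup (\<Prod>s<n. \<Sum>i\<le>N s. Poly_Mapping.single (sgl s i) (q s i)) \<alpha> =
      (\<Sum>g\<in>?G. if (\<Sum>s<n. sgl s (g s)) = \<alpha> then \<Prod>s<n. q s (g s) else 0)"
    by (subst prod_sum_PiE) (simp_all add: single_prod lookup_sum lookup_single when_def)
  also have "\<dots> = (if keys \<alpha> \<subseteq> {..<n} then \<Prod>s<n. q s (lookup \<alpha> s) else 0)"
  proof (cases "keys \<alpha> \<subseteq> {..<n}")
    case True
    let ?g = "restrict (lookup \<alpha>) {..<n}"
    have eq: "(\<Sum>s<n. sgl s (g s)) = \<alpha> \<longleftrightarrow> g = ?g" if "g \<in> ?G" for g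
    proof
      assume "(\<Sum>s<n. sgl s (g s)) = \<alpha>"
      then have "lookup \<alpha> s = g s" if "s < n" for s using look[of g s] that by simp
      then show "g = ?g" using that by (intro extensionalityI[of _ "{..<n}"]) (auto simp: PiE_def)
    next
      assume g: "g = ?g"
      have "lookup (\<Sum>s<n. sgl s (g s)) i = lookup \<alpha> i" for i
        unfolding look using True by (auto simp: g in_keys_iff)
      then show "(\<Sum>s<n. sgl s (g s)) = \<alpha>" by (rule poly_mapping_eqI)
    qed
    have fin: "finite ?G" by (intro finite_PiE) auto
    have "(\<Sum>g\<in>?G. if (\<Sum>s<n. sgl s (g s)) = \<alpha> then \<Prod>s<n. q s (g s) else 0) =
        (\<Sum>g\<in>?G. if g = ?g then \<Prod>s<n. q s (lookup \<alpha> s) else 0)"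
      using eq by (intro sum.cong) auto
    also have "\<dots> = (if ?g \<in> ?G then \<Prod>s<n. q s (lookup \<alpha> s) else 0)" using fin by simp
    also have "\<dots> = (\<Prod>s<n. q s (lookup \<alpha> s))"
    proof (cases "?g \<in> ?G")
      case False
      then obtain s where "s < n" "lookup \<alpha> s > N s" by (auto simp: PiE_def Pi_def not_le)
      then have "(\<Prod>s<n. q s (lookup \<alpha> s)) = 0" using assms by (intro prod_zero) auto
      then show ?thesis using False by simp
    qed simp
    finally show ?thesis using True by simp
  next
    case False
    then obtain i where i: "i \<in> keys \<alpha>" "\<not> i < n" by auto
    have "(\<Sum>s<n. sgl s (g s)) \<noteq> \<alpha>" for g
    proof
      assume "(\<Sum>s<n. sgl s (g s)) = \<alpha>"
      then have "lookup \<alpha> i = 0" using look[of g i] i by simp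
      then show False using i by (simp add: in_keys_iff)
    qed
    then show ?thesis using False by simp
  qed
  finally show ?thesis .
qed

text \<open>The monomial with exponents \<open>C\<close> re-expanded around the point
  \<open>x\<close>, so that the coefficients are its Taylor coefficients there.\<close>

definition taylor_poly :: "nat \<Rightarrow> (nat \<Rightarrow> nat) \<Rightarrow> (nat \<Rightarrow> 'a::comm_ring_1) \<Rightarrow> (nat, 'a) mpoly"
  where "taylor_poly n C x = (\<Prod>s<n. \<Sum>i\<le>C s.
    Poly_Mapping.single (sgl s i) (of_nat (C s choose i) * x s ^ (C s - i)))"

lemma peval_taylor_poly: "peval v (taylor_poly n C x) = (\<Prod>s<n. (v s + x s) ^ C s)"
  by (simp add: taylor_poly_def peval_prod peval_sum peval_monomial binomial_ring mult_ac)

lemma lookup_taylor_poly: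
  "lookup (taylor_poly n C x) \<alpha> = (if keys \<alpha> \<subseteq> {..<n} then
    \<Prod>s<n. of_nat (C s choose lookup \<alpha> s) * x s ^ (C s - lookup \<alpha> s) else 0)"
  unfolding taylor_poly_def by (rule lookup_prod_of_variable_polys) (simp add: binomial_eq_0)

text \<open>Membership in power \<open>m + 1\<close> of the ideal of the variables. A difference of
  high order is a congruence modulo this ideal, hence compatible with substitution into
  polynomials.\<close>

definition high_order :: "nat \<Rightarrow> ('i, 'a::comm_ring_1) mpoly \<Rightarrow> bool"
  where "high_order m p \<longleftrightarrow> (\<forall>\<beta>\<in>keys p. m < mdeg \<beta>)"

lemma high_order_add: "high_order m p \<Longrightarrow> high_order m q \<Longrightarrow> high_order m (p + q)"
  using Poly_Mapping.keys_add[of p q] by (auto simp: high_order_def)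

lemma high_order_mult: "high_order m p \<Longrightarrow> high_order m (p * q)"
  using keys_mult[of p q] by (force simp: high_order_def mdeg_add)

lemma high_order_diff_mult:
  assumes "high_order m (p - p')" "high_order m (q - q')"
  shows "high_order m (p * q - p' * q')"
proof -
  have "p * q - p' * q' = (p - p') * q + (q - q') * p'" by (simp add: algebra_simps)
  then show ?thesis using assms by (simp add: high_order_add high_order_mult)
qed

lemma high_order_diff_power: "high_order m (p - p') \<Longrightarrow> high_order m (p ^ k - p' ^ k)"
  by (induction k) (simp add: high_order_def, simp add: high_order_diff_mult)

lemma high_order_diff_prod:
  "(\<And>s. s \<in> S \<Longrightarrow> high_order m (f s - g s)) \<Longrightarrow> high_order m ((\<Prod>s\<in>S. f s) - (\<Prod>s\<in>S. g s))"
  by (induction S rule: infinite_finite_induct) (simp_all add: high_order_diff_mult, simp_all add: high_order_def)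

lemma high_order_diff_psubst:
  assumes "\<And>j. high_order m (f j - g j)"
  shows "high_order m (psubst (Poly_Mapping.single 0) f p - psubst (Poly_Mapping.single 0) g p)"
proof -
  have sum: "(\<And>s. s \<in> S \<Longrightarrow> high_order m (h s)) \<Longrightarrow> high_order m (\<Sum>s\<in>S. h s)" for S h
    by (induction S rule: infinite_finite_induct) (simp_all add: high_order_add, simp_all add: high_order_def)
  show ?thesis
    unfolding psubst_def sum_subtractf[symmetric]
    by (intro sum high_order_diff_mult high_order_diff_prod high_order_diff_power assms)
      (simp add: high_order_def)
qed

lemma finite_multi_indices: "finite (multi_indices d m)"
proof -
  have "multi_indices d m \<subseteq> {0} \<union> (\<Union>k\<le>m. {\<alpha>. keys \<alpha> \<subseteq> {..<d} \<and> mdeg \<alpha> = k})"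
    by (auto simp: multi_indices_def)
  moreover have "finite {\<alpha>. keys \<alpha> \<subseteq> {..<d} \<and> mdeg \<alpha> = k}" for k
  proof (cases "d = 0")
    case True
    then have "{\<alpha>. keys \<alpha> \<subseteq> {..<d} \<and> mdeg \<alpha> = k} \<subseteq> {0}" by auto
    then show ?thesis by (rule finite_subset) simp
  next
    case False
    then show ?thesis by (intro card_monomials_of_degree_le(1)) auto
  qed
  ultimately show ?thesis by (meson finite.emptyI finite.insertI finite_UN finite_Un finite_atMost finite_subset)
qed

lemma lookup_truncated:
  "lookup (truncated d m \<phi>) \<beta> = (if \<beta> \<in> multi_indices d m then \<phi> \<beta> else 0)"
  by (simp add: truncated_def lookup_sum lookup_single when_def finite_multi_indices)

text \<open>Truncating polynomials only affects terms of high order.\<close>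

lemma series_solution_polynomialI:
  fixes P :: "'i \<Rightarrow> (nat, 'a::field_char_0) mpoly"
  assumes "\<And>j. P j \<in> carrier (poly_ring {..<d})" "\<And>v. peval (\<lambda>j. peval v (P j)) F = 0"
  shows "series_solution d (\<lambda>j \<alpha>. lookup (P j) \<alpha>) F"
  unfolding series_solution_def
proof (intro allI ballI)
  fix m \<beta> assume \<beta>: "\<beta> \<in> multi_indices d m"
  let ?t = "\<lambda>j. truncated d m (\<lambda>\<alpha>. lookup (P j) \<alpha>)"
  let ?s = "psubst (Poly_Mapping.single 0) :: ('i \<Rightarrow> (nat, 'a) mpoly) \<Rightarrow> _"
  have "?s P F = 0"
    by (rule mpoly_eq_0_if_vanishes[of _ UNIV]) (simp_all add: poly_ring_def peval_psubst assms)
  moreover have "high_order m (?t j - P j)" for j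
    unfolding high_order_def
  proof (rule ballI, rule ccontr)
    fix \<gamma> assume \<gamma>: "\<gamma> \<in> keys (?t j - P j)" "\<not> m < mdeg \<gamma>"
    then have "lookup (?t j) \<gamma> \<noteq> lookup (P j) \<gamma>" by (simp add: in_keys_iff lookup_minus)
    then have "\<not> keys \<gamma> \<subseteq> {..<d}" "lookup (P j) \<gamma> \<noteq> 0"
      using \<gamma> by (auto simp: lookup_truncated multi_indices_def split: if_splits)
    then show False using assms(1)[of j] by (auto simp: poly_ring_def in_keys_iff)
  qed
  then have "high_order m (?s ?t F - ?s P F)" by (rule high_order_diff_psubst)
  ultimately have "high_order m (?s ?t F)" by simp
  then have "\<beta> \<notin> keys (?s ?t F)" using \<beta> by (auto simp: high_order_def multi_indices_def)
  then show "lookup (?s ?t F) \<beta> = 0" by (simp add: in_keys_iff)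
qed

section \<open>Multi-indices of small degree\<close>

lemma mdeg_le_1_cases: "mdeg \<alpha> \<le> 1 \<Longrightarrow> \<alpha> = 0 \<or> (\<exists>s. \<alpha> = sgl s 1)"
proof -
  assume "mdeg \<alpha> \<le> 1"
  then consider "mdeg \<alpha> = 0" | "mdeg \<alpha> = Suc 0" by linarith
  then show ?thesis
    by cases (use mdeg_eq_0_iff mdeg_Suc_decompose in \<open>metis add.right_neutral\<close>)+
qed

text \<open>
  A multi-index of degree at most 2 is the sum of two elements \<open>s\<close> and \<open>t - 1\<close> of \<open>{0, \<dots>, d}\<close>, the element
  \<open>d\<close> standing for zero; such pairs correspond to the 2-subsets \<open>{s, t}\<close> of \<open>{0, \<dots>, d + 1}\<close>.
\<close>

lemma card_multi_indices_2: "card (multi_indices d 2) \<le> (d + 2) choose 2"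
proof -
  define u where "u s = (if s < d then sgl s 1 else 0)" for s
  define F where "F S = u (Min S) + u (Max S - 1)" for S :: "nat set"
  have F: "u s + u t \<in> F ` {S. S \<subseteq> {..d + 1} \<and> card S = 2}" if "s \<le> t" "t \<le> d" for s t
    using that by (intro image_eqI[of _ _ "{s, t + 1}"]) (auto simp: F_def)
  have F': "u s + u t \<in> F ` {S. S \<subseteq> {..d + 1} \<and> card S = 2}" if "s \<le> d" "t \<le> d" for s t
  proof (cases "s \<le> t")
    case False
    then show ?thesis using that by (subst add.commute) (intro F, simp_all)
  qed (rule F[OF _ that(2)])
  have "multi_indices d 2 \<subseteq> F ` {S. S \<subseteq> {..d + 1} \<and> card S = 2}"
  proof
    fix \<alpha> assume \<alpha>: "\<alpha> \<in> multi_indices d 2"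
    have u1: "\<exists>s\<le>d. \<beta> = u s" if \<beta>: "mdeg \<beta> \<le> 1" "keys \<beta> \<subseteq> {..<d}" for \<beta>
    proof (cases "\<beta> = 0")
      case True
      then show ?thesis by (intro exI[of _ d]) (simp add: u_def)
    next
      case False
      then obtain s where "\<beta> = sgl s 1" using mdeg_le_1_cases \<beta>(1) by blast
      then show ?thesis using \<beta>(2) by (intro exI[of _ s]) (auto simp: u_def)
    qed
    have "\<exists>\<beta> \<gamma>. \<alpha> = \<beta> + \<gamma> \<and> mdeg \<beta> \<le> 1 \<and> mdeg \<gamma> \<le> 1"
    proof (cases "mdeg \<alpha> = 0")
      case True
      then show ?thesis by (intro exI[of _ 0]) (simp add: mdeg_eq_0_iff)
    next
      case False
      then obtain k where "mdeg \<alpha> = Suc k" using not0_implies_Suc by blast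
      moreover from this obtain i m' where "\<alpha> = sgl i 1 + m'" "mdeg m' = k" by (rule mdeg_Suc_decompose)
      ultimately show ?thesis
        using \<alpha> by (intro exI[of _ "sgl i 1"] exI[of _ m']) (simp add: multi_indices_def)
    qed
    then obtain \<beta> \<gamma> where \<beta>\<gamma>: "\<alpha> = \<beta> + \<gamma>" "mdeg \<beta> \<le> 1" "mdeg \<gamma> \<le> 1" by blast
    then have "keys \<beta> \<subseteq> {..<d}" "keys \<gamma> \<subseteq> {..<d}"
      using \<alpha> by (auto simp: multi_indices_def keys_add_exponents)
    then obtain s t where "s \<le> d" "t \<le> d" "\<beta> = u s" "\<gamma> = u t" using u1 \<beta>\<gamma> by blast
    then show "\<alpha> \<in> F ` {S. S \<subseteq> {..d + 1} \<and> card S = 2}" using F' \<beta>\<gamma>(1) by simp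
  qed
  then have "card (multi_indices d 2) \<le> card (F ` {S. S \<subseteq> {..d + 1} \<and> card S = 2})"
    by (intro card_mono finite_imageI) (auto intro: finite_subset[of _ "Pow {..d + 1}"])
  also have "\<dots> \<le> card {S. S \<subseteq> {..d + 1} \<and> card S = 2}"
    by (intro card_image_le) (auto intro: finite_subset[of _ "Pow {..d + 1}"])
  also have "\<dots> = (d + 2) choose 2" by (subst n_subsets) simp_all
  finally show ?thesis .
qed

context toric_family begin

text \<open>
  By the relation between the exponents, the second osculating spaces satisfy
  \<open>x\<^sub>1\<^sup>2 \<partial>\<^sub>1\<^sub>1 + x\<^sub>2\<^sup>2 \<partial>\<^sub>2\<^sub>2 = x\<^sub>1 x\<^sub>2 \<partial>\<^sub>1\<^sub>2\<close> in the coordinates \<open>t\<^sub>1, t\<^sub>2\<close> of the chart \<open>h\<close>.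
\<close>

theorem laplace_equation_X:
  assumes n: "card J = n + 1" "\<And>h. h \<in> H \<Longrightarrow> card (T h) = n"
    and h: "h \<in> H" and t: "t\<^sub>1 \<in> T h" "t\<^sub>2 \<in> T h" "t\<^sub>1 \<noteq> t\<^sub>2"
    and rel: "\<And>k. k \<in> K \<Longrightarrow> c h (e k) t\<^sub>1 * (c h (e k) t\<^sub>1 - 1) + c h (e k) t\<^sub>2 * (c h (e k) t\<^sub>2 - 1) =
      c h (e k) t\<^sub>1 * c h (e k) t\<^sub>2"
  shows "laplace_equation_order_2 K (X :: ('k \<Rightarrow> 'a::field_char_0) set set)"
proof -
  \<comment> \<open>On \<open>U\<close> the chart \<open>h\<close> applies and the coordinate at
    \<open>t\<^sub>1\<close> is nonzero, so the relation can be solved for the second derivative in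
    that direction.\<close>
  let ?f = "mvar (a h) * mvar (b h t\<^sub>1) :: ('k, 'a) mpoly"
  define U where "U = proj_space K - zero_locus K {?f}"
  have f: "?f \<in> forms K (1 + 1)" using a b h t by (intro forms_mult mvar_in_forms) auto
  have "openin (zariski K) U"
    unfolding U_def openin_zariski using f by (intro exI[of _ "{?f}"]) blast
  moreover have "X \<inter> U \<noteq> {}"
  proof -
    let ?p = "chart h (\<lambda>_. 1 :: 'a)"
    have "proj_pt ?p \<in> X" by (rule chart_in_X[OF h])
    moreover from this have "proj_pt ?p \<in> proj_space K" using image_closure_subset by blast
    moreover have "proj_pt ?p \<notin> zero_locus K {?f}"
      using self_in_proj_pt[of ?p] h t by (auto simp: zero_locus_def peval_mult peval_monomial intro!: bexI[of _ ?p])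
    ultimately show ?thesis by (auto simp: U_def)
  qed
  moreover have "\<exists>\<Phi>. local_parametrization K X n x \<Phi> \<and>
      vec_dim (osculating_space n \<Phi> 2) - 1 < ((n + 2) choose 2) - 1" if x: "x \<in> X \<inter> U" for x
  proof -
    obtain z where z: "z \<in> x" "z (a h) \<noteq> 0" "z (b h t\<^sub>1) \<noteq> 0"
      using x by (auto simp: U_def zero_locus_def peval_mult peval_monomial)
    define y where "y t = z (b h t) / z (a h)" for t
    have x_eq: "x = proj_pt (chart h y)" unfolding y_def using x z h by (intro point_eq_chart) auto
    obtain \<tau> where \<tau>: "bij_betw \<tau> {..<n} (T h)"
      using ex_bij_betw_nat_finite[OF finite_T[OF h]] n(2)[OF h] by (auto simp: lessThan_atLeast0)
    have \<tau>_in: "\<tau> s \<in> T h" if "s < n" for s using bij_betwE[OF \<tau>] that by simp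
    have \<tau>_eq: "\<tau> i = \<tau> j \<longleftrightarrow> i = j" if "i < n" "j < n" for i j
      using bij_betw_imp_inj_on[OF \<tau>] that by (auto simp: inj_on_def)
    define C where "C k s = c h (e k) (\<tau> s)" for k s
    define p where "p s = y (\<tau> s)" for s
    define P where "P k = (if k \<in> K then taylor_poly n (C k) p else 0)" for k
    define \<Phi> where "\<Phi> k \<alpha> = lookup (P k) \<alpha>" for k \<alpha>
    \<comment> \<open>Factorial times binomial is the falling factorial, so
      \<open>w \<alpha>\<close> is the derivative of the chart at \<open>p\<close>. Where the
      exponent truncates, the binomial coefficient is 0.\<close>
    define w where "w \<alpha> k = (if k \<in> K then \<Prod>s<n. of_nat (fact (lookup \<alpha> s) * (C k s choose lookup \<alpha> s)) *
        p s ^ (C k s - lookup \<alpha> s) else 0)" for \<alpha> k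
    have partial: "partial_at_0 \<Phi> \<alpha> = w \<alpha>" if \<alpha>: "keys \<alpha> \<subseteq> {..<n}" for \<alpha>
    proof
      fix k
      have "(\<Prod>i\<in>keys \<alpha>. of_nat (fact (lookup \<alpha> i)) :: 'a) = (\<Prod>s<n. of_nat (fact (lookup \<alpha> s)))"
        using \<alpha> by (intro prod.mono_neutral_left) (auto simp: in_keys_iff)
      then show "partial_at_0 \<Phi> \<alpha> k = w \<alpha> k"
        using \<alpha> by (simp add: partial_at_0_def \<Phi>_def P_def w_def lookup_taylor_poly prod.distrib mult_ac)
    qed
    have chart_prod: "chart h (\<lambda>t. y t + v (inv_into {..<n} \<tau> t)) k = (\<Prod>s<n. (v s + p s) ^ C k s)"
      if "k \<in> K" for v k
    proof -
      have "(\<Prod>s<n. (v s + p s) ^ C k s) =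
          (\<Prod>s<n. (\<lambda>t. (y t + v (inv_into {..<n} \<tau> t)) ^ c h (e k) t) (\<tau> s))"
        using bij_betw_inv_into_left[OF \<tau>] by (intro prod.cong) (simp_all add: p_def C_def add.commute)
      also have "\<dots> = (\<Prod>t\<in>T h. (y t + v (inv_into {..<n} \<tau> t)) ^ c h (e k) t)"
        by (rule prod.reindex_bij_betw[OF \<tau>])
      finally show ?thesis using that by (simp add: chart_def)
    qed
    have w0: "w 0 = chart h y"
    proof
      fix k show "w 0 k = chart h y k"
        using chart_prod[of k "\<lambda>_. 0"] by (cases "k \<in> K") (simp_all add: w_def chart_def)
    qed
    have C_a: "C (a h) s = 0" if "s < n" for s
      using a[OF h] c_A[OF h \<tau>_in[OF that]] by (simp add: C_def)
    have C_b: "C (b h (\<tau> i)) s = (if i = s then 1 else 0)" if "i < n" "s < n" for i s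
      using b[OF h \<tau>_in] c_E[OF h \<tau>_in \<tau>_in] \<tau>_eq that by (simp add: C_def)
    have "series_solution n \<Phi> F" if F: "F \<in> vanishing_ideal K X" for F
      unfolding \<Phi>_def
    proof (rule series_solution_polynomialI)
      show "P k \<in> carrier (poly_ring {..<n})" for k
      proof -
        have "keys m \<subseteq> {..<n}" if "lookup (P k) m \<noteq> 0" for m
          using that by (simp add: P_def lookup_taylor_poly split: if_splits)
        then show ?thesis by (simp add: poly_ring_def in_keys_iff)
      qed
      fix v
      have "peval (\<lambda>k. 1 * chart h (\<lambda>t. y t + v (inv_into {..<n} \<tau> t)) k) F = 0"
        using F by (intro vanishing_ideal_chart[OF h]) simp_all
      also have "(\<lambda>k. 1 * chart h (\<lambda>t. y t + v (inv_into {..<n} \<tau> t)) k) = (\<lambda>k. peval v (P k))"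
      proof
        fix k show "1 * chart h (\<lambda>t. y t + v (inv_into {..<n} \<tau> t)) k = peval v (P k)"
          using chart_prod[of k v] by (cases "k \<in> K") (simp_all add: P_def peval_taylor_poly chart_def)
      qed
      finally show "peval (\<lambda>k. peval v (P k)) F = 0" .
    qed
    moreover have "(\<lambda>k. \<Phi> k 0) \<in> x"
    proof -
      have "(\<lambda>k. \<Phi> k 0) = w 0"
        by (auto simp: \<Phi>_def P_def w_def lookup_taylor_poly)
      then show ?thesis unfolding x_eq w0 by (simp add: self_in_proj_pt)
    qed
    moreover have "vec_dim (osculating_space n \<Phi> 1) = n + 1"
    proof -
      let ?V = "osculating_space n \<Phi> 1"
      let ?S = "insert (a h) ((\<lambda>s. b h (\<tau> s)) ` {..<n})"
      have V: "?V = vec_span (insert (w 0) ((\<lambda>s. w (sgl s 1)) ` {..<n}))"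
      proof -
        have "multi_indices n 1 = insert 0 ((\<lambda>s. sgl s 1) ` {..<n})"
          using mdeg_le_1_cases by (fastforce simp: multi_indices_def)
        then show ?thesis
          unfolding osculating_space_def by (simp add: partial image_image cong: image_cong_simp)
      qed
      have w1_a: "w (sgl s 1) (a h) = 0" if "s < n" for s
        using a(1)[OF h] C_a that by (auto simp: w_def lookup_single when_def intro!: prod_zero)
      have w1_b: "w (sgl s 1) (b h (\<tau> i)) = (if s = i then 1 else 0)" if "s < n" "i < n" for s i
      proof (cases "s = i")
        case True
        then show ?thesis using b(1)[OF h \<tau>_in] that C_b
          by (auto simp: w_def lookup_single when_def intro!: prod.neutral)
      next
        case False
        then show ?thesis using b(1)[OF h \<tau>_in] that C_b
          by (auto simp: w_def lookup_single when_def intro!: prod_zero bexI[of _ s])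
      qed
      have w0_b: "w 0 (b h (\<tau> i)) = p i" if "i < n" for i
        using \<tau>_in[OF that] h by (simp add: w0 p_def)
      have w0_a: "w 0 (a h) = 1" using h by (simp add: w0)
      have sum_eval: "(\<Sum>s<n. vec_scale (u s) (w (sgl s 1))) j = (\<Sum>s<n. u s * w (sgl s 1) j)" for u j
        by (induction n) auto
      have sum_a: "(\<Sum>s<n. vec_scale (u s) (w (sgl s 1))) (a h) = 0" for u
        unfolding sum_eval using w1_a by simp
      have sum_b: "(\<Sum>s<n. vec_scale (u s) (w (sgl s 1))) (b h (\<tau> i)) = u i" if "i < n" for u i
      proof -
        have "(\<Sum>s<n. u s * w (sgl s 1) (b h (\<tau> i))) = (\<Sum>s<n. if s = i then u s else 0)"
          using w1_b that by (intro sum.cong) auto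
        then show ?thesis unfolding sum_eval using that by simp
      qed
      have sub: "vec.subspace ?V" unfolding V by (rule vec.subspace_span)
      have "vec_dim ?V = card ?S"
      proof (rule vec_dim_eq_card_coordinates[OF sub])
        show "finite ?S" by simp
        fix s assume "s \<in> ?S"
        then consider "s = a h" | i where "i < n" "s = b h (\<tau> i)" by auto
        then show "\<exists>v\<in>?V. \<forall>s'\<in>?S. v s' = (if s = s' then 1 else 0)"
        proof cases
          case 1
          \<comment> \<open>The first derivatives, weighted by \<open>p\<close>, cancel the edge
            entries of \<open>w 0\<close> and leave its entry 1 at the origin.\<close>
          define v where "v = w 0 - (\<Sum>s<n. vec_scale (p s) (w (sgl s 1)))"
          have "v \<in> ?V"
            unfolding V v_def by (intro vec.span_diff vec.span_sum vec.span_scale vec.span_base) auto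
          moreover have "v (a h) = 1" by (simp only: v_def minus_apply w0_a sum_a diff_zero)
          moreover have "v (b h (\<tau> i)) = 0" if "i < n" for i
            by (simp only: v_def minus_apply w0_b[OF that] sum_b[OF that] diff_self)
          moreover have "b h (\<tau> i) \<noteq> a h" if "i < n" for i using b_neq_a[OF h] \<tau>_in that by blast
          ultimately show ?thesis using 1 by (intro bexI[of _ v]) auto
        next
          case 2
          have "w (sgl i 1) \<in> ?V" unfolding V using 2 by (intro vec.span_base) auto
          moreover have "b h (\<tau> i) = b h (\<tau> j) \<longleftrightarrow> i = j" if "j < n" for j
            using inj_on_eq_iff[OF inj_on_b[OF h]] \<tau>_in \<tau>_eq 2 that by simp
          moreover have "b h (\<tau> i) \<noteq> a h" using b_neq_a[OF h] \<tau>_in 2 by blast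
          ultimately show ?thesis
            using 2 w1_a[of i] w1_b[of i] by (intro bexI[of _ "w (sgl i 1)"]) auto
        qed
      next
        fix v assume v: "v \<in> ?V" and v0: "\<And>s. s \<in> ?S \<Longrightarrow> v s = 0"
        \<comment> \<open>\<open>R\<close> reconstructs a vector from its origin and edge entries.
          It is linear and fixes the generators, so it is the identity on the span, and a vector
          with all these entries 0 is 0.\<close>
        define R where "R v j = v (a h) * w 0 j +
          (\<Sum>s<n. (v (b h (\<tau> s)) - v (a h) * p s) * w (sgl s 1) j)" for v j
        have R_add: "R (u + v) j = R u j + R v j" for u v j
          by (simp add: R_def algebra_simps sum.distrib sum_subtractf)
        have R_scale: "R (vec_scale r v) j = r * R v j" for r v j
          by (simp add: R_def algebra_simps sum_distrib_left sum_subtractf)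
        have R_0: "R 0 j = 0" for j by (simp add: R_def)
        have "vec.subspace {v. \<forall>j. R v j = v j}"
          unfolding vec.subspace_def by (simp add: R_add R_scale R_0)
        moreover have "insert (w 0) ((\<lambda>s. w (sgl s 1)) ` {..<n}) \<subseteq> {v. \<forall>j. R v j = v j}"
        proof -
          have "R (w (sgl i 1)) j = w (sgl i 1) j" if "i < n" for i j
          proof -
            have "(\<Sum>s<n. (w (sgl i 1) (b h (\<tau> s)) - w (sgl i 1) (a h) * p s) * w (sgl s 1) j) =
                (\<Sum>s<n. if i = s then w (sgl s 1) j else 0)"
              using w1_a w1_b that by (intro sum.cong) auto
            then show ?thesis unfolding R_def using w1_a that by simp
          qed
          moreover have "R (w 0) j = w 0 j" for j by (simp add: R_def w0_a w0_b)
          ultimately show ?thesis by blast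
        qed
        ultimately have "?V \<subseteq> {v. \<forall>j. R v j = v j}" unfolding V by (intro vec.span_minimal)
        then have "R v j = v j" for j using v by blast
        moreover have "R v j = 0" for j using v0 by (simp add: R_def)
        ultimately show "v = 0" by (simp add: fun_eq_iff)
      qed
      also have "card ?S = n + 1"
      proof -
        have "card ((\<lambda>s. b h (\<tau> s)) ` {..<n}) = n"
          using inj_on_eq_iff[OF inj_on_b[OF h]] \<tau>_in \<tau>_eq by (subst card_image) (auto simp: inj_on_def)
        moreover have "a h \<notin> (\<lambda>s. b h (\<tau> s)) ` {..<n}" using b_neq_a[OF h, symmetric] \<tau>_in by auto
        ultimately show ?thesis by simp
      qed
      finally show ?thesis .
    qed
    moreover have "\<forall>k \<alpha>. \<Phi> k \<alpha> \<noteq> 0 \<longrightarrow> k \<in> K \<and> keys \<alpha> \<subseteq> {..<n}"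
      by (auto simp: \<Phi>_def P_def lookup_taylor_poly split: if_splits)
    ultimately have "local_parametrization K X n x \<Phi>" unfolding local_parametrization_def by blast
    moreover have "vec_dim (osculating_space n \<Phi> 2) < (n + 2) choose 2"
    proof -
      obtain s1 s2 where s: "s1 < n" "s2 < n" "\<tau> s1 = t\<^sub>1" "\<tau> s2 = t\<^sub>2"
        using bij_betw_imp_surj_on[OF \<tau>] t by (metis imageE lessThan_iff)
      have ne: "s1 \<noteq> s2" using s t by auto
      have p1: "p s1 \<noteq> 0" using z s by (simp add: p_def y_def)
      let ?\<alpha> = "sgl s1 2" and ?\<beta> = "sgl s2 2" and ?\<gamma> = "sgl s1 1 + sgl s2 1"
      have D1: "of_nat (fact 1 * (m choose 1)) * q ^ (m - 1) * q = of_nat m * q ^ m" for m and q :: 'a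
        by (cases m) (simp_all add: mult_ac)
      \<comment> \<open>Multiplying by \<open>q\<^sup>2\<close> restores the full power, so the
        truncated exponent disappears; for \<open>m < 2\<close> both sides are 0.\<close>
      have D2: "of_nat (fact 2 * (m choose 2)) * q ^ (m - 2) * q\<^sup>2 = of_nat (m * (m - 1)) * q ^ m" for m and q :: 'a
      proof (cases "m < 2")
        case False
        have "fact 2 * (m choose 2) = m * (m - 1)"
          unfolding choose_two by (cases m) (simp_all add: fact_numeral)
        moreover have "q ^ (m - 2) * q\<^sup>2 = q ^ m"
          using False by (simp only: power_add[symmetric] le_add_diff_inverse2 not_less)
        ultimately show ?thesis by (metis mult.assoc)
      qed (auto simp: less_2_cases_iff)
      have split: "(\<Prod>s<n. f s) = f s1 * f s2 * (\<Prod>s\<in>{..<n} - {s1, s2}. f s)" for f :: "nat \<Rightarrow> 'a"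
      proof -
        have "(\<Prod>s<n. f s) = (\<Prod>s\<in>{s1, s2}. f s) * (\<Prod>s\<in>{..<n} - {s1, s2}. f s)"
          using s by (subst mult.commute, intro prod.subset_diff) auto
        then show ?thesis using ne by simp
      qed
      \<comment> \<open>After multiplication by the powers of \<open>p\<close>, all three
        derivatives are natural multiples of one monomial \<open>?m\<close>, and the multiples are
        the three terms of \<open>rel\<close>.\<close>
      have rel': "(p s1)\<^sup>2 * w ?\<alpha> k + (p s2)\<^sup>2 * w ?\<beta> k = p s1 * p s2 * w ?\<gamma> k" for k
      proof (cases "k \<in> K")
        case True
        let ?e = "C k s1" and ?f = "C k s2"
        let ?R = "\<Prod>s\<in>{..<n} - {s1, s2}. p s ^ C k s"
        let ?m = "p s1 ^ ?e * p s2 ^ ?f * ?R"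
        have rest: "(\<Prod>s\<in>{..<n} - {s1, s2}. of_nat (fact (lookup \<delta> s) * (C k s choose lookup \<delta> s)) *
            p s ^ (C k s - lookup \<delta> s)) = ?R" if "keys \<delta> \<subseteq> {s1, s2}" for \<delta>
        proof (intro prod.cong refl)
          fix s assume "s \<in> {..<n} - {s1, s2}"
          then have "s \<notin> keys \<delta>" using that by blast
          then have "lookup \<delta> s = 0" by (simp add: in_keys_iff)
          then show "of_nat (fact (lookup \<delta> s) * (C k s choose lookup \<delta> s)) *
            p s ^ (C k s - lookup \<delta> s) = p s ^ C k s" by simp
        qed
        have "(p s1)\<^sup>2 * w ?\<alpha> k = of_nat (fact 2 * (?e choose 2)) * p s1 ^ (?e - 2) * (p s1)\<^sup>2 * p s2 ^ ?f * ?R"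
          using True ne by (simp add: w_def split rest lookup_single when_def mult_ac)
        then have A: "(p s1)\<^sup>2 * w ?\<alpha> k = of_nat (?e * (?e - 1)) * ?m" unfolding D2 by (simp add: mult_ac)
        have "(p s2)\<^sup>2 * w ?\<beta> k = of_nat (fact 2 * (?f choose 2)) * p s2 ^ (?f - 2) * (p s2)\<^sup>2 * p s1 ^ ?e * ?R"
          using True ne by (simp add: w_def split rest lookup_single when_def mult_ac)
        then have B: "(p s2)\<^sup>2 * w ?\<beta> k = of_nat (?f * (?f - 1)) * ?m" unfolding D2 by (simp add: mult_ac)
        have "p s1 * p s2 * w ?\<gamma> k = (of_nat (fact 1 * (?e choose 1)) * p s1 ^ (?e - 1) * p s1) *
            (of_nat (fact 1 * (?f choose 1)) * p s2 ^ (?f - 1) * p s2) * ?R"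
          using True ne rest[of ?\<gamma>] by (simp add: w_def split lookup_add lookup_single when_def keys_add_exponents mult_ac)
        then have G: "p s1 * p s2 * w ?\<gamma> k = of_nat (?e * ?f) * ?m" unfolding D1 by (simp add: mult_ac)
        have "?e * (?e - 1) + ?f * (?f - 1) = ?e * ?f" using rel[OF True] s by (simp add: C_def)
        then show ?thesis unfolding A B G by (simp only: of_nat_add[symmetric] distrib_right[symmetric])
      qed (simp add: w_def)
      \<comment> \<open>Dropping \<open>?\<alpha>\<close> keeps the span, by \<open>rel'\<close> and
        \<open>p s1 \<noteq> 0\<close>; this one generator less is the whole drop in dimension that
        is claimed.\<close>
      let ?I = "multi_indices n 2 - {?\<alpha>}"
      have \<beta>\<gamma>: "?\<beta> \<in> ?I" "?\<gamma> \<in> ?I"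
      proof -
        have "?\<beta> \<noteq> ?\<alpha>" "?\<gamma> \<noteq> ?\<alpha>"
          using ne by (auto simp: poly_mapping_eq_iff fun_eq_iff lookup_add lookup_single when_def)
        then show "?\<beta> \<in> ?I" "?\<gamma> \<in> ?I"
          using s by (auto simp: multi_indices_def mdeg_add keys_add_exponents)
      qed
      have "w ?\<alpha> = vec_scale (p s2 / p s1) (w ?\<gamma>) - vec_scale ((p s2)\<^sup>2 / (p s1)\<^sup>2) (w ?\<beta>)"
      proof
        fix k
        show "w ?\<alpha> k = (vec_scale (p s2 / p s1) (w ?\<gamma>) - vec_scale ((p s2)\<^sup>2 / (p s1)\<^sup>2) (w ?\<beta>)) k"
          using rel'[of k] p1 by (simp add: field_simps power2_eq_square)
      qed
      also have "\<dots> \<in> vec_span (w ` ?I)"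
        using \<beta>\<gamma> by (intro vec.span_diff vec.span_scale vec.span_base imageI)
      finally have \<alpha>: "w ?\<alpha> \<in> vec_span (w ` ?I)" .
      have "osculating_space n \<Phi> 2 = vec_span (w ` multi_indices n 2)"
        unfolding osculating_space_def
        by (intro arg_cong[where f = vec_span] image_cong refl partial) (simp add: multi_indices_def)
      also have "\<dots> \<subseteq> vec_span (w ` ?I)"
        using \<alpha> by (intro vec.span_minimal vec.subspace_span) (auto intro: vec.span_base)
      finally have "vec_dim (osculating_space n \<Phi> 2) \<le> card (w ` ?I)"
        using finite_multi_indices by (intro vec.dim_le_card) auto
      also have "\<dots> \<le> card ?I" using finite_multi_indices by (intro card_image_le) auto
      also have "\<dots> < card (multi_indices n 2)"
        using s finite_multi_indices by (intro card_Diff1_less) (auto simp: multi_indices_def)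
      also have "\<dots> \<le> (n + 2) choose 2" by (rule card_multi_indices_2)
      finally show ?thesis .
    qed
    moreover have "(n + 2) choose 2 \<ge> 1" by (simp add: Suc_leI)
    \<comment> \<open>The conclusion subtracts 1 in the naturals, so a span of dimension 0 satisfies
      the strict inequality only if the binomial coefficient exceeds 1.\<close>
    moreover have "(n + 2) choose 2 \<noteq> 1"
    proof -
      have "n \<noteq> 0" using t(1) finite_T[OF h] n(2)[OF h] by (metis card_eq_0_iff empty_iff)
      then show ?thesis by (cases n) (simp_all add: numeral_2_eq_2)
    qed
    ultimately show ?thesis by (intro exI[of _ \<Phi>]) linarith
  qed
  ultimately show ?thesis
    unfolding laplace_equation_order_2_def using krull_dim_X[OF n] by blast
qed

end

section \<open>The atlas of the Togliatti cubics\<close>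

text \<open>The cubic monomials vanishing on the centre: the lower bound 1 is vanishing on the
  linear space, the upper bounds 2 are vanishing at the two points.\<close>

definition cubics :: "nat \<Rightarrow> (nat \<Rightarrow>\<^sub>0 nat) set"
  where "cubics n = {m. keys m \<subseteq> {..n} \<and> mdeg m = 3 \<and> lookup m (n - 1) \<le> 2 \<and> lookup m n \<le> 2 \<and>
    1 \<le> lookup m (n - 1) + lookup m n}"

definition togliatti_cubics :: "nat \<Rightarrow> (nat \<Rightarrow>\<^sub>0 nat) set"
  where "togliatti_cubics n = {m \<in> cubics n. \<not> (lookup m (n - 1) = 1 \<and> lookup m n = 1)}"

lemma sorted_cubic:
  fixes m :: "nat \<Rightarrow>\<^sub>0 nat"
  assumes "mdeg m = 3"
  obtains i j k where "i \<le> j" "j \<le> k" "m = sgl i 1 + sgl j 1 + sgl k 1"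
proof -
  obtain x m1 where 1: "m = sgl x 1 + m1" "mdeg m1 = 2"
    using mdeg_Suc_decompose[of m 2] assms by (auto simp: eval_nat_numeral)
  obtain y m2 where 2: "m1 = sgl y 1 + m2" "mdeg m2 = 1"
    using mdeg_Suc_decompose[of m1 1] 1 by (auto simp: eval_nat_numeral)
  obtain z m3 where 3: "m2 = sgl z 1 + m3" "mdeg m3 = 0"
    using mdeg_Suc_decompose[of m2 0] 2 by auto
  have m: "m = sgl x 1 + sgl y 1 + sgl z 1" using 1 2 3 by (simp add: mdeg_eq_0_iff add.assoc)
  show thesis
  proof (cases "x \<le> y")
    case True
    then consider "y \<le> z" | "x \<le> z" "z \<le> y" | "z \<le> x" by linarith
    then show thesis
      by cases (use True m that[of x y z] that[of x z y] that[of z x y] in \<open>simp_all add: ac_simps\<close>)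
  next
    case False
    then consider "x \<le> z" | "y \<le> z" "z \<le> x" | "z \<le> y" by linarith
    then show thesis
      by cases (use False m that[of y x z] that[of y z x] that[of z y x] in \<open>simp_all add: ac_simps\<close>)
  qed
qed

text \<open>In the case names \<open>y\<close> is a variable among x_0, ..., x_(n-2), while
  \<open>p\<close> and \<open>q\<close> are the last two. The vertices of the polytope are
  \<open>yyp\<close> with equal indices, \<open>ypp\<close> and \<open>qpp\<close>.\<close>

lemma cubics_cases:
  assumes n: "n \<ge> 3" and m: "m \<in> cubics n"
  obtains (yyp) j k p where "j \<le> n - 2" "k \<le> n - 2" "p \<in> {n - 1, n}" "m = sgl j 1 + sgl k 1 + sgl p 1"
    | (ypp) j p where "j \<le> n - 2" "p \<in> {n - 1, n}" "m = sgl j 1 + sgl p 2"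
    | (ypq) j where "j \<le> n - 2" "m = sgl j 1 + sgl (n - 1) 1 + sgl n 1"
    | (qpp) p q where "{p, q} = {n - 1, n}" "m = sgl q 1 + sgl p 2"
proof -
  have "mdeg m = 3" using m by (simp add: cubics_def)
  then obtain i j k where s: "i \<le> j" "j \<le> k" and m_eq: "m = sgl i 1 + sgl j 1 + sgl k 1"
    by (rule sorted_cubic)
  have k: "k \<le> n" using m by (auto simp: cubics_def m_eq keys_add_exponents)
  have b: "lookup m (n - 1) \<le> 2" "lookup m n \<le> 2" "1 \<le> lookup m (n - 1) + lookup m n"
    using m by (auto simp: cubics_def)
  have two: "sgl p 1 + sgl p 1 = sgl p 2" for p :: nat
    by (simp only: single_add[symmetric] one_add_one)
  have k': "k \<in> {n - 1, n}"
    using b(3) s k n by (auto simp: m_eq lookup_add lookup_single when_def split: if_splits)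
  consider "j \<le> n - 2" | "j = n - 1" "k = n - 1" | "j = n - 1" "k = n" | "j = n"
    using s k k' n unfolding insert_iff empty_iff by arith
  then show thesis
  proof cases
    case 1
    then show thesis using yyp[of i j k] s k' m_eq by simp
  next
    case 2
    have "i \<noteq> n - 1" using b(1) 2 by (auto simp: m_eq lookup_add lookup_single)
    then show thesis using ypp[of i "n - 1"] 2 s m_eq n two[of "n - 1"] by (simp add: add.assoc)
  next
    case 3
    show thesis
    proof (cases "i = n - 1")
      case True
      then have "m = sgl n 1 + sgl (n - 1) 2"
        using m_eq 3 two[of "n - 1"] by (simp add: add.commute)
      then show thesis using qpp[of "n - 1" n] by simp
    next
      case False
      then show thesis using ypq[of i] 3 s m_eq n by simp
    qed
  next
    case 4
    have kn: "k = n" using 4 s k by simp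
    have "i \<noteq> n" using b(2) 4 kn by (auto simp: m_eq lookup_add lookup_single)
    then consider "i \<le> n - 2" | "i = n - 1" using s 4 by linarith
    moreover have "m = sgl i 1 + sgl n 2" using m_eq 4 kn two[of n] by (simp add: add.assoc)
    ultimately show thesis by cases (use ypp[of i n] qpp[of n "n - 1"] in auto)
  qed
qed

text \<open>
  Writing \<open>q\<close> for the element of \<open>{n - 1, n}\<close> other than \<open>p\<close>, the chart \<open>(True, h, p)\<close> with \<open>h \<le> n - 2\<close> is
  centred at \<open>x\<^sub>h\<^sup>2 x\<^sub>p\<close> and has coordinates \<open>x\<^sub>t / x\<^sub>h\<close>, \<open>x\<^sub>p / x\<^sub>h\<close>, \<open>x\<^sub>q / x\<^sub>p\<close>; the chart \<open>(False, h, p)\<close> with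
  \<open>h \<noteq> p\<close> is centred at \<open>x\<^sub>h x\<^sub>p\<^sup>2\<close> and has coordinates \<open>x\<^sub>t / x\<^sub>h\<close> and \<open>x\<^sub>h / x\<^sub>p\<close>.
\<close>

definition chart_set :: "nat \<Rightarrow> (bool \<times> nat \<times> nat) set"
  where "chart_set n = {(b, h, p). p \<in> {n - 1, n} \<and> (if b then h \<le> n - 2 else h \<le> n \<and> h \<noteq> p)}"

fun origin :: "bool \<times> nat \<times> nat \<Rightarrow> nat \<Rightarrow>\<^sub>0 nat"
  where "origin (b, h, p) = (if b then sgl h 2 + sgl p 1 else sgl h 1 + sgl p 2)"

fun directions :: "nat \<Rightarrow> bool \<times> nat \<times> nat \<Rightarrow> nat set"
  where "directions n (b, h, p) = {..n} - {h}"

fun edge :: "nat \<Rightarrow> bool \<times> nat \<times> nat \<Rightarrow> nat \<Rightarrow> nat \<Rightarrow>\<^sub>0 nat"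
  where "edge n (b, h, p) t =
    (if b then if t = p then sgl h 1 + sgl p 2
      else if n - 1 \<le> t then sgl h 2 + sgl t 1
      else sgl t 1 + sgl h 1 + sgl p 1
    else if t = p then sgl h 2 + sgl p 1 else sgl t 1 + sgl p 2)"

text \<open>The subtractions are exact on \<open>cubics\<close>, whose bounds 1 and 2 say precisely
  that these exponents are non-negative.\<close>

fun chart_exponents :: "nat \<Rightarrow> bool \<times> nat \<times> nat \<Rightarrow> (nat \<Rightarrow>\<^sub>0 nat) \<Rightarrow> nat \<Rightarrow> nat"
  where "chart_exponents n (b, h, p) m t =
    (if t = p then if b then lookup m (n - 1) + lookup m n - 1 else 2 - lookup m p else lookup m t)"

text \<open>The source point with affine coordinates y has x_h = 1, x_t = y_t, x_p = y_p, x_q = y_p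
  y_q in the first kind of chart, and x_p = 1, x_h = y_p, x_t = y_t y_p in the second. In both the
  origin monomial takes the value y_p, whence \<open>source_scaling\<close>.\<close>

fun source_exponents :: "nat \<Rightarrow> bool \<times> nat \<times> nat \<Rightarrow> nat \<Rightarrow> nat \<Rightarrow> nat"
  where "source_exponents n (b, h, p) i t =
    (if b then if i = h then 0 else if n - 1 \<le> i then of_bool (t = i \<or> t = p) else of_bool (t = i)
    else if i = p then 0 else if i = h then of_bool (t = p) else of_bool (t = i \<or> t = p))"

fun source_scaling :: "bool \<times> nat \<times> nat \<Rightarrow> nat \<Rightarrow> nat"
  where "source_scaling (b, h, p) t = of_bool (t = p)"

lemma chart_set_cases:
  assumes "n \<ge> 3" "x \<in> chart_set n"
  obtains (yyp) h p q where "x = (True, h, p)" "h < n - 1" "p = n - 1 \<and> q = n \<or> p = n \<and> q = n - 1"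
    | (ypp) h p q where "x = (False, h, p)" "h \<le> n" "h \<noteq> p" "p = n - 1 \<and> q = n \<or> p = n \<and> q = n - 1"
proof -
  obtain b h p where x: "x = (b, h, p)" by (cases x)
  then have p: "p = n - 1 \<or> p = n" using assms by (auto simp: chart_set_def)
  let ?q = "if p = n then n - 1 else n"
  have q: "p = n - 1 \<and> ?q = n \<or> p = n \<and> ?q = n - 1" using p assms(1) by auto
  show thesis
  proof (cases b)
    case True
    then have "h < n - 1" using assms x by (auto simp: chart_set_def)
    then show thesis using yyp[OF _ _ q] x True by simp
  next
    case False
    then show thesis using ypp[OF _ _ _ q] assms x by (simp add: chart_set_def)
  qed
qed

lemma chart_True:
  assumes "n \<ge> 3" "h < n - 1" "p = n - 1 \<and> q = n \<or> p = n \<and> q = n - 1"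
  shows "chart_exponents n (True, h, p) m t = (if t = p then lookup m p + lookup m q - 1 else lookup m t)"
    and "edge n (True, h, p) p = sgl h 1 + sgl p 2"
    and "edge n (True, h, p) q = sgl h 2 + sgl q 1"
    and "t < n - 1 \<Longrightarrow> edge n (True, h, p) t = sgl t 1 + sgl h 1 + sgl p 1"
    and "h \<noteq> p" "h \<noteq> q" "p \<noteq> q" "h \<le> n" "p \<le> n" "q \<le> n"
  using assms by auto

lemma togliatti_cubics_iff:
  assumes "p = n - 1 \<and> q = n \<or> p = n \<and> q = n - 1"
  shows "m \<in> togliatti_cubics n \<longleftrightarrow> keys m \<subseteq> {..n} \<and> mdeg m = 3 \<and> lookup m p \<le> 2 \<and> lookup m q \<le> 2 \<and>
    1 \<le> lookup m p + lookup m q \<and> \<not> (lookup m p = 1 \<and> lookup m q = 1)"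
  using assms by (auto simp: togliatti_cubics_def cubics_def)

lemma origin_in:
  assumes n: "n \<ge> 3" and x: "x \<in> chart_set n"
  shows "origin x \<in> togliatti_cubics n"
  using n x
proof (cases rule: chart_set_cases)
  case (yyp h p q)
  note chart = chart_True[OF n yyp(2,3)]
  show ?thesis
    unfolding togliatti_cubics_iff[OF yyp(3)] yyp(1) using chart(5-10)
    by (simp add: keys_add_exponents mdeg_add lookup_add lookup_single when_def)
next
  case (ypp h p q)
  then have "p \<noteq> q" "p \<le> n" using n by auto
  then show ?thesis
    unfolding togliatti_cubics_iff[OF ypp(4)] ypp(1) using ypp(2,3)
    by (simp add: keys_add_exponents mdeg_add lookup_add lookup_single when_def)
qed

lemma edge_in:
  assumes n: "n \<ge> 3" and x: "x \<in> chart_set n" and t: "t \<in> directions n x"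
  shows "edge n x t \<in> togliatti_cubics n"
  using n x
proof (cases rule: chart_set_cases)
  case (yyp h p q)
  note chart = chart_True[OF n yyp(2,3)]
  have "t \<le> n" using t yyp by simp
  then consider "t = p" | "t = q" | "t < n - 1" "t \<noteq> p" "t \<noteq> q" using yyp(2,3) by arith
  then show ?thesis
  proof cases
    case 1
    show ?thesis
      unfolding togliatti_cubics_iff[OF yyp(3)] yyp(1) 1 chart(2) using chart(5-10)
      by (simp add: keys_add_exponents mdeg_add lookup_add lookup_single when_def)
  next
    case 2
    show ?thesis
      unfolding togliatti_cubics_iff[OF yyp(3)] yyp(1) 2 chart(3) using chart(5-10)
      by (simp add: keys_add_exponents mdeg_add lookup_add lookup_single when_def)
  next
    case 3
    show ?thesis
      unfolding togliatti_cubics_iff[OF yyp(3)] yyp(1) chart(4)[OF 3(1)] using chart(5-10) 3(2,3) \<open>t \<le> n\<close>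
      by (simp add: keys_add_exponents mdeg_add lookup_add lookup_single when_def)
  qed
next
  case (ypp h p q)
  then have pq: "p \<noteq> q" "p \<le> n" "t \<le> n" using n t by auto
  show ?thesis
    unfolding togliatti_cubics_iff[OF ypp(4)] ypp(1) using ypp(2,3) pq
    by (cases "t = p") (simp_all add: keys_add_exponents mdeg_add lookup_add lookup_single when_def)
qed

lemma chart_exponents_edge:
  assumes n: "n \<ge> 3" and x: "x \<in> chart_set n" and s: "s \<in> directions n x" and t: "t \<in> directions n x"
  shows "chart_exponents n x (edge n x s) t = (if s = t then 1 else 0)"
  using n x
proof (cases rule: chart_set_cases)
  case (yyp h p q)
  note chart = chart_True[OF n yyp(2,3)]
  have st: "s \<le> n" "s \<noteq> h" "t \<noteq> h" using s t yyp(1) by simp_all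
  then consider "s = p" | "s = q" | "s < n - 1" "s \<noteq> p" "s \<noteq> q" using yyp(2,3) by arith
  then show ?thesis
  proof cases
    case 1
    show ?thesis
      unfolding yyp(1) chart(1) 1 chart(2) using chart(5-7) st
      by (simp add: lookup_add lookup_single when_def)
  next
    case 2
    show ?thesis
      unfolding yyp(1) chart(1) 2 chart(3) using chart(5-7) st
      by (simp add: lookup_add lookup_single when_def)
  next
    case 3
    show ?thesis
      unfolding yyp(1) chart(1) chart(4)[OF 3(1)] using chart(5-7) st 3(2,3)
      by (simp add: lookup_add lookup_single when_def)
  qed
next
  case (ypp h p q)
  have "s \<noteq> h" "t \<noteq> h" using s t ypp(1) by simp_all
  then show ?thesis
    unfolding ypp(1) using ypp(3)
    by (cases "s = p"; cases "t = p") (simp_all add: lookup_add lookup_single when_def)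
qed

lemma toric_atlas_cubics:
  assumes n: "n \<ge> 3"
  shows "toric_atlas {..n} (cubics n) 3 (chart_set n) origin (directions n) (edge n)
    (chart_exponents n) (source_exponents n) source_scaling"
proof
  have sub: "togliatti_cubics n \<subseteq> cubics n" by (auto simp: togliatti_cubics_def)
  show "finite {..n}" by simp
  show "keys m \<subseteq> {..n}" "mdeg m = 3" if "m \<in> cubics n" for m using that by (simp_all add: cubics_def)
  show "finite (directions n x)" for x by (cases x) simp
  show "origin x \<in> cubics n" if "x \<in> chart_set n" for x using origin_in[OF n that] sub by blast
  show "edge n x t \<in> cubics n" if "x \<in> chart_set n" "t \<in> directions n x" for x t
    using edge_in[OF n that] sub by blast
  show "chart_exponents n x (origin x) t = 0" if x: "x \<in> chart_set n" and t: "t \<in> directions n x" for x t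
    using n x
  proof (cases rule: chart_set_cases)
    case (yyp h p q)
    note chart = chart_True[OF n yyp(2,3)]
    have "t \<noteq> h" using t yyp(1) by simp
    then show ?thesis
      unfolding yyp(1) chart(1) using chart(5-7) by (simp add: lookup_add lookup_single when_def)
  next
    case (ypp h p q)
    have "t \<noteq> h" using t ypp(1) by simp
    then show ?thesis
      unfolding ypp(1) using ypp(3) by (simp add: lookup_add lookup_single when_def)
  qed
  show "chart_exponents n x (edge n x s) t = (if s = t then 1 else 0)"
    if "x \<in> chart_set n" "s \<in> directions n x" "t \<in> directions n x" for x s t
    by (rule chart_exponents_edge[OF n that])
  show "lookup m i + (\<Sum>t\<in>directions n x. chart_exponents n x m t) * lookup (origin x) i =
      lookup (origin x) i + (\<Sum>t\<in>directions n x. chart_exponents n x m t * lookup (edge n x t) i)"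
    if x: "x \<in> chart_set n" and m: "m \<in> cubics n" and i: "i \<in> {..n}" for x m i
    using n x
  proof (cases rule: chart_set_cases)
    case (yyp h p q)
    define R where "R = {..n} - {h, p, q}"
    note chart = chart_True[OF n yyp(2,3), folded yyp(1)]
    have pq: "p \<le> n" "q \<le> n" "h \<le> n" "h \<noteq> p" "h \<noteq> q" "p \<noteq> q" using chart(5-10) by simp_all
    have split: "(\<Sum>t\<in>directions n x. f t) = f p + (f q + (\<Sum>t\<in>R. f t))" for f :: "nat \<Rightarrow> nat"
    proof -
      have "{..n} - {h} = insert p (insert q R)" "p \<notin> insert q R" "q \<notin> R" "finite R"
        using pq by (auto simp: R_def)
      then show ?thesis by (simp add: yyp(1))
    qed
    let ?\<sigma> = "\<Sum>t\<in>R. lookup m t"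
    have R: "t < n - 1" "t \<noteq> h" "t \<noteq> p" "t \<noteq> q" if "t \<in> R" for t
    proof -
      show "t \<noteq> h" "t \<noteq> p" "t \<noteq> q" using that by (auto simp: R_def)
      moreover have "t \<le> n" using that by (simp add: R_def)
      ultimately show "t < n - 1" using yyp by arith
    qed
    have "{..n} = insert h (insert p (insert q R))" "finite R" "h \<notin> R" "p \<notin> R" "q \<notin> R" "p \<noteq> q"
      using pq by (auto simp: R_def)
    then have "(\<Sum>i\<le>n. lookup m i) = lookup m h + lookup m p + lookup m q + ?\<sigma>" using pq by simp
    moreover have "mdeg m = (\<Sum>i\<le>n. lookup m i)" using m by (intro mdeg_superset) (auto simp: cubics_def)
    ultimately have deg: "lookup m h + lookup m p + lookup m q + ?\<sigma> = 3" using m by (simp add: cubics_def)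
    have pq1: "lookup m (n - 1) + lookup m n = lookup m p + lookup m q"
      using yyp by auto
    have ge1: "1 \<le> lookup m p + lookup m q" using m pq1 by (simp add: cubics_def)
    have c: "chart_exponents n x m p = lookup m p + lookup m q - 1"
      "chart_exponents n x m q = lookup m q" "\<And>t. t \<in> R \<Longrightarrow> chart_exponents n x m t = lookup m t"
      using chart(1) R pq by simp_all
    have E: "edge n x p = sgl h 1 + sgl p 2" "edge n x q = sgl h 2 + sgl q 1"
      "\<And>t. t \<in> R \<Longrightarrow> edge n x t = sgl t 1 + sgl h 1 + sgl p 1"
      using chart(2-4) R by simp_all
    have sumE: "(\<Sum>t\<in>R. chart_exponents n x m t * lookup (edge n x t) i) =
        (\<Sum>t\<in>R. lookup m t * (of_bool (t = i) + of_bool (h = i) + of_bool (p = i)))"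
      using c(3) E(3) by (intro sum.cong) (auto simp: lookup_add lookup_single when_def)
    have sumc: "(\<Sum>t\<in>R. chart_exponents n x m t) = ?\<sigma>" using c(3) by simp
    have sum_i: "(\<Sum>t\<in>R. lookup m t * of_bool (t = i)) = (if i \<in> R then lookup m i else 0)"
      by (simp add: R_def)
    obtain r where r: "lookup m p + lookup m q = Suc r" using ge1 by (metis One_nat_def Suc_le_D)
    have A: "lookup (origin x) i = 2 * of_bool (i = h) + of_bool (i = p)"
      using pq by (auto simp: yyp(1) lookup_add lookup_single when_def)
    have Ep: "lookup (edge n x p) i = of_bool (i = h) + 2 * of_bool (i = p)"
      and Eq: "lookup (edge n x q) i = 2 * of_bool (i = h) + of_bool (i = q)"
      unfolding E by (auto simp: lookup_add lookup_single when_def)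
    have lhs: "(\<Sum>t\<in>directions n x. chart_exponents n x m t) = r + (lookup m q + ?\<sigma>)"
      unfolding split sumc c r by simp
    have rhs: "(\<Sum>t\<in>directions n x. chart_exponents n x m t * lookup (edge n x t) i) =
        r * (of_bool (i = h) + 2 * of_bool (i = p)) + (lookup m q * (2 * of_bool (i = h) + of_bool (i = q)) +
        ((if i \<in> R then lookup m i else 0) + ?\<sigma> * (of_bool (h = i) + of_bool (p = i))))"
      unfolding split sumE c r Ep Eq
      by (simp add: distrib_left sum.distrib sum_i flip: sum_distrib_right)
    \<comment> \<open>For \<open>i = h\<close> the identity is the total degree 3, for
      \<open>i = p\<close> the definition of \<open>r\<close>; every other variable occurs in its
      own edge only.\<close>
    consider "i = h" | "i = p" | "i = q" | "i \<in> R" using i by (auto simp: R_def)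
    then show ?thesis
      unfolding lhs rhs A by cases (use pq deg r R in auto)
  next
    case (ypp h p q)
    define R where "R = {..n} - {h, p}"
    have pq: "p \<le> n" using ypp by auto
    have split: "(\<Sum>t\<in>directions n x. f t) = f p + (\<Sum>t\<in>R. f t)" for f :: "nat \<Rightarrow> nat"
    proof -
      have "{..n} - {h} = insert p R" "p \<notin> R" "finite R" using pq ypp by (auto simp: R_def)
      then show ?thesis using ypp by simp
    qed
    let ?\<sigma> = "\<Sum>t\<in>R. lookup m t"
    have R: "t \<noteq> h" "t \<noteq> p" if "t \<in> R" for t using that by (auto simp: R_def)
    have "{..n} = insert h (insert p R)" "finite R" "h \<notin> R" "p \<notin> R" using pq ypp by (auto simp: R_def)
    then have "(\<Sum>i\<le>n. lookup m i) = lookup m h + lookup m p + ?\<sigma>" using ypp by simp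
    moreover have "mdeg m = (\<Sum>i\<le>n. lookup m i)" using m by (intro mdeg_superset) (auto simp: cubics_def)
    ultimately have deg: "lookup m h + lookup m p + ?\<sigma> = 3" using m by (simp add: cubics_def)
    have le2: "lookup m p \<le> 2" using m ypp by (auto simp: cubics_def)
    then obtain r where r: "lookup m p + r = 2" using le_Suc_ex by metis
    have c: "chart_exponents n x m p = r" "\<And>t. t \<in> R \<Longrightarrow> chart_exponents n x m t = lookup m t"
      using ypp R r by auto
    have E: "edge n x p = sgl h 2 + sgl p 1" "\<And>t. t \<in> R \<Longrightarrow> edge n x t = sgl t 1 + sgl p 2"
      using ypp R by auto
    have sumE: "(\<Sum>t\<in>R. chart_exponents n x m t * lookup (edge n x t) i) =
        (\<Sum>t\<in>R. lookup m t * (of_bool (t = i) + 2 * of_bool (p = i)))"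
      using c(2) E(2) by (intro sum.cong) (auto simp: lookup_add lookup_single when_def)
    have sumc: "(\<Sum>t\<in>R. chart_exponents n x m t) = ?\<sigma>" using c(2) by simp
    have sum_i: "(\<Sum>t\<in>R. lookup m t * of_bool (t = i)) = (if i \<in> R then lookup m i else 0)"
      by (simp add: R_def)
    have A: "lookup (origin x) i = of_bool (i = h) + 2 * of_bool (i = p)"
      using ypp by (auto simp: lookup_add lookup_single when_def)
    have Ep: "lookup (edge n x p) i = 2 * of_bool (i = h) + of_bool (i = p)"
      unfolding E by (auto simp: lookup_add lookup_single when_def)
    have lhs: "(\<Sum>t\<in>directions n x. chart_exponents n x m t) = r + ?\<sigma>"
      unfolding split sumc c by simp
    have rhs: "(\<Sum>t\<in>directions n x. chart_exponents n x m t * lookup (edge n x t) i) =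
        r * (2 * of_bool (i = h) + of_bool (i = p)) +
        ((if i \<in> R then lookup m i else 0) + ?\<sigma> * (2 * of_bool (p = i)))"
      unfolding split sumE c Ep
      by (simp add: distrib_left sum.distrib sum_i flip: sum_distrib_right)
    consider "i = h" | "i = p" | "i \<in> R" using i by (auto simp: R_def)
    then show ?thesis
      unfolding lhs rhs A by cases (use ypp deg r R in auto)
  qed
  show "(\<Sum>i\<in>{..n}. source_exponents n x i t * lookup m i) = source_scaling x t + chart_exponents n x m t"
    if x: "x \<in> chart_set n" and m: "m \<in> cubics n" and t: "t \<in> directions n x" for x m t
  proof -
    \<comment> \<open>Source exponents are 0 or 1, so the sum is the degree of \<open>m\<close> in
      the set \<open>S\<close> of variables whose value involves the coordinate
      \<open>t\<close>.\<close>
    have restrict: "(\<Sum>i\<in>{..n}. source_exponents n x i t * lookup m i) = (\<Sum>i\<in>S. lookup m i)"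
      if "S \<subseteq> {..n}" "\<And>i. i \<le> n \<Longrightarrow> source_exponents n x i t = of_bool (i \<in> S)" for S
    proof -
      have "(\<Sum>i\<in>{..n}. source_exponents n x i t * lookup m i) = (\<Sum>i\<in>{..n}. if i \<in> S then lookup m i else 0)"
        using that(2) by (intro sum.cong) auto
      then show ?thesis using that(1) by (simp add: Int_absorb1 flip: sum.inter_restrict)
    qed
    show ?thesis using n x
    proof (cases rule: chart_set_cases)
      case (yyp h p q)
      have "t \<le> n" using t yyp by simp
      then consider "t = p" | "t = q" | "t < n - 1" "t \<noteq> p" "t \<noteq> q" using yyp by arith
      then show ?thesis
      proof cases
        case 1
        have "(\<Sum>i\<in>{..n}. source_exponents n x i t * lookup m i) = (\<Sum>i\<in>{n - 1, n}. lookup m i)"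
          using 1 yyp n by (intro restrict) auto
        moreover have "1 \<le> lookup m (n - 1) + lookup m n" using m by (simp add: cubics_def)
        ultimately show ?thesis using 1 yyp n by simp
      next
        case 2
        have "(\<Sum>i\<in>{..n}. source_exponents n x i t * lookup m i) = (\<Sum>i\<in>{q}. lookup m i)"
          using 2 yyp n by (intro restrict) auto
        then show ?thesis using 2 yyp by auto
      next
        case 3
        have "(\<Sum>i\<in>{..n}. source_exponents n x i t * lookup m i) = (\<Sum>i\<in>{t}. lookup m i)"
          using 3 yyp n t by (intro restrict) auto
        then show ?thesis using 3 yyp by auto
      qed
    next
      case (ypp h p q)
      show ?thesis
      proof (cases "t = p")
        case True
        have "(\<Sum>i\<in>{..n}. source_exponents n x i t * lookup m i) = (\<Sum>i\<in>{..n} - {p}. lookup m i)"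
          using True ypp by (intro restrict) auto
        moreover have "mdeg m = lookup m p + (\<Sum>i\<in>{..n} - {p}. lookup m i)"
          using m ypp mdeg_superset[of "{..n}" m] by (auto simp: cubics_def sum.remove[of "{..n}" p])
        moreover have "lookup m p \<le> 2" using m ypp by (auto simp: cubics_def)
        moreover have "mdeg m = 3" using m by (simp add: cubics_def)
        ultimately show ?thesis using True ypp by simp
      next
        case False
        have "(\<Sum>i\<in>{..n}. source_exponents n x i t * lookup m i) = (\<Sum>i\<in>{t}. lookup m i)"
          using False ypp t by (intro restrict) auto
        then show ?thesis using False ypp by auto
      qed
    qed
  qed
  \<comment> \<open>(x_j x_k x_p)^2 is the product of x_j^2 x_p and x_k^2 x_p, and (x_j x_(n-1)
    x_n)^2 that of x_j x_(n-1)^2 and x_j x_n^2. The other cubics are origins.\<close>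
  show "\<exists>x\<in>chart_set n. \<exists>y\<in>chart_set n. m + m = origin x + origin y" if m: "m \<in> cubics n" for m
  proof -
    have two: "sgl p 1 + sgl p 1 = sgl p 2" "sgl p 2 + sgl p 2 = sgl p 4" for p :: nat
      by (simp_all add: numeral_eq_Suc flip: single_add)
    show ?thesis using n m
    proof (cases rule: cubics_cases)
      case (yyp j k p)
      have "m + m = origin (True, j, p) + origin (True, k, p)"
        unfolding yyp by (simp add: ac_simps flip: two(1))
      moreover have "(True, j, p) \<in> chart_set n" "(True, k, p) \<in> chart_set n"
        using yyp by (auto simp: chart_set_def)
      ultimately show ?thesis by blast
    next
      case (ypp j p)
      have "m + m = origin (False, j, p) + origin (False, j, p)" unfolding ypp by simp
      moreover have "(False, j, p) \<in> chart_set n" using ypp n by (auto simp: chart_set_def)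
      ultimately show ?thesis by blast
    next
      case (ypq j)
      have "m + m = origin (False, j, n - 1) + origin (False, j, n)"
        unfolding ypq by (simp add: ac_simps flip: two(1))
      moreover have "(False, j, n - 1) \<in> chart_set n" "(False, j, n) \<in> chart_set n"
        using ypq n by (auto simp: chart_set_def)
      ultimately show ?thesis by blast
    next
      case (qpp p q)
      have "m + m = origin (False, q, p) + origin (False, q, p)" unfolding qpp by simp
      moreover have "(False, q, p) \<in> chart_set n" using qpp n by (auto simp: chart_set_def doubleton_eq_iff)
      ultimately show ?thesis by blast
    qed
  qed
qed

lemma card_directions: "x \<in> chart_set n \<Longrightarrow> card (directions n x) = n"
  by (cases x) (auto simp: chart_set_def split: if_splits)

lemma toric_family_cubics:
  assumes "n \<ge> 3" "finite K" "e ` K \<subseteq> cubics n" "togliatti_cubics n \<subseteq> e ` K"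
  shows "toric_family {..n} (cubics n) 3 (chart_set n) origin (directions n) (edge n)
    (chart_exponents n) (source_exponents n) source_scaling K e"
proof -
  have "(True, 0, n) \<in> chart_set n" by (simp add: chart_set_def)
  then have "K \<noteq> {}" using origin_in[OF assms(1)] assms(4) by blast
  then show ?thesis
    unfolding toric_family_def toric_family_axioms_def
    using toric_atlas_cubics origin_in edge_in assms by blast
qed

text \<open>With degrees b, c in x_(n-1), x_n one has i = b + c - 1 and j = c. The vertices become
  (0,0), (1,0), (0,1), (1,2), (2,1), (2,2), all on the conic; the omitted centre (1,1) is not. The
  total degree 3 excludes b = c = 2.\<close>

lemma togliatti_relation:
  assumes "n \<ge> 3" "m \<in> togliatti_cubics n"
  defines "i \<equiv> chart_exponents n (True, 0, n - 1) m (n - 1)"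
    and "j \<equiv> chart_exponents n (True, 0, n - 1) m n"
  shows "i * (i - 1) + j * (j - 1) = i * j"
proof -
  have "lookup m (n - 1) \<in> {0, 1, 2}" "lookup m n \<in> {0, 1, 2}"
    "1 \<le> lookup m (n - 1) + lookup m n" "\<not> (lookup m (n - 1) = 1 \<and> lookup m n = 1)"
    "lookup m (n - 1) + lookup m n \<le> 3"
  proof -
    have "(\<Sum>i\<in>{n - 1, n}. lookup m i) \<le> (\<Sum>i\<le>n. lookup m i)" by (rule sum_mono2) auto
    then show "lookup m (n - 1) + lookup m n \<le> 3"
      using assms mdeg_superset[of "{..n}" m] by (simp add: togliatti_cubics_def cubics_def)
  qed (use assms(2) in \<open>auto simp: togliatti_cubics_def cubics_def\<close>)
  moreover have "n - 1 \<noteq> n" using assms(1) by simp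
  ultimately show ?thesis unfolding i_def j_def by auto
qed

section \<open>Monomial ideals\<close>

text \<open>Described by a condition on exponents instead of generators, so that membership is read
  off from the terms. It is an ideal once \<open>P\<close> passes to multiples.\<close>

definition monomial_ideal :: "'i set \<Rightarrow> (('i \<Rightarrow>\<^sub>0 nat) \<Rightarrow> bool) \<Rightarrow> ('i, 'a::comm_ring_1) mpoly set"
  where "monomial_ideal J P = {p \<in> carrier (poly_ring J). \<forall>m\<in>keys p. P m}"

lemma poly_ring_simps [simp]:
  "\<zero>\<^bsub>poly_ring J\<^esub> = 0" "\<one>\<^bsub>poly_ring J\<^esub> = 1" "p \<oplus>\<^bsub>poly_ring J\<^esub> q = p + q" "p \<otimes>\<^bsub>poly_ring J\<^esub> q = p * q"
  by (simp_all add: poly_ring_def)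

lemma ideal_monomial_ideal:
  assumes "\<And>m m'. P m \<Longrightarrow> P (m + m')"
  shows "ideal (monomial_ideal J P) (poly_ring J :: ('i, 'a::comm_ring_1) mpoly ring)"
proof -
  let ?R = "poly_ring J :: ('i, 'a) mpoly ring" and ?I = "monomial_ideal J P :: ('i, 'a) mpoly set"
  interpret cring ?R by (rule cring_poly_ring)
  have mult: "q * p \<in> ?I" if "p \<in> ?I" "q \<in> carrier ?R" for p q
  proof -
    have "P m" if m: "m \<in> keys (q * p)" for m
    proof -
      obtain x y where "m = x + y" "y \<in> keys p" using m Poly_Mapping.keys_mult[of q p] by blast
      then show ?thesis using \<open>p \<in> ?I\<close> assms[of y x] by (simp add: monomial_ideal_def add.commute)
    qed
    then show ?thesis using that by (simp add: monomial_ideal_def carrier_poly_ring_closed)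
  qed
  show ?thesis
  proof (rule idealI)
    show "ring ?R" by (rule ring_axioms)
    show "subgroup ?I (add_monoid ?R)"
    proof
      show "?I \<subseteq> carrier (add_monoid ?R)" by (auto simp: monomial_ideal_def)
      show "p \<otimes>\<^bsub>add_monoid ?R\<^esub> q \<in> ?I" if "p \<in> ?I" "q \<in> ?I" for p q
        using that Poly_Mapping.keys_add[of p q] by (auto simp: monomial_ideal_def carrier_poly_ring_closed)
      show "\<one>\<^bsub>add_monoid ?R\<^esub> \<in> ?I" by (auto simp: monomial_ideal_def poly_ring_def)
      show "inv\<^bsub>add_monoid ?R\<^esub> p \<in> ?I" if p: "p \<in> ?I" for p
      proof -
        have "\<ominus>\<^bsub>?R\<^esub> p = - p"
          using p by (intro minus_equality) (auto simp: monomial_ideal_def carrier_poly_ring_uminus)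
        then show ?thesis
          using p unfolding a_inv_def[symmetric] by (simp add: monomial_ideal_def carrier_poly_ring_uminus)
      qed
    qed
    show "q \<otimes>\<^bsub>?R\<^esub> p \<in> ?I" if "p \<in> ?I" "q \<in> carrier ?R" for p q using mult[OF that] by simp
    show "p \<otimes>\<^bsub>?R\<^esub> q \<in> ?I" if "p \<in> ?I" "q \<in> carrier ?R" for p q
      using mult[OF that] by (simp add: mult.commute)
  qed
qed

lemma xpow_in_carrier: "keys m \<subseteq> J \<Longrightarrow> Poly_Mapping.single m r \<in> carrier (poly_ring J)"
  by (auto simp: poly_ring_def)

lemma xpow_in_monomial_ideal: "keys m \<subseteq> J \<Longrightarrow> P m \<Longrightarrow> xpow m \<in> monomial_ideal J P"
  by (simp add: monomial_ideal_def xpow_in_carrier)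

lemma genideal_subset_monomial_ideal:
  fixes S :: "('i, 'a::comm_ring_1) mpoly set"
  assumes "\<And>m m'. P m \<Longrightarrow> P (m + m')" "S \<subseteq> monomial_ideal J P"
  shows "genideal (poly_ring J) S \<subseteq> monomial_ideal J P"
  using ring.genideal_minimal[OF cring.axioms(1)[OF cring_poly_ring] ideal_monomial_ideal assms(2)] assms(1)
  by blast

lemma ideal_prod_subset_monomial_ideal:
  assumes "I1 \<subseteq> monomial_ideal J P" "I2 \<subseteq> monomial_ideal J Q" "\<And>m m'. P m \<Longrightarrow> Q m' \<Longrightarrow> S (m + m')"
  shows "ideal_prod (poly_ring J) I1 I2 \<subseteq> monomial_ideal J S"
proof
  fix p assume "p \<in> ideal_prod (poly_ring J) I1 I2"
  then show "p \<in> monomial_ideal J S"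
  proof (induction rule: ideal_prod.induct)
    case (prod f g)
    have "S m" if m: "m \<in> keys (f * g)" for m
    proof -
      obtain x y where "m = x + y" "x \<in> keys f" "y \<in> keys g"
        using m Poly_Mapping.keys_mult[of f g] by blast
      moreover have "f \<in> monomial_ideal J P" "g \<in> monomial_ideal J Q" using prod assms(1,2) by blast+
      ultimately show ?thesis using assms(3) by (simp add: monomial_ideal_def)
    qed
    moreover have "f \<in> carrier (poly_ring J)" "g \<in> carrier (poly_ring J)"
      using prod assms by (auto simp: monomial_ideal_def)
    ultimately show ?case by (simp add: monomial_ideal_def carrier_poly_ring_closed)
  next
    case (sum f g)
    then show ?case
      using Poly_Mapping.keys_add[of f g] by (auto simp: monomial_ideal_def carrier_poly_ring_closed)
  qed
qed

lemma genideal_poly_ring: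
  fixes S :: "('i, 'a::comm_ring_1) mpoly set"
  assumes "S \<subseteq> carrier (poly_ring J)"
  shows "ideal (genideal (poly_ring J) S) (poly_ring J)" "S \<subseteq> genideal (poly_ring J) S"
  using ring.genideal_ideal[OF cring.axioms(1)[OF cring_poly_ring] assms]
    ring.genideal_self[OF cring.axioms(1)[OF cring_poly_ring] assms] by blast+

lemma zero_in_ideal: "ideal I (poly_ring J) \<Longrightarrow> 0 \<in> I"
  using additive_subgroup.zero_closed[OF ideal.axioms(1)] by fastforce

lemma sum_in_ideal:
  assumes "ideal I (poly_ring J)" "\<And>x. x \<in> A \<Longrightarrow> f x \<in> I"
  shows "(\<Sum>x\<in>A. f x) \<in> I"
  using assms(2)
proof (induction A rule: infinite_finite_induct)
  case (insert x A)
  then show ?case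
    using additive_subgroup.a_closed[OF ideal.axioms(1)[OF assms(1)], of "f x" "\<Sum>x\<in>A. f x"] by simp
qed (simp_all add: zero_in_ideal[OF assms(1)])

section \<open>The inverse system\<close>

text \<open>The degree in the first \<open>n - 1\<close> variables is additive, so the triple ideal
  product has only terms of degree at least 3 in them; the other alternatives are the remaining
  generators. This upper bound keeps the standard cubics out of the ideal.\<close>

lemma togliatti_ideal_subset:
  assumes n: "n \<ge> 3"
  shows "togliatti_ideal n \<subseteq> monomial_ideal {..n} (\<lambda>m. 3 \<le> (\<Sum>i\<le>n - 2. lookup m i) \<or> 3 \<le> lookup m (n - 1) \<or>
    3 \<le> lookup m n \<or> (1 \<le> lookup m (n - 1) \<and> 1 \<le> lookup m n \<and> (\<exists>i\<le>n - 2. 1 \<le> lookup m i)))"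
    (is "_ \<subseteq> monomial_ideal _ ?P")
proof -
  let ?R = "poly_ring {..n} :: (nat, 'a) mpoly ring"
  let ?\<mm> = "genideal ?R (mvar ` {..n - 2})"
  let ?S = "{mvar (n - 1) ^ 3, mvar n ^ 3} \<union> {mvar i * mvar (n - 1) * mvar n | i. i \<le> n - 2} :: (nat, 'a) mpoly set"
  have deg: "?\<mm> \<subseteq> monomial_ideal {..n} (\<lambda>m. 1 \<le> (\<Sum>i\<le>n - 2. lookup m i))"
  proof (rule genideal_subset_monomial_ideal)
    show "mvar ` {..n - 2} \<subseteq> monomial_ideal {..n} (\<lambda>m. 1 \<le> (\<Sum>i\<le>n - 2. lookup m i))"
      by (auto intro!: xpow_in_monomial_ideal simp: lookup_single when_def)
  qed (simp add: lookup_add sum.distrib)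
  have "ideal_prod ?R ?\<mm> ?\<mm> \<subseteq> monomial_ideal {..n} (\<lambda>m. 2 \<le> (\<Sum>i\<le>n - 2. lookup m i))"
    by (rule ideal_prod_subset_monomial_ideal[OF deg deg]) (simp add: lookup_add sum.distrib)
  then have I: "ideal_prod ?R ?\<mm> (ideal_prod ?R ?\<mm> ?\<mm>) \<subseteq> monomial_ideal {..n} ?P"
    by (rule ideal_prod_subset_monomial_ideal[OF deg]) (simp add: lookup_add sum.distrib)
  have "genideal ?R ?S \<subseteq> monomial_ideal {..n} ?P"
  proof (rule genideal_subset_monomial_ideal)
    fix m m' assume "?P m"
    then show "?P (m + m')"
      unfolding lookup_add sum.distrib by (meson le_add1 le_trans)
  next
    have "mvar i ^ 3 = (xpow (sgl i 3) :: (nat, 'a) mpoly)" for i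
      by (simp add: eval_nat_numeral mult_single flip: single_add)
    moreover have "mvar i * mvar (n - 1) * mvar n = (xpow (sgl i 1 + sgl (n - 1) 1 + sgl n 1) :: (nat, 'a) mpoly)" for i
      by (simp add: mult_single)
    ultimately show "?S \<subseteq> monomial_ideal {..n} ?P"
      by (auto intro!: xpow_in_monomial_ideal simp: lookup_add lookup_single when_def keys_add_exponents)
  qed
  moreover have "p + q \<in> monomial_ideal {..n} ?P"
    if "p \<in> monomial_ideal {..n} ?P" "q \<in> monomial_ideal {..n} ?P" for p q :: "(nat, 'a) mpoly"
  proof -
    have "\<forall>m\<in>keys p \<union> keys q. ?P m" using that unfolding monomial_ideal_def by blast
    then have "\<forall>m\<in>keys (p + q). ?P m" using Poly_Mapping.keys_add[of p q] by blast
    then show ?thesis using that unfolding monomial_ideal_def by (simp add: carrier_poly_ring_closed)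
  qed
  ultimately show ?thesis using I by (auto simp: togliatti_ideal_def Let_def set_add_def')
qed

text \<open>In degree 3 each excluded monomial is itself a generator, up to the order of its
  factors.\<close>

lemma cubic_in_togliatti_ideal:
  assumes n: "n \<ge> 3" and m: "keys m \<subseteq> {..n}" "mdeg m = 3" and not: "m \<notin> togliatti_cubics n"
  shows "xpow m \<in> togliatti_ideal n"
proof -
  let ?R = "poly_ring {..n} :: (nat, 'a) mpoly ring"
  let ?x = "mvar :: nat \<Rightarrow> (nat, 'a) mpoly"
  let ?\<mm> = "genideal ?R (?x ` {..n - 2})"
  let ?S = "{?x (n - 1) ^ 3, ?x n ^ 3} \<union> {?x i * ?x (n - 1) * ?x n | i. i \<le> n - 2}"
  have sub: "?x ` {..n - 2} \<subseteq> carrier ?R" by (auto intro!: xpow_in_carrier)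
  have cube: "?x i ^ 3 = xpow (sgl i 3)" for i
    by (simp add: eval_nat_numeral mult_single flip: single_add)
  have S: "?S \<subseteq> carrier ?R"
    unfolding cube by (auto intro!: xpow_in_carrier simp: mult_single keys_add_exponents)
  note \<mm> = genideal_poly_ring[OF sub] and G = genideal_poly_ring[OF S]
  have prod3: "?x i * (?x j * ?x k) \<in> ideal_prod ?R ?\<mm> (ideal_prod ?R ?\<mm> ?\<mm>)"
    if "i \<le> n - 2" "j \<le> n - 2" "k \<le> n - 2" for i j k
    using ideal_prod.prod[of "?x i" ?\<mm> "?x j * ?x k" "ideal_prod ?R ?\<mm> ?\<mm>" ?R]
      ideal_prod.prod[of "?x j" ?\<mm> "?x k" ?\<mm> ?R] that \<mm>(2) by auto
  \<comment> \<open>\<open><+>\<close> is the set of sums, so embedding one summand takes the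
    element 0 of the other; in the inductively defined \<open>ideal_prod\<close> it arises as a
    product of zeros.\<close>
  have "0 * (0 * 0) \<in> ideal_prod ?R ?\<mm> (ideal_prod ?R ?\<mm> ?\<mm>)"
    using ideal_prod.prod[of 0 ?\<mm> "0 * 0" "ideal_prod ?R ?\<mm> ?\<mm>" ?R]
      ideal_prod.prod[of 0 ?\<mm> 0 ?\<mm> ?R] zero_in_ideal[OF \<mm>(1)] by simp
  then have left0: "0 \<in> ideal_prod ?R ?\<mm> (ideal_prod ?R ?\<mm> ?\<mm>)" by simp
  have sum: "p + q \<in> togliatti_ideal n"
    if "p \<in> ideal_prod ?R ?\<mm> (ideal_prod ?R ?\<mm> ?\<mm>)" "q \<in> genideal ?R ?S" for p q
    unfolding togliatti_ideal_def Let_def set_add_def' poly_ring_simps using that by blast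
  have right: "p \<in> togliatti_ideal n" if "p \<in> ?S" for p
    using sum[OF left0 subsetD[OF G(2) that]] by (simp only: add_0)
  have left: "p \<in> togliatti_ideal n" if "p \<in> ideal_prod ?R ?\<mm> (ideal_prod ?R ?\<mm> ?\<mm>)" for p
    using sum[OF that zero_in_ideal[OF G(1)]] by (simp only: add_0_right)
  obtain i j k where s: "i \<le> j" "j \<le> k" and m_eq: "m = sgl i 1 + sgl j 1 + sgl k 1"
    using m(2) by (rule sorted_cubic)
  have k: "k \<le> n" using m by (auto simp: m_eq keys_add_exponents)
  have mon: "xpow m = ?x i * ?x j * ?x k" by (simp add: m_eq mult_single)
  have n1: "n - 1 \<noteq> n" using n by simp
  have look: "lookup m l = of_bool (i = l) + of_bool (j = l) + of_bool (k = l)" for l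
    by (auto simp: m_eq lookup_add lookup_single when_def)
  consider "k \<le> n - 2" | "i = n - 1" "j = n - 1" "k = n - 1" | "i = n" "j = n" "k = n"
    | "i \<le> n - 2" "j = n - 1" "k = n"
  proof -
    have "3 \<le> lookup m (n - 1) \<or> 3 \<le> lookup m n \<or> lookup m (n - 1) + lookup m n = 0 \<or>
        (lookup m (n - 1) = 1 \<and> lookup m n = 1)"
      using not m unfolding togliatti_cubics_def cubics_def by auto
    then show thesis
    proof (elim disjE)
      assume "lookup m (n - 1) + lookup m n = 0"
      then have "k \<noteq> n - 1" "k \<noteq> n" by (auto simp: look)
      then show thesis using that(1) k by linarith
    next
      assume "3 \<le> lookup m (n - 1)"
      then show thesis using that(2) by (auto simp: look split: if_splits simp: of_bool_def)
    next
      assume "3 \<le> lookup m n"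
      then show thesis using that(3) by (auto simp: look split: if_splits simp: of_bool_def)
    next
      assume l: "lookup m (n - 1) = 1 \<and> lookup m n = 1"
      have "k = n" using l s k by (auto simp: look of_bool_def split: if_splits)
      moreover have "j \<noteq> n" using l \<open>k = n\<close> by (auto simp: look of_bool_def)
      ultimately have jk: "j < n" "k = n" using s by simp_all
      have l1: "of_bool (i = n - 1) + of_bool (j = n - 1) + of_bool (k = n - 1) = (1::nat)"
        using l look by metis
      have j: "j = n - 1"
      proof (rule ccontr)
        assume "j \<noteq> n - 1"
        then have "i \<noteq> n - 1" using s jk by linarith
        then show False using l1 \<open>j \<noteq> n - 1\<close> jk n1 by simp
      qed
      have "i \<noteq> n - 1" using l1 j jk n1 by (cases "i = n - 1") simp_all
      then have "i \<le> n - 2" using s j by linarith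
      then show thesis using that(4) j jk by blast
    qed
  qed
  then show ?thesis
  proof cases
    case 1
    then show ?thesis using left[OF prod3[of i j k]] s mon by (simp add: mult.assoc)
  next
    case 2
    then have "xpow m = ?x (n - 1) ^ 3" by (simp add: mon power3_eq_cube)
    then show ?thesis using right by blast
  next
    case 3
    then have "xpow m = ?x n ^ 3" by (simp add: mon power3_eq_cube)
    then show ?thesis using right by blast
  next
    case 4
    then have "xpow m = ?x i * ?x (n - 1) * ?x n" by (simp add: mon)
    then show ?thesis using right 4 by blast
  qed
qed

lemma standard_monomials_togliatti:
  assumes n: "n \<ge> 3"
  shows "standard_monomials {..n} (togliatti_ideal n :: (nat, 'a::field) mpoly set) 3 = togliatti_cubics n"
proof (intro equalityI subsetI)
  fix m assume "m \<in> standard_monomials {..n} (togliatti_ideal n :: (nat, 'a) mpoly set) 3"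
  then show "m \<in> togliatti_cubics n"
    using cubic_in_togliatti_ideal[OF n, of m] by (auto simp: standard_monomials_def)
next
  fix m assume m: "m \<in> togliatti_cubics n"
  then have keys: "keys m \<subseteq> {..n}" "mdeg m = 3" by (auto simp: togliatti_cubics_def cubics_def)
  have "{..n} = insert (n - 1) (insert n {..n - 2})" "n - 1 \<notin> insert n {..n - 2}" "n \<notin> {..n - 2}"
    using n by auto
  then have "(\<Sum>i\<le>n. lookup m i) = lookup m (n - 1) + (lookup m n + (\<Sum>i\<le>n - 2. lookup m i))" by simp
  moreover have "mdeg m = (\<Sum>i\<le>n. lookup m i)" using keys by (intro mdeg_superset) auto
  ultimately have deg: "(\<Sum>i\<le>n - 2. lookup m i) + (lookup m (n - 1) + lookup m n) = 3"
    using keys by simp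
  have bc: "lookup m (n - 1) \<le> 2" "lookup m n \<le> 2" "1 \<le> lookup m (n - 1) + lookup m n"
    "\<not> (lookup m (n - 1) = 1 \<and> lookup m n = 1)"
    using m by (auto simp: togliatti_cubics_def cubics_def)
  have "xpow m \<notin> (togliatti_ideal n :: (nat, 'a) mpoly set)"
  proof
    assume "xpow m \<in> (togliatti_ideal n :: (nat, 'a) mpoly set)"
    then have "3 \<le> (\<Sum>i\<le>n - 2. lookup m i) \<or> 3 \<le> lookup m (n - 1) \<or> 3 \<le> lookup m n \<or>
        (1 \<le> lookup m (n - 1) \<and> 1 \<le> lookup m n \<and> (\<exists>i\<le>n - 2. 1 \<le> lookup m i))"
      using togliatti_ideal_subset[OF n, where 'a = 'a] by (auto simp: monomial_ideal_def)
    then obtain i where i: "1 \<le> lookup m (n - 1)" "1 \<le> lookup m n" "i \<le> n - 2" "1 \<le> lookup m i"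
      using deg bc by fastforce
    have "lookup m i \<le> (\<Sum>i\<le>n - 2. lookup m i)" using i by (intro member_le_sum) auto
    then show False using i deg bc by linarith
  qed
  then show "m \<in> standard_monomials {..n} (togliatti_ideal n :: (nat, 'a) mpoly set) 3"
    using keys by (simp add: standard_monomials_def)
qed

section \<open>Counting the cubics\<close>

definition monomials_below :: "nat \<Rightarrow> nat \<Rightarrow> (nat \<Rightarrow>\<^sub>0 nat) set"
  where "monomials_below l d = {m. keys m \<subseteq> {..<l} \<and> mdeg m = d}"

lemma finite_monomials_below: "finite (monomials_below l d)"
proof (cases "l = 0")
  case True
  then have "monomials_below l d \<subseteq> {0}" by (auto simp: monomials_below_def)
  then show ?thesis by (rule finite_subset) simp
next
  case False
  then show ?thesis unfolding monomials_below_def by (intro card_monomials_of_degree_le(1)) auto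
qed

lemma card_monomials_below_0: "card (monomials_below l 0) = 1"
proof -
  have "monomials_below l 0 = {0}" by (auto simp: monomials_below_def mdeg_eq_0_iff)
  then show ?thesis by simp
qed

lemma card_monomials_below_1: "card (monomials_below l 1) = l"
proof -
  have "monomials_below l 1 = (\<lambda>s. sgl s 1) ` {..<l}"
  proof (intro equalityI subsetI)
    fix m assume m: "m \<in> monomials_below l 1"
    then have "m \<noteq> 0" by (auto simp: monomials_below_def)
    then obtain s where "m = sgl s 1" using m mdeg_le_1_cases[of m] by (auto simp: monomials_below_def)
    then show "m \<in> (\<lambda>s. sgl s 1) ` {..<l}" using m by (auto simp: monomials_below_def)
  qed (auto simp: monomials_below_def)
  moreover have "inj_on (\<lambda>s. sgl s (1::nat)) {..<l}"
    by (intro inj_onI) (metis keys_single singleton_inject zero_neq_one)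
  ultimately show ?thesis by (simp add: card_image)
qed

text \<open>Induction on the last variable \<open>l\<close>: the quadratic monomials containing it
  correspond to the \<open>l + 1\<close> variables.\<close>

lemma card_monomials_below_2: "2 * card (monomials_below l 2) = l * (l + 1)"
proof (induction l)
  case 0
  have "monomials_below 0 2 = {}" by (auto simp: monomials_below_def)
  then show ?case by simp
next
  case (Suc l)
  let ?f = "\<lambda>m. sgl l 1 + m"
  have "monomials_below (Suc l) 2 = monomials_below l 2 \<union> ?f ` monomials_below (Suc l) 1"
  proof (intro equalityI subsetI)
    fix m assume m: "m \<in> monomials_below (Suc l) 2"
    show "m \<in> monomials_below l 2 \<union> ?f ` monomials_below (Suc l) 1"
    proof (cases "l \<in> keys m")
      case True
      then have "m = ?f (m - sgl l 1)"
        by (intro poly_mapping_eqI) (auto simp: lookup_add lookup_minus lookup_single when_def in_keys_iff)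
      moreover from this have "mdeg m = 1 + mdeg (m - sgl l 1)" by (metis mdeg_add mdeg_single)
      moreover have "keys (m - sgl l 1) \<subseteq> keys m" by (auto simp: in_keys_iff lookup_minus)
      ultimately have "m - sgl l 1 \<in> monomials_below (Suc l) 1" "m = ?f (m - sgl l 1)"
        using m by (auto simp: monomials_below_def)
      then show ?thesis by blast
    next
      case False
      then show ?thesis using m by (auto simp: monomials_below_def less_Suc_eq)
    qed
  next
    fix m assume "m \<in> monomials_below l 2 \<union> ?f ` monomials_below (Suc l) 1"
    then show "m \<in> monomials_below (Suc l) 2"
      by (auto simp: monomials_below_def keys_add_exponents mdeg_add)
  qed
  moreover have "monomials_below l 2 \<inter> ?f ` monomials_below (Suc l) 1 = {}"
    by (auto simp: monomials_below_def keys_add_exponents)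
  moreover have "card (?f ` monomials_below (Suc l) 1) = Suc l"
    using card_monomials_below_1 by (subst card_image) (auto simp: inj_on_def)
  ultimately have "card (monomials_below (Suc l) 2) = card (monomials_below l 2) + Suc l"
    by (simp add: card_Un_disjoint finite_monomials_below)
  then show ?case using Suc by simp
qed

text \<open>\<open>B\<close> lists the degrees in x_(n-1), x_n at the six vertices of the hexagon.
  The fibre over (b, c) consists of the monomials of degree 3 - b - c in the other l = n - 1
  variables, and the fibres add up to l(l + 1) + 2l + 2.\<close>

lemma card_togliatti_cubics:
  assumes n: "n \<ge> 3"
  shows "card (togliatti_cubics n) = n * (n + 1)"
proof -
  obtain l where l: "n = Suc l" using n by (cases n) auto
  define B :: "(nat \<times> nat) set" where "B = {(1, 0), (0, 1), (2, 0), (0, 2), (2, 1), (1, 2)}"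
  define s where "s = (\<lambda>(b, c). sgl l b + sgl n c :: nat \<Rightarrow>\<^sub>0 nat)"
  define F where "F x = {m \<in> togliatti_cubics n. (lookup m l, lookup m n) = x}" for x
  have F: "F x = (\<lambda>m. s x + m) ` monomials_below l (3 - (fst x + snd x))" if x: "x \<in> B" for x
  proof (intro equalityI subsetI)
    fix m assume m: "m \<in> F x"
    have m_eq: "m = s x + (m - s x)"
      using m l by (intro poly_mapping_eqI)
        (auto simp: F_def s_def lookup_add lookup_minus lookup_single when_def split: prod.splits)
    have "mdeg (s x) = fst x + snd x" by (auto simp: s_def mdeg_add split: prod.splits)
    then have "mdeg m = fst x + snd x + mdeg (m - s x)"
      using arg_cong[OF m_eq, of mdeg] by (simp only: mdeg_add)
    moreover have "mdeg m = 3" using m by (simp add: F_def togliatti_cubics_def cubics_def)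
    ultimately have "mdeg (m - s x) = 3 - (fst x + snd x)" by simp
    moreover have "keys (m - s x) \<subseteq> {..<l}"
    proof
      fix i assume i: "i \<in> keys (m - s x)"
      have "i \<noteq> l" "i \<noteq> n"
        using i m l by (auto simp: in_keys_iff lookup_minus lookup_add lookup_single when_def F_def s_def split: prod.splits)
      moreover have "i \<le> n"
        using i m by (auto simp: in_keys_iff lookup_minus F_def togliatti_cubics_def cubics_def subset_iff)
      ultimately show "i \<in> {..<l}" using l by simp
    qed
    ultimately have "m - s x \<in> monomials_below l (3 - (fst x + snd x))" by (simp add: monomials_below_def)
    then show "m \<in> (\<lambda>m. s x + m) ` monomials_below l (3 - (fst x + snd x))" using m_eq by blast
  next
    fix m assume "m \<in> (\<lambda>m. s x + m) ` monomials_below l (3 - (fst x + snd x))"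
    then obtain m' where m': "m = s x + m'" "keys m' \<subseteq> {..<l}" "mdeg m' = 3 - (fst x + snd x)"
      by (auto simp: monomials_below_def)
    have "l \<notin> keys m'" "n \<notin> keys m'" using m'(2) l by auto
    then have "lookup m' l = 0" "lookup m' n = 0" by (simp_all add: in_keys_iff)
    then have "lookup m l = fst x" "lookup m n = snd x"
      using l by (auto simp: m' s_def lookup_add lookup_single when_def split: prod.splits)
    moreover have "keys m \<subseteq> {..n}"
      using m'(2) l by (auto simp: m'(1) s_def keys_add_exponents split: prod.splits if_splits)
    moreover have "mdeg m = 3"
      using x m'(3) by (auto simp: m'(1) s_def mdeg_add B_def split: prod.splits)
    ultimately show "m \<in> F x" using x l by (auto simp: F_def togliatti_cubics_def cubics_def B_def)
  qed
  have card_F: "card (F x) = card (monomials_below l (3 - (fst x + snd x)))" if "x \<in> B" for x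
    unfolding F[OF that] by (rule card_image) (simp add: inj_on_def)
  have "togliatti_cubics n = (\<Union>x\<in>B. F x)"
  proof (intro equalityI subsetI)
    fix m assume m: "m \<in> togliatti_cubics n"
    have "(\<Sum>i\<in>{l, n}. lookup m i) \<le> (\<Sum>i\<le>n. lookup m i)" using l by (intro sum_mono2) auto
    then have "lookup m l + lookup m n \<le> 3"
      using m l mdeg_superset[of "{..n}" m] by (simp add: togliatti_cubics_def cubics_def)
    moreover have "lookup m l \<in> {0, 1, 2}" "lookup m n \<in> {0, 1, 2}"
      "1 \<le> lookup m l + lookup m n" "\<not> (lookup m l = 1 \<and> lookup m n = 1)"
      using m l by (auto simp: togliatti_cubics_def cubics_def)
    ultimately have "(lookup m l, lookup m n) \<in> B" unfolding B_def by auto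
    then show "m \<in> (\<Union>x\<in>B. F x)" using m by (auto simp: F_def)
  qed (auto simp: F_def)
  moreover have "finite B" by (simp add: B_def)
  moreover have "\<forall>x\<in>B. finite (F x)" using F finite_monomials_below by simp
  moreover have "\<forall>x\<in>B. \<forall>y\<in>B. x \<noteq> y \<longrightarrow> F x \<inter> F y = {}" by (auto simp: F_def)
  ultimately have "card (togliatti_cubics n) = (\<Sum>x\<in>B. card (F x))" by (simp add: card_UN_disjoint)
  also have "\<dots> = (\<Sum>x\<in>B. card (monomials_below l (3 - (fst x + snd x))))" using card_F by simp
  also have "\<dots> = 2 * card (monomials_below l 2) + 2 * l + 2"
    using card_monomials_below_1[of l] card_monomials_below_0[of l] by (simp add: B_def)
  also have "\<dots> = n * (n + 1)" using card_monomials_below_2[of l] l by simp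
  finally show ?thesis .
qed

lemma dim_inverse_system:
  fixes I :: "(nat, 'a::field) mpoly set"
  shows "finite (standard_monomials J I d) \<Longrightarrow>
    vector_space.dim poly_scale (inverse_system J I d) = card (standard_monomials J I d)"
proof -
  let ?S = "standard_monomials J I d"
  let ?x = "xpow :: _ \<Rightarrow> (nat, 'a) mpoly"
  assume fin: "finite ?S"
  have inj: "inj_on ?x ?S"
    by (intro inj_onI) (metis keys_single singleton_inject zero_neq_one)
  have "mpoly_space.independent (?x ` ?S)"
  proof
    assume "mpoly_space.dependent (?x ` ?S)"
    then obtain u where u: "\<exists>v\<in>?x ` ?S. u v \<noteq> 0" "(\<Sum>v\<in>?x ` ?S. poly_scale (u v) v) = 0"
      unfolding mpoly_space.dependent_finite[OF finite_imageI[OF fin]] by (elim exE conjE)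
    then have "(\<Sum>m\<in>?S. Poly_Mapping.single m (u (?x m))) = 0"
      by (simp add: sum.reindex[OF inj] mult_single)
    then have "lookup (\<Sum>m\<in>?S. Poly_Mapping.single m (u (?x m))) k = 0" for k by simp
    then have "(if k \<in> ?S then u (?x k) else 0) = 0" for k
      using fin by (simp add: lookup_sum lookup_single when_def)
    then have "u (?x k) = 0" if "k \<in> ?S" for k using that by metis
    then show False using u by blast
  qed
  then have "vector_space.dim poly_scale (inverse_system J I d) = card (?x ` ?S)"
    unfolding inverse_system_def by (rule mpoly_space.dim_span_eq_card_independent)
  then show ?thesis by (simp add: card_image[OF inj])
qed

section \<open>The blow-up\<close>

definition centre_quadrics :: "nat \<Rightarrow> (nat \<Rightarrow>\<^sub>0 nat) set"
  where "centre_quadrics n = {sgl j 1 + sgl p 1 | j p. j \<le> n - 2 \<and> p \<in> {n - 1, n}} \<union> {sgl (n - 1) 1 + sgl n 1}"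

lemma centre_quadrics:
  assumes "n \<ge> 3" "x \<in> centre_quadrics n"
  shows "keys x \<subseteq> {..n}" "mdeg x = 2"
  using assms by (auto simp: centre_quadrics_def keys_add_exponents mdeg_add)

lemma finite_centre_quadrics: "n \<ge> 3 \<Longrightarrow> finite (centre_quadrics n)"
  by (rule finite_subset[OF _ card_monomials_of_degree_le(1)[of "{..n}" 2]]) (auto dest: centre_quadrics)

lemma add_centre_quadric_in_cubics:
  assumes "n \<ge> 3" "i \<le> n" "x \<in> centre_quadrics n"
  shows "sgl i 1 + x \<in> cubics n"
  using assms by (auto simp: centre_quadrics_def cubics_def keys_add_exponents mdeg_add lookup_add lookup_single when_def)

lemma cubics_decompose:
  assumes n: "n \<ge> 3" and m: "m \<in> cubics n"
  shows "\<exists>i\<le>n. \<exists>x\<in>centre_quadrics n. m = sgl i 1 + x"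
  using n m
proof (cases rule: cubics_cases)
  case (yyp j k p)
  then have "sgl k 1 + sgl p 1 \<in> centre_quadrics n" by (auto simp: centre_quadrics_def)
  then show ?thesis using yyp by (intro exI[of _ j]) (auto simp: add.assoc)
next
  case (ypp j p)
  then have "sgl j 1 + sgl p 1 \<in> centre_quadrics n" "p \<le> n" by (auto simp: centre_quadrics_def)
  moreover have "m = sgl p 1 + (sgl j 1 + sgl p 1)"
  proof -
    have "sgl p 1 + (sgl j 1 + sgl p 1) = sgl j 1 + (sgl p 1 + sgl p 1)" by (simp only: ac_simps)
    then show ?thesis unfolding ypp by (simp only: single_add[symmetric] one_add_one)
  qed
  ultimately show ?thesis by blast
next
  case (ypq j)
  have "sgl (n - 1) 1 + sgl n 1 \<in> centre_quadrics n" by (simp add: centre_quadrics_def)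
  then show ?thesis using ypq by (intro exI[of _ j]) (auto simp: add.assoc)
next
  case (qpp p q)
  then have "sgl q 1 + sgl p 1 = sgl (n - 1) 1 + sgl n 1" by (auto simp: doubleton_eq_iff add.commute)
  then have "sgl q 1 + sgl p 1 \<in> centre_quadrics n" by (simp add: centre_quadrics_def)
  moreover have "p \<le> n" using qpp by (auto simp: doubleton_eq_iff)
  moreover have "m = sgl p 1 + (sgl q 1 + sgl p 1)"
  proof -
    have "sgl p 1 + (sgl q 1 + sgl p 1) = sgl q 1 + (sgl p 1 + sgl p 1)" by (simp only: ac_simps)
    then show ?thesis unfolding qpp by (simp only: single_add[symmetric] one_add_one)
  qed
  ultimately show ?thesis by blast
qed

lemma centre_quadric_vanishes:
  assumes n: "n \<ge> 3" and x: "x \<in> centre_quadrics n" and v: "v \<in> y" "y \<in> blowup_centre n"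
  shows "mval v x = (0 :: 'a::field)"
proof -
  consider "v (n - 1) = 0" "v n = 0" | "\<And>i. i \<noteq> n - 1 \<Longrightarrow> v i = 0" | "\<And>i. i \<noteq> n \<Longrightarrow> v i = 0"
  proof -
    have "y \<in> {x \<in> proj_space {..n}. \<forall>v\<in>x. v (n - 1) = 0 \<and> v n = 0} \<or>
        y = proj_pt (\<lambda>i. if i = n - 1 then 1 else 0) \<or> y = proj_pt (\<lambda>i. if i = n then 1 else 0)"
      using v(2) by (auto simp: blowup_centre_def)
    then show thesis
    proof (elim disjE)
      assume "y = proj_pt (\<lambda>i. if i = n - 1 then 1 else 0)"
      then obtain c where "v = (\<lambda>i. c * (if i = n - 1 then 1 else 0))" using v(1) unfolding proj_pt_def by blast
      then show thesis using that(2) by simp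
    next
      assume "y = proj_pt (\<lambda>i. if i = n then 1 else 0)"
      then obtain c where "v = (\<lambda>i. c * (if i = n then 1 else 0))" using v(1) unfolding proj_pt_def by blast
      then show thesis using that(3) by simp
    qed (use that(1) v(1) in auto)
  qed
  then show ?thesis
    using x n by cases (auto simp: centre_quadrics_def mval_add)
qed

text \<open>The centre is a union of three coordinate subspaces; \<open>Z\<close> is the set of
  coordinates that may be nonzero on one of them.\<close>

lemma point_of_centre:
  fixes v :: "nat \<Rightarrow> 'a::field"
  assumes n: "n \<ge> 3" and Z: "Z \<in> {{..n - 2}, {n - 1}, {n}}" and v: "v \<in> affine_space Z" "v \<noteq> 0"
  shows "proj_pt v \<in> blowup_centre n"
proof -
  consider "Z = {..n - 2}" | l where "l \<in> {n - 1, n}" "Z = {l}" using Z by blast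
  then show ?thesis
  proof cases
    case 1
    then have "v \<in> affine_space {..n}" "v (n - 1) = 0" "v n = 0" using v n by (auto simp: affine_space_def)
    then show ?thesis
      using v(2) proj_pt_in_proj_space[of v "{..n}"] by (auto simp: blowup_centre_def proj_pt_def)
  next
    case 2
    have v_eq: "v i = v l * (if i = l then 1 else 0)" for i using v 2 by (simp add: affine_space_def)
    have "v l \<noteq> 0"
    proof
      assume "v l = 0"
      then have "v i = 0" for i using v_eq[of i] by simp
      then show False using v(2) by (simp add: fun_eq_iff)
    qed
    then have "proj_pt v = proj_pt (\<lambda>i. if i = l then 1 else 0)" by (rule proj_pt_eqI[OF _ v_eq])
    then show ?thesis using 2 by (auto simp: blowup_centre_def)
  qed
qed

text \<open>A form vanishing on a coordinate subspace has no monomial in its variables alone, as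
  monomials are independent functions. So each monomial of a form in the vanishing ideal involves
  one of the last two variables and a second variable, and their product is one of the
  quadrics.\<close>

lemma ideal_of_centre:
  fixes n e :: nat
  assumes n: "n \<ge> 3" and e: "e \<ge> 2"
  defines "G \<equiv> xpow ` centre_quadrics n :: (nat, 'a::field_char_0) mpoly set"
  shows "genideal (poly_ring {..n}) G \<inter> forms {..n} e =
    vanishing_ideal {..n} (blowup_centre n) \<inter> forms {..n} e"
proof (intro equalityI subsetI IntI; elim IntE)
  have G: "G \<subseteq> carrier (poly_ring {..n})"
    using centre_quadrics[OF n] unfolding G_def by (auto intro!: xpow_in_carrier)
  fix p :: "(nat, 'a) mpoly" assume p: "p \<in> forms {..n} e"
  show "p \<in> forms {..n} e" "p \<in> forms {..n} e" by (rule p)+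
  {
    assume "p \<in> genideal (poly_ring {..n}) G"
    moreover have "genideal (poly_ring {..n}) G \<subseteq>
        monomial_ideal {..n} (\<lambda>m. \<exists>x\<in>centre_quadrics n. \<exists>m'. m = x + m')"
    proof (rule genideal_subset_monomial_ideal)
      show "\<exists>x\<in>centre_quadrics n. \<exists>k. m + m' = x + k" if "\<exists>x\<in>centre_quadrics n. \<exists>k. m = x + k" for m m'
        using that by (metis add.assoc)
      show "G \<subseteq> monomial_ideal {..n} (\<lambda>m. \<exists>x\<in>centre_quadrics n. \<exists>m'. m = x + m')"
        unfolding G_def using centre_quadrics[OF n]
        by (auto intro!: xpow_in_monomial_ideal bexI exI[of _ "0 :: nat \<Rightarrow>\<^sub>0 nat"])
    qed
    ultimately have p': "p \<in> monomial_ideal {..n} (\<lambda>m. \<exists>x\<in>centre_quadrics n. \<exists>m'. m = x + m')" by blast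
    have "peval v p = 0" if "v \<in> y" "y \<in> blowup_centre n" for v y
      unfolding peval_def_mval
    proof (intro sum.neutral ballI)
      fix m assume "m \<in> keys p"
      then obtain x m' where "x \<in> centre_quadrics n" "m = x + m'" using p' by (auto simp: monomial_ideal_def)
      then show "lookup p m * mval v m = 0" using centre_quadric_vanishes[OF n _ that] by (simp add: mval_add)
    qed
    then show "p \<in> vanishing_ideal {..n} (blowup_centre n)"
      using p by (auto simp: vanishing_ideal_def forms_def)
  }
  {
    assume van: "p \<in> vanishing_ideal {..n} (blowup_centre n)"
    have not_sub: "\<not> keys m \<subseteq> Z" if m: "m \<in> keys p" and Z: "Z \<in> {{..n - 2}, {n - 1}, {n}}" for m Z
    proof
      assume "keys m \<subseteq> Z"
      let ?S = "{m \<in> keys p. keys m \<subseteq> Z}"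
      have "\<forall>m\<in>?S. lookup p m = 0"
      proof (rule mono_functions_independent)
        show "finite ?S" by simp
        show "keys m \<subseteq> Z" if "m \<in> ?S" for m using that by simp
        fix v :: "nat \<Rightarrow> 'a" assume v: "v \<in> affine_space Z"
        have "peval v p = 0"
        \<comment> \<open>The zero vector is no projective point; there the degree
          \<open>e \<ge> 2\<close> excludes a constant term.\<close>
        proof (cases "v = 0")
          case True
          have "mval v m = 0" if "m \<in> keys p" for m
          proof -
            have "mdeg m = e" using that p by (simp add: forms_def)
            then have "keys m \<noteq> {}" using e by auto
            then show ?thesis using True by (auto simp: mval_eq_0_iff simp del: keys_eq_empty)
          qed
          then show ?thesis by (simp add: peval_def_mval)
        next
          case False
          then show ?thesis
            using van point_of_centre[OF n Z v False] self_in_proj_pt[of v] by (auto simp: vanishing_ideal_def)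
        qed
        moreover have "peval v p = (\<Sum>m\<in>?S. lookup p m * mval v m)"
          unfolding peval_def_mval
        proof (rule sum.mono_neutral_right)
          show "\<forall>m\<in>keys p - ?S. lookup p m * mval v m = 0"
          proof
            fix m assume "m \<in> keys p - ?S"
            then obtain i where "i \<in> keys m" "i \<notin> Z" by auto
            then have "mval v m = 0" using v by (auto simp: mval_eq_0_iff affine_space_def)
            then show "lookup p m * mval v m = 0" by simp
          qed
        qed auto
        ultimately show "(\<Sum>m\<in>?S. lookup p m * mval v m) = 0" by simp
      qed
      then show False using m \<open>keys m \<subseteq> Z\<close> by (auto simp: in_keys_iff)
    qed
    have summand: "Poly_Mapping.single m (lookup p m) \<in> genideal (poly_ring {..n}) G" if m: "m \<in> keys p" for m
    proof -
      have keys: "keys m \<subseteq> {..n}" using m p by (auto simp: forms_def poly_ring_def)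
      obtain i j where ij: "i \<in> keys m" "j \<in> keys m" "i \<noteq> j" "sgl i 1 + sgl j 1 \<in> centre_quadrics n"
      proof -
        have "\<exists>i\<in>keys m. i \<notin> {..n - 2}" using not_sub[OF m, of "{..n - 2}"] by auto
        then obtain l where l: "l \<in> keys m" "l \<in> {n - 1, n}" using keys by fastforce
        then obtain i where i: "i \<in> keys m" "i \<noteq> l" using not_sub[OF m, of "{l}"] by blast
        show thesis
        proof (cases "i \<le> n - 2")
          case True
          then show thesis using that[OF i(1) l(1) i(2)] l(2) by (auto simp: centre_quadrics_def)
        next
          case False
          have "i \<le> n" using keys i by auto
          then have "{i, l} = {n - 1, n}" using False i l by auto
          then have "sgl i 1 + sgl l 1 = sgl (n - 1) 1 + sgl n 1"
            by (auto simp: doubleton_eq_iff add.commute)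
          then show thesis using that[OF i(1) l(1) i(2)] by (simp add: centre_quadrics_def)
        qed
      qed
      let ?x = "sgl i 1 + sgl j 1"
      have "m = (m - ?x) + ?x"
        using ij(1-3) by (intro poly_mapping_eqI) (auto simp: lookup_add lookup_minus lookup_single when_def in_keys_iff)
      then have "Poly_Mapping.single m (lookup p m) = Poly_Mapping.single (m - ?x) (lookup p m) * xpow ?x"
        by (simp add: mult_single)
      moreover have "keys (m - ?x) \<subseteq> keys m" by (auto simp: in_keys_iff lookup_minus)
      then have "keys (m - ?x) \<subseteq> {..n}" using keys by blast
      then have "Poly_Mapping.single (m - ?x) (lookup p m) \<in> carrier (poly_ring {..n})" by (rule xpow_in_carrier)
      moreover have "xpow ?x \<in> genideal (poly_ring {..n}) G"
        using genideal_poly_ring(2)[OF G] ij(4) unfolding G_def by blast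
      ultimately show ?thesis using ideal.I_l_closed[OF genideal_poly_ring(1)[OF G]] by fastforce
    qed
    have "(\<Sum>m\<in>keys p. Poly_Mapping.single m (lookup p m)) \<in> genideal (poly_ring {..n}) G"
      by (rule sum_in_ideal[OF genideal_poly_ring(1)[OF G] summand])
    then show "p \<in> genideal (poly_ring {..n}) G" by (simp only: sum_single_lookup)
  }
qed

text \<open>The Segre coordinate (i, l) of the graph is x_i times the quadric \<open>q l\<close>, so
  the blow-up is again the closure of the image of a monomial map, now with repeated coordinates,
  and \<open>isomorphic_toric_families\<close> applies.\<close>

lemma blowup_isomorphic:
  fixes X :: "('k \<Rightarrow> 'a::field_char_0) set set"
  assumes n: "n \<ge> 3" and K: "finite K" "e ` K = togliatti_cubics n"
    and X: "X = image_closure {..n} K (\<lambda>k. xpow (e k))"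
  shows "\<exists>r B. is_blowup {..n} (blowup_centre n) r B \<and> isomorphic K X ({..n} \<times> {..r}) B"
proof -
  obtain q where q: "bij_betw q {0..<card (centre_quadrics n)} (centre_quadrics n)"
    using ex_bij_betw_nat_finite[OF finite_centre_quadrics[OF n]] by blast
  define r where "r = card (centre_quadrics n) - 1"
  have "card (centre_quadrics n) > 0"
    using finite_centre_quadrics[OF n] by (auto simp: card_gt_0_iff centre_quadrics_def)
  then have r: "{0..<card (centre_quadrics n)} = {..r}" by (auto simp: r_def)
  then have q_image: "q ` {..r} = centre_quadrics n" using q by (simp add: bij_betw_def)
  have q_in: "q l \<in> centre_quadrics n" if "l \<le> r" for l using q_image that by blast
  define e' where "e' = (\<lambda>(i, l). sgl i 1 + q l)"
  define f where "f l = (xpow (q l) :: (nat, 'a) mpoly)" for l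
  let ?L = "{..n} \<times> {..r}"
  define B where "B = (image_closure {..n} ?L (\<lambda>k. xpow (e' k)) :: (nat \<times> nat \<Rightarrow> 'a) set set)"
  have "e' ` ?L = cubics n"
  proof (intro equalityI subsetI)
    show "m \<in> cubics n" if "m \<in> e' ` ?L" for m
      using that add_centre_quadric_in_cubics[OF n] q_in by (auto simp: e'_def)
    fix m assume "m \<in> cubics n"
    then obtain i x where "i \<le> n" "x \<in> centre_quadrics n" "m = sgl i 1 + x" using cubics_decompose[OF n] by blast
    moreover from this obtain l where "l \<le> r" "x = q l" using q_image by auto
    ultimately show "m \<in> e' ` ?L" by (intro image_eqI[of _ _ "(i, l)"]) (auto simp: e'_def)
  qed
  then have "isomorphic K X ?L B"
    unfolding X B_def using n K
    by (intro isomorphic_toric_families[OF toric_family_cubics toric_family_cubics])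
      (auto simp: togliatti_cubics_def)
  moreover have "is_blowup {..n} (blowup_centre n) r B"
  proof -
    have forms: "f l \<in> forms {..n} 2" if "l \<le> r" for l
      unfolding f_def using centre_quadrics[OF n q_in[OF that]] by (rule monomial_in_forms)
    have "f ` {..r} = xpow ` centre_quadrics n" by (simp add: f_def image_image flip: q_image)
    then have ideal: "genideal (poly_ring {..n}) (f ` {..r}) \<inter> forms {..n} d =
        vanishing_ideal {..n} (blowup_centre n) \<inter> forms {..n} d" if "d \<ge> 2" for d
      using ideal_of_centre[OF n that] by simp
    let ?f = "eval_tuple {..r} f" and ?g = "eval_tuple ?L (\<lambda>k. xpow (e' k)) :: (nat \<Rightarrow> 'a) \<Rightarrow> _"
    have g: "?g v = (\<lambda>(i, l). v i * ?f v l)" if "v \<in> affine_space {..n}" for v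
      using that by (auto simp: eval_tuple_def f_def e'_def peval_monomial mval_add affine_space_def fun_eq_iff)
    \<comment> \<open>The graph omits the common zeros of the quadrics, the image those of their
      products with the variables; these sets agree because a quadric nonzero at \<open>v\<close>
      involves a variable nonzero at \<open>v\<close>.\<close>
    have neq0: "?g v \<noteq> 0 \<longleftrightarrow> ?f v \<noteq> 0" if v: "v \<in> affine_space {..n}" for v
    proof
      assume "?f v \<noteq> 0"
      then obtain l where l: "?f v l \<noteq> 0" by (auto simp: fun_eq_iff)
      then have "l \<le> r" "mval v (q l) \<noteq> 0"
        by (auto simp: eval_tuple_def f_def peval_monomial split: if_splits)
      moreover have "q l \<noteq> 0" using centre_quadrics(2)[OF n q_in[OF \<open>l \<le> r\<close>]] by auto
      then obtain i where "i \<in> keys (q l)" by (metis all_not_in_conv keys_eq_empty)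
      ultimately have "v i \<noteq> 0" by (auto simp: mval_eq_0_iff)
      then have "?g v (i, l) \<noteq> 0" using l by (simp add: g[OF v])
      then show "?g v \<noteq> 0" by (metis zero_fun_apply)
    next
      assume "?g v \<noteq> 0"
      then show "?f v \<noteq> 0" unfolding g[OF v] by (auto simp: fun_eq_iff)
    qed
    have "{proj_pt (?g v) | v. v \<in> affine_space {..n} \<and> ?g v \<noteq> 0} =
        {segre v (?f v) | v. v \<in> affine_space {..n} \<and> ?f v \<noteq> 0}"
    proof (rule Collect_cong, rule ex_cong1)
      fix y v
      show "(y = proj_pt (?g v) \<and> v \<in> affine_space {..n} \<and> ?g v \<noteq> 0) \<longleftrightarrow>
          (y = segre v (?f v) \<and> v \<in> affine_space {..n} \<and> ?f v \<noteq> 0)"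
      proof (cases "v \<in> affine_space {..n}")
        case True
        then show ?thesis using neq0[OF True] unfolding segre_def g[OF True] by blast
      qed blast
    qed
    then have "B = zariski ?L closure_of {segre v (?f v) | v. v \<in> affine_space {..n} \<and> ?f v \<noteq> 0}"
      by (simp add: B_def image_closure_def)
    with forms ideal show ?thesis
      unfolding is_blowup_def by (intro exI[of _ 2] exI[of _ f]) simp
  qed
  ultimately show ?thesis by blast
qed

theorem mainTheorem3:
  fixes n N :: nat
    and I :: "(nat, 'a::{alg_closed_field, field_char_0}) mpoly set"
  assumes "n \<ge> 3"
    and "N = n * (n + 1) - 1"
    and "I = togliatti_ideal n"
  shows "vector_space.dim poly_scale (inverse_system {..n} I 3) = n * (n + 1) \<and>
    (\<forall>e X. bij_betw e {..N} (standard_monomials {..n} I 3) \<and>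
        X = image_closure {..n} {..N} (\<lambda>j. Poly_Mapping.single (e j) (1::'a)) \<longrightarrow>
      smooth_variety {..N} n X \<and>
      (\<exists>r B. is_blowup {..n} (blowup_centre n) r B \<and> isomorphic {..N} X ({..n} \<times> {..r}) B) \<and>
      laplace_equation_order_2 {..N} X)"
proof (intro conjI allI impI; (elim conjE)?)
  note n = assms(1)
  have std: "standard_monomials {..n} I 3 = togliatti_cubics n"
    unfolding assms(3) by (rule standard_monomials_togliatti[OF n])
  have card: "card (togliatti_cubics n) = n * (n + 1)" by (rule card_togliatti_cubics[OF n])
  then have "finite (togliatti_cubics n)" using n by (intro card_ge_0_finite) simp
  then show "vector_space.dim poly_scale (inverse_system {..n} I 3) = n * (n + 1)"
    using dim_inverse_system[of "{..n}" I 3] std card by simp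
  fix e and X :: "(nat \<Rightarrow> 'a) set set"
  assume e: "bij_betw e {..N} (standard_monomials {..n} I 3)"
    and X: "X = image_closure {..n} {..N} (\<lambda>j. Poly_Mapping.single (e j) (1::'a))"
  have e_image: "e ` {..N} = togliatti_cubics n" using e by (simp add: bij_betw_def std)
  interpret F: toric_family "{..n}" "cubics n" 3 "chart_set n" origin "directions n" "edge n"
    "chart_exponents n" "source_exponents n" source_scaling "{..N}" e
    using e_image by (intro toric_family_cubics[OF n]) (auto simp: togliatti_cubics_def)
  show "smooth_variety {..N} n X" unfolding X by (rule F.smooth_variety_X) (simp_all add: card_directions)
  show "\<exists>r B. is_blowup {..n} (blowup_centre n) r B \<and> isomorphic {..N} X ({..n} \<times> {..r}) B"
    by (rule blowup_isomorphic[OF n _ e_image X]) simp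
  show "laplace_equation_order_2 {..N} X"
    unfolding X
  proof (rule F.laplace_equation_X)
    \<comment> \<open>In the chart at x_0^2 x_(n-1) the coordinates \<open>n - 1\<close> and
      \<open>n\<close> are x_(n-1) / x_0 and x_n / x_(n-1), whose exponents are the ones related by
      the conic.\<close>
    show "(True, 0, n - 1) \<in> chart_set n" by (simp add: chart_set_def)
    show "n - 1 \<in> directions n (True, 0, n - 1)" "n \<in> directions n (True, 0, n - 1)" "n - 1 \<noteq> n"
      using n by auto
    show "chart_exponents n (True, 0, n - 1) (e k) (n - 1) * (chart_exponents n (True, 0, n - 1) (e k) (n - 1) - 1) +
        chart_exponents n (True, 0, n - 1) (e k) n * (chart_exponents n (True, 0, n - 1) (e k) n - 1) =
        chart_exponents n (True, 0, n - 1) (e k) (n - 1) * chart_exponents n (True, 0, n - 1) (e k) n"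
      if "k \<in> {..N}" for k
      by (rule togliatti_relation[OF n]) (use e_image that in blast)
  qed (simp_all add: card_directions)
qed

end
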